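(* The following isomorphisms of $\mathfrak g_0$-modules hold. (a) For every $\lambda=(\lambda_1,\lambda_2)\in P^+_{\mathfrak b_{(1)}}$, $$K_{\mathfrak b_{(1)}}(\lambda_1,\lambda_2)\cong L_{\mathfrak{gl}}(\lambda_1,\lambda_2)\oplus L_{\mathfrak{gl}}(\lambda_1-1,\lambda_2)\oplus L_{\mathfrak{gl}}(\lambda_1,\lambda_2+1)\oplus L_{\mathfrak{gl}}(\lambda_1-1,\lambda_2-1)^{\oplus(1-\delta_{\lambda_2,0})}.$$ (b) For every $\lambda=(\lambda_1,\lambda_2)\in P^+_{\mathfrak b_{(3)}}$, $$K_{\mathfrak b_{(3)}}(\lambda_1,\lambda_2)\cong L_{\mathfrak{gl}}(\lambda_1,\lambda_2)\oplus L_{\mathfrak{gl}}(\lambda_1+1,\lambda_2)\oplus L_{\mathfrak{gl}}(\lambda_1+1,\lambda_2+1)\oplus L_{\mathfrak{gl}}(\lambda_1,\lambda_2-1)^{\oplus(1-\delta_{\lambda_2,0})}.$$ (c) For every $\lambda=(\lambda_1,\lambda_2)\in P^+_{\mathfrak b_{(2)}}$ with $\lambda\neq0$, $$K_{\mathfrak b_{(2)}}(\lambda_1,\lambda_2)\cong L_{\mathfrak{gl}}(\lambda_1,\lambda_2-1)\oplus L_{\mathfrak{gl}}(\lambda_1-1,\lambda_2-1)\oplus L_{\mathfrak{gl}}(\lambda_1,\lambda_2)\oplus L_{\mathfrak{gl}}(\lambda_1-1,\lambda_2-2)^{\oplus(1-\delta_{\lambda_2,1})}.$$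
   Context: All vector spaces are over $\mathbb C$. $\mathfrak g=\mathfrak{sl}(1|2)$ is the Lie superalgebra of $3\times 3$ complex matrices $A=(a_{ij})$ with $a_{11}-a_{22}-a_{33}=0$; the even part $\mathfrak g_0\cong\mathfrak{gl}(2)$ consists of block-diagonal matrices (blocks of size $1$ and $2$), the odd part of block-off-diagonal matrices, and $[A,B]=AB-(-1)^{\bar i\bar j}BA$ for $A,B$ of parity $\bar i,\bar j$. Let $E_{i,j}$ be the matrix units, $x_1=E_{1,2}$, $x_2=E_{2,3}$, $x_3=E_{1,3}$, $y_i=x_i^t$ (transpose), $h_1=E_{1,1}+E_{2,2}$, $h_2=E_{2,2}-E_{3,3}$, $\mathfrak h=\mathrm{span}\{h_1,h_2\}$. A weight $\lambda\in\mathfrak h^*$ is identified with $(\lambda_1,\lambda_2)=(\lambda(h_1),\lambda(h_2))\in\mathbb C^2$. The Borel subalgebras are $\mathfrak b_{(i)}=\mathfrak h\oplus\mathfrak n_{(i)}^+$ with $\mathfrak n^+_{(1)}=\mathrm{span}\{x_1,x_2,x_3\}$, $\mathfrak n^+_{(2)}=\mathrm{span}\{y_1,x_2,x_3\}$, $\mathfrak n^+_{(3)}=\mathrm{span}\{y_1,x_2,y_3\}$; all have even part $\mathfrak b_0=\mathfrak h\oplus\mathbb Cx_2$. $L_{\mathfrak{gl}}(\lambda)$ is the irreducible $\mathfrak g_0$-module of $\mathfrak b_0$-highest weight $\lambda$. $P^+_{\mathfrak b}$ is the set of $\lambda\in\mathfrak h^*$ such that the irreducible $\mathfrak g$-module of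 highest weight $\lambda$ with respect to $\mathfrak b$ is finite dimensional. For $\mathfrak b=\mathfrak h\oplus\mathfrak n^+$ equal to one of the three Borel subalgebras $\mathfrak b_{(1)},\mathfrak b_{(2)},\mathfrak b_{(3)}$ (so that $\mathfrak n^+$ is, respectively, $\mathfrak n^+_{(1)},\mathfrak n^+_{(2)},\mathfrak n^+_{(3)}$) and $\lambda\in P^+_{\mathfrak b}$, the generalized Kac module $K_{\mathfrak b}(\lambda)$ is the quotient of $\mathbf U(\mathfrak g)$ by the left ideal generated by $\mathfrak n^+$, $h-\lambda(h)$ ($h\in\mathfrak h$) and $y_2^{\lambda_2+1}$. In the exponents, $\delta_{i,j}$ is the Kronecker delta and $L^{\oplus 0}=0$. *)

theory Defs
  imports
    "HOL-Analysis.Cartesian_Space"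
    "HOL-Algebra.QuotRing"
    "HOL-Algebra.Module"
    "HOL-Algebra.Algebraic_Closure_Type"
    "HOL-Library.Poly_Mapping"
begin

section \<open>The Lie superalgebra \<open>sl(1|2)\<close>\<close>

type_synonym mat3 = "complex^3^3"

definition cscale :: "complex \<Rightarrow> mat3 \<Rightarrow> mat3" where
  "cscale c A = (\<chi> i j. c * A $ i $ j)"

definition sl12 :: "mat3 set" where
  "sl12 = {A. A $ 1 $ 1 - A $ 2 $ 2 - A $ 3 $ 3 = 0}"

text \<open>Index 1 forms the block of size 1, indices 2 and 3 the block of size 2;
  \<open>sl12_part 0\<close> is the even part (isomorphic to \<open>gl(2)\<close>) and \<open>sl12_part 1\<close> the odd part.\<close>

definition sl12_part :: "nat \<Rightarrow> mat3 set" where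
  "sl12_part p =
    (if p = 0 then {A \<in> sl12. \<forall>i j. (i = 1) \<noteq> (j = 1) \<longrightarrow> A $ i $ j = 0}
     else {A \<in> sl12. \<forall>i j. (i = 1) = (j = 1) \<longrightarrow> A $ i $ j = 0})"

abbreviation gl2 :: "mat3 set" where
  "gl2 \<equiv> sl12_part 0"

text \<open>The bracket of homogeneous elements \<open>A\<close>, \<open>B\<close> of parities \<open>p\<close>, \<open>q\<close>; all axioms below
  involving the bracket are stated for homogeneous elements.\<close>

definition sbracket :: "nat \<Rightarrow> nat \<Rightarrow> mat3 \<Rightarrow> mat3 \<Rightarrow> mat3" where
  "sbracket p q A B = A ** B - cscale ((- 1) ^ (p * q)) (B ** A)"

definition E :: "3 \<Rightarrow> 3 \<Rightarrow> mat3" where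
  "E i j = (\<chi> a b. if a = i \<and> b = j then 1 else 0)"

definition x1 :: mat3 where "x1 = E 1 2"
definition x2 :: mat3 where "x2 = E 2 3"
definition x3 :: mat3 where "x3 = E 1 3"
definition y1 :: mat3 where "y1 = transpose x1"
definition y2 :: mat3 where "y2 = transpose x2"
definition y3 :: mat3 where "y3 = transpose x3"
definition h1 :: mat3 where "h1 = E 1 1 + E 2 2"
definition h2 :: mat3 where "h2 = E 2 2 - E 3 3"

text \<open>A weight \<open>\<lambda>\<close> is the pair \<open>(\<lambda>(h1), \<lambda>(h2))\<close>, so
  \<open>\<lambda>(a h1 + b h2) = a \<lambda>\<^sub>1 + b \<lambda>\<^sub>2\<close>.\<close>

type_synonym weight = "complex \<times> complex"

definition cartan :: "complex \<Rightarrow> complex \<Rightarrow> mat3" where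
  "cartan a b = cscale a h1 + cscale b h2"

definition weight_eval :: "weight \<Rightarrow> complex \<Rightarrow> complex \<Rightarrow> complex" where
  "weight_eval l a b = a * fst l + b * snd l"

definition mspan :: "mat3 set \<Rightarrow> mat3 set" where
  "mspan S = {\<Sum>A\<in>T. cscale (c A) A | T c. finite T \<and> T \<subseteq> S}"

datatype borel = Borel1 | Borel2 | Borel3

fun nplus :: "borel \<Rightarrow> mat3 set" where
  "nplus Borel1 = mspan {x1, x2, x3}"
| "nplus Borel2 = mspan {y1, x2, x3}"
| "nplus Borel3 = mspan {y1, x2, y3}"

definition nplus0 :: "mat3 set" where
  "nplus0 = mspan {x2}"


section \<open>Modules\<close>

text \<open>Modules are ungraded. This loses nothing: \<open>diag(2,1,1)\<close> lies in the Cartan subalgebra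
  and separates the parities of weight spaces of a highest weight module, so every submodule of
  such a module is automatically homogeneous. The fields \<^const>\<open>monoid.mult\<close> and
  \<^const>\<open>monoid.one\<close>, which the library's module record inherits from rings, are irrelevant.\<close>

record 'v lmod = "(complex, 'v) module" +
  act :: "mat3 \<Rightarrow> 'v \<Rightarrow> 'v"

abbreviation complex_ring :: "complex ring" where
  "complex_ring \<equiv> ring_of_type_algebra"

text \<open>Here \<open>k\<close> is a graded Lie subsuperalgebra of \<open>sl(1|2)\<close>.\<close>

definition lie_module :: "mat3 set \<Rightarrow> 'v lmod \<Rightarrow> bool" where
  "lie_module k V \<longleftrightarrow>
     Module.module complex_ring V \<and>
     (\<forall>A\<in>k. \<forall>v\<in>carrier V. act V A v \<in> carrier V) \<and>
     (\<forall>A\<in>k. \<forall>v\<in>carrier V. \<forall>w\<in>carrier V.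
        act V A (v \<oplus>\<^bsub>V\<^esub> w) = act V A v \<oplus>\<^bsub>V\<^esub> act V A w) \<and>
     (\<forall>A\<in>k. \<forall>c. \<forall>v\<in>carrier V. act V A (c \<odot>\<^bsub>V\<^esub> v) = c \<odot>\<^bsub>V\<^esub> act V A v) \<and>
     (\<forall>A\<in>k. \<forall>B\<in>k. \<forall>v\<in>carrier V. act V (A + B) v = act V A v \<oplus>\<^bsub>V\<^esub> act V B v) \<and>
     (\<forall>A\<in>k. \<forall>c. \<forall>v\<in>carrier V. act V (cscale c A) v = c \<odot>\<^bsub>V\<^esub> act V A v) \<and>
     (\<forall>p\<in>{0, 1}. \<forall>q\<in>{0, 1}. \<forall>A\<in>k \<inter> sl12_part p. \<forall>B\<in>k \<inter> sl12_part q. \<forall>v\<in>carrier V.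
        act V (sbracket p q A B) v =
          act V A (act V B v) \<ominus>\<^bsub>V\<^esub> ((- 1) ^ (p * q)) \<odot>\<^bsub>V\<^esub> act V B (act V A v))"

definition lie_submodule :: "mat3 set \<Rightarrow> 'v set \<Rightarrow> 'v lmod \<Rightarrow> bool" where
  "lie_submodule k W V \<longleftrightarrow>
     submodule W complex_ring V \<and> (\<forall>A\<in>k. \<forall>w\<in>W. act V A w \<in> W)"

definition irreducible_module :: "mat3 set \<Rightarrow> 'v lmod \<Rightarrow> bool" where
  "irreducible_module k V \<longleftrightarrow>
     lie_module k V \<and> carrier V \<noteq> {\<zero>\<^bsub>V\<^esub>} \<and>
     (\<forall>W. lie_submodule k W V \<longrightarrow> W = {\<zero>\<^bsub>V\<^esub>} \<or> W = carrier V)"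

definition highest_weight_vector :: "mat3 set \<Rightarrow> weight \<Rightarrow> 'v lmod \<Rightarrow> 'v \<Rightarrow> bool" where
  "highest_weight_vector n l V v \<longleftrightarrow>
     v \<in> carrier V \<and> v \<noteq> \<zero>\<^bsub>V\<^esub> \<and>
     (\<forall>A\<in>n. act V A v = \<zero>\<^bsub>V\<^esub>) \<and>
     (\<forall>a b. act V (cartan a b) v = weight_eval l a b \<odot>\<^bsub>V\<^esub> v)"

definition irreducible_hw_module :: "mat3 set \<Rightarrow> mat3 set \<Rightarrow> weight \<Rightarrow> 'v lmod \<Rightarrow> bool" where
  "irreducible_hw_module k n l V \<longleftrightarrow>
     irreducible_module k V \<and> (\<exists>v. highest_weight_vector n l V v)"

definition finite_dimensional :: "'v lmod \<Rightarrow> bool" where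
  "finite_dimensional V \<longleftrightarrow>
     (\<exists>S. finite S \<and> S \<subseteq> carrier V \<and>
       (\<forall>v\<in>carrier V. \<exists>c. v = finsum V (\<lambda>s. c s \<odot>\<^bsub>V\<^esub> s) S))"

text \<open>An irreducible highest weight module exists for every weight, is unique up to isomorphism
  and has countable dimension. Hence it can be realised on a subset of
  \<^typ>\<open>nat \<Rightarrow> complex\<close>, and neither the choice in \<open>L_gl\<close> nor the existential
  quantifier in \<open>Pplus\<close> depends on the realisation.\<close>

definition L_gl :: "weight \<Rightarrow> (nat \<Rightarrow> complex) lmod" where
  "L_gl l = (SOME V. irreducible_hw_module gl2 nplus0 l V)"

definition Pplus :: "borel \<Rightarrow> weight set" where
  "Pplus b = {l. \<exists>V :: (nat \<Rightarrow> complex) lmod.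
     irreducible_hw_module sl12 (nplus b) l V \<and> finite_dimensional V}"

definition direct_sum :: "'v lmod list \<Rightarrow> 'v list lmod" where
  "direct_sum Vs =
    \<lparr>carrier = {vs. list_all2 (\<lambda>v V. v \<in> carrier V) vs Vs},
     monoid.mult = undefined, one = undefined,
     zero = map (\<lambda>V. \<zero>\<^bsub>V\<^esub>) Vs,
     add = (\<lambda>vs ws. map (\<lambda>i. vs ! i \<oplus>\<^bsub>Vs ! i\<^esub> ws ! i) [0..<length Vs]),
     module.smult = (\<lambda>c vs. map (\<lambda>i. c \<odot>\<^bsub>Vs ! i\<^esub> vs ! i) [0..<length Vs]),
     act = (\<lambda>A vs. map (\<lambda>i. act (Vs ! i) A (vs ! i)) [0..<length Vs])\<rparr>"

definition module_iso :: "mat3 set \<Rightarrow> 'v lmod \<Rightarrow> 'w lmod \<Rightarrow> bool" where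
  "module_iso k V W \<longleftrightarrow>
     (\<exists>f. bij_betw f (carrier V) (carrier W) \<and>
       (\<forall>v\<in>carrier V. \<forall>w\<in>carrier V. f (v \<oplus>\<^bsub>V\<^esub> w) = f v \<oplus>\<^bsub>W\<^esub> f w) \<and>
       (\<forall>c. \<forall>v\<in>carrier V. f (c \<odot>\<^bsub>V\<^esub> v) = c \<odot>\<^bsub>W\<^esub> f v) \<and>
       (\<forall>A\<in>k. \<forall>v\<in>carrier V. f (act V A v) = act W A (f v)))"


section \<open>The universal enveloping superalgebra\<close>

text \<open>The free monoid, written additively so that \<open>'a fword \<Rightarrow>\<^sub>0 complex\<close> is
  the free associative algebra on \<open>'a\<close>.\<close>

datatype 'a fword = FWord (letters: "'a list")

instantiation fword :: (type) monoid_add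
begin

definition zero_fword :: "'a fword" where
  "zero_fword = FWord []"

definition plus_fword :: "'a fword \<Rightarrow> 'a fword \<Rightarrow> 'a fword" where
  "plus_fword u w = FWord (letters u @ letters w)"

instance
  by standard (simp_all add: zero_fword_def plus_fword_def)

end

type_synonym free_alg = "mat3 fword \<Rightarrow>\<^sub>0 complex"

definition gen :: "mat3 \<Rightarrow> free_alg" where
  "gen A = Poly_Mapping.single (FWord [A]) 1"

definition scal :: "complex \<Rightarrow> free_alg" where
  "scal c = Poly_Mapping.single 0 c"

definition free_sl12 :: "free_alg ring" where
  "free_sl12 = ring_of_type_algebra
     \<lparr>carrier := {p. \<forall>w\<in>Poly_Mapping.keys p. set (letters w) \<subseteq> sl12}\<rparr>"

text \<open>The first two families of relations turn the free algebra on the set \<open>sl12\<close> into the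
  tensor algebra of the vector space \<open>sl12\<close>.\<close>

definition U_relations :: "free_alg set" where
  "U_relations =
     {gen (A + B) - gen A - gen B | A B. A \<in> sl12 \<and> B \<in> sl12} \<union>
     {gen (cscale c A) - scal c * gen A | c A. A \<in> sl12} \<union>
     {gen A * gen B - scal ((- 1) ^ (p * q)) * gen B * gen A - gen (sbracket p q A B)
       | p q A B. p \<in> {0, 1} \<and> q \<in> {0, 1} \<and> A \<in> sl12_part p \<and> B \<in> sl12_part q}"

definition U_ideal :: "free_alg set" where
  "U_ideal = Idl\<^bsub>free_sl12\<^esub> U_relations"

definition U :: "free_alg set ring" where
  "U = free_sl12 Quot U_ideal"

definition U_gen :: "mat3 \<Rightarrow> free_alg set" where
  "U_gen A = U_ideal +>\<^bsub>free_sl12\<^esub> gen A"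

definition U_scal :: "complex \<Rightarrow> free_alg set" where
  "U_scal c = U_ideal +>\<^bsub>free_sl12\<^esub> scal c"


section \<open>Generalized Kac modules\<close>

definition left_ideal :: "'a set \<Rightarrow> 'a ring \<Rightarrow> bool" where
  "left_ideal I R \<longleftrightarrow>
     additive_subgroup I R \<and> (\<forall>r\<in>carrier R. \<forall>a\<in>I. r \<otimes>\<^bsub>R\<^esub> a \<in> I)"

definition left_ideal_gen :: "'a ring \<Rightarrow> 'a set \<Rightarrow> 'a set" where
  "left_ideal_gen R S = \<Inter>{I. left_ideal I R \<and> S \<subseteq> I}"

text \<open>For \<open>l\<close> in \<open>Pplus b\<close> the second component is a natural number, so the exponent
  is exactly \<open>snd l + 1\<close>.\<close>

definition kac_ideal :: "borel \<Rightarrow> weight \<Rightarrow> free_alg set set" where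
  "kac_ideal b l = left_ideal_gen U
     (U_gen ` nplus b \<union>
      {U_gen (cartan s t) \<ominus>\<^bsub>U\<^esub> U_scal (weight_eval l s t) | s t. True} \<union>
      {U_gen y2 [^]\<^bsub>U\<^esub> (nat \<lfloor>Re (snd l)\<rfloor> + 1)})"

text \<open>Left multiplication on cosets of the left ideal, written as a union over representatives
  as in \<^const>\<open>rcoset_mult\<close>.\<close>

definition kac_module :: "borel \<Rightarrow> weight \<Rightarrow> free_alg set set lmod" where
  "kac_module b l =
    (let I = kac_ideal b l in
     \<lparr>carrier = a_rcosets\<^bsub>U\<^esub> I,
      monoid.mult = undefined, one = undefined,
      zero = I,
      add = set_add U,
      module.smult = (\<lambda>c C. \<Union>u\<in>C. I +>\<^bsub>U\<^esub> (U_scal c \<otimes>\<^bsub>U\<^esub> u)),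
      act = (\<lambda>A C. \<Union>u\<in>C. I +>\<^bsub>U\<^esub> (U_gen A \<otimes>\<^bsub>U\<^esub> u))\<rparr>)"

end

theory Submission
  imports Defs "HOL-Library.Function_Algebras" "HOL-Library.Product_Plus"
begin

text \<open>
  For the first Borel subalgebra the generalized Kac module of weight \<open>(m, n)\<close> is induced from the
  \<open>gl(2)\<close>-module $L = L_{gl}(m,n)$ on which \<open>x1\<close> and \<open>x3\<close> act by zero. The induced module is
  $\Lambda(y_1,y_3)\otimes L$, of dimension \<open>4 (n + 1)\<close>, and it has an explicit model (\<open>Ind\<close>). The model
  contains a vector satisfying the defining relations, so the Kac module maps to it
  (\<open>kac_module_embedding\<close>); this bounds the Kac module from below. Conversely, the generator of the Kac
  module generates a quotient of $L$ over \<open>gl(2)\<close>, so the induced module maps to the Kac module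
  (\<open>Phi_hom\<close>), onto because the generator is in the image. The two maps are mutually inverse
  (\<open>singular1_generated_iso_Ind\<close>).

  Over \<open>gl(2)\<close> the induced module is $L\oplus(\mathbb C^2\otimes L)\oplus(L\otimes\Lambda^2)$, and the
  middle summand splits by the Clebsch-Gordan rule, which is given by explicit formulas (\<open>CG\<close>). This is
  the asserted decomposition for the first Borel subalgebra.

  The third Borel subalgebra reduces to the first by an involution of \<open>sl(1|2)\<close> (\<open>invol\<close>) that
  exchanges them, preserves \<open>gl(2)\<close>, and sends the weight \<open>(a, b)\<close> to \<open>(b - a, b)\<close>.

  For the second Borel subalgebra and the weight \<open>(a, n + 1)\<close> with generator \<open>v\<close>, the vector \<open>x1 v\<close>
  satisfies the relations of the first Borel subalgebra with weight \<open>(a, n)\<close>, and \<open>y1 x1 v = a v\<close>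
  (an odd reflection). If \<open>a\<close> is nonzero, \<open>x1 v\<close> is therefore a generator and the module is
  the Kac module of weight \<open>(a, n)\<close> for the first Borel subalgebra (\<open>kac_like_Borel2_decomp\<close>).
  If \<open>a = 0\<close>, the involution fixes the second Borel subalgebra and turns \<open>a\<close> into \<open>n + 1\<close>, which is
  nonzero. Finite dimensionality forces the second weight component to be a natural number, and for the
  second Borel subalgebra it vanishes only for the weight zero (\<open>Pplus_dominant\<close>); this is where the
  condition on the weight enters.

  Modules are given as records with a carrier. They are moved into a type that is itself a complex vector
  space, with the Lie superalgebra acting by operators defined on the whole type
  (\<open>embed_lie_module\<close>), so that calculations are equations between vectors without side conditions.
\<close>

section \<open>Complex vector spaces\<close>

class cvec = ab_group_add +
  fixes cs :: "complex \<Rightarrow> 'a \<Rightarrow> 'a"  (infixr \<open>*\<^sub>c\<close> 75)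
  assumes cs_right_distrib: "a *\<^sub>c (x + y) = a *\<^sub>c x + a *\<^sub>c y"
    and cs_left_distrib: "(a + b) *\<^sub>c x = a *\<^sub>c x + b *\<^sub>c x"
    and cs_cs: "a *\<^sub>c b *\<^sub>c x = (a * b) *\<^sub>c x"
    and cs_one: "1 *\<^sub>c x = x"

interpretation cvec: vector_space "cs :: complex \<Rightarrow> 'a \<Rightarrow> 'a::cvec"
  by unfold_locales (simp_all add: cs_right_distrib cs_left_distrib cs_cs cs_one)

interpretation cvec: vector_space_pair "cs :: complex \<Rightarrow> 'a \<Rightarrow> 'a::cvec" "cs :: complex \<Rightarrow> 'b \<Rightarrow> 'b::cvec" ..

instantiation complex :: cvec
begin
definition cs_complex :: "complex \<Rightarrow> complex \<Rightarrow> complex" where "cs_complex = (*)"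
instance by standard (simp_all add: cs_complex_def algebra_simps)
end

instantiation "fun" :: (type, cvec) cvec
begin
definition cs_fun :: "complex \<Rightarrow> ('a \<Rightarrow> 'b) \<Rightarrow> 'a \<Rightarrow> 'b" where "cs_fun c f = (\<lambda>x. c *\<^sub>c f x)"
instance by standard (simp_all add: cs_fun_def cs_right_distrib cs_left_distrib cs_cs cs_one plus_fun_def)
end

instantiation prod :: (cvec, cvec) cvec
begin
definition cs_prod :: "complex \<Rightarrow> 'a \<times> 'b \<Rightarrow> 'a \<times> 'b" where "cs_prod c p = (c *\<^sub>c fst p, c *\<^sub>c snd p)"
instance by standard (simp_all add: cs_prod_def cs_right_distrib cs_left_distrib cs_cs cs_one)
end

abbreviation (input) "lookup \<equiv> Poly_Mapping.lookup"
abbreviation (input) "keys \<equiv> Poly_Mapping.keys"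
abbreviation (input) "single \<equiv> Poly_Mapping.single"

instantiation poly_mapping :: (type, cvec) cvec
begin
definition cs_poly_mapping :: "complex \<Rightarrow> ('a \<Rightarrow>\<^sub>0 'b) \<Rightarrow> 'a \<Rightarrow>\<^sub>0 'b" where
  "cs_poly_mapping c p = Poly_Mapping.map (cs c) p"
instance
proof -
  have l: "lookup (Poly_Mapping.map (cs c) p) k = c *\<^sub>c lookup p k"
    for c k and p :: "'a \<Rightarrow>\<^sub>0 'b"
    by (simp add: Poly_Mapping.map.rep_eq when_def)
  show "OFCLASS('a \<Rightarrow>\<^sub>0 'b, cvec_class)"
    by standard
      (simp_all add: cs_poly_mapping_def poly_mapping_eq_iff fun_eq_iff l lookup_add
        cs_right_distrib cs_left_distrib cs_cs cs_one)
qed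
end

lemma lookup_cs: "lookup (c *\<^sub>c p) k = c *\<^sub>c lookup p k"
  by (simp add: cs_poly_mapping_def Poly_Mapping.map.rep_eq when_def)

text \<open>Linear maps are stated by their two laws, because the operators of a representation are rewritten
  with these laws throughout; \<open>lin_iff_linear\<close> gives access to the library.\<close>

definition lin :: "('a::cvec \<Rightarrow> 'b::cvec) \<Rightarrow> bool" where
  "lin f \<longleftrightarrow> (\<forall>x y. f (x + y) = f x + f y) \<and> (\<forall>c x. f (c *\<^sub>c x) = c *\<^sub>c f x)"

lemma lin_iff_linear: "lin f \<longleftrightarrow> Vector_Spaces.linear cs cs f"
  unfolding lin_def Vector_Spaces.linear_iff
  by (rule iffI; elim conjE; intro conjI cvec.vector_space_axioms; assumption)

lemma
  assumes "lin f"
  shows lin_add: "f (x + y) = f x + f y" and lin_cs: "f (c *\<^sub>c x) = c *\<^sub>c f x"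
    and lin_zero: "f 0 = 0" and lin_minus: "f (- x) = - f x" and lin_diff: "f (x - y) = f x - f y"
    and lin_sum: "f (sum g T) = (\<Sum>i\<in>T. f (g i))"
proof -
  interpret Vector_Spaces.linear cs cs f using assms by (simp add: lin_iff_linear)
  show "f (x + y) = f x + f y" "f (c *\<^sub>c x) = c *\<^sub>c f x" "f 0 = 0" "f (- x) = - f x"
    "f (x - y) = f x - f y" "f (sum g T) = (\<Sum>i\<in>T. f (g i))"
    by (rule add scale zero neg diff sum)+
qed

lemma linI: "(\<And>x y. f (x + y) = f x + f y) \<Longrightarrow> (\<And>c x. f (c *\<^sub>c x) = c *\<^sub>c f x) \<Longrightarrow> lin f"
  by (simp add: lin_def)

section \<open>Matrices and superbrackets\<close>

text \<open>The infix \<open>$\<close> for entries also denotes coefficients of power series; the abbreviation avoids the ambiguity.\<close>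

abbreviation ent :: "mat3 \<Rightarrow> 3 \<Rightarrow> 3 \<Rightarrow> complex" where
  "ent A i j \<equiv> vec_nth (vec_nth A i) j"

lemma mat3_eq_iff: "(A::mat3) = B \<longleftrightarrow> (\<forall>i j. ent A i j = ent B i j)"
  by (simp add: vec_eq_iff)

lemma sl12_iff: "A \<in> sl12 \<longleftrightarrow> ent A 1 1 = ent A 2 2 + ent A 3 3"
  unfolding sl12_def by (simp only: mem_Collect_eq diff_diff_eq right_minus_eq)

lemma sl12_closed:
  "A \<in> sl12 \<Longrightarrow> B \<in> sl12 \<Longrightarrow> A + B \<in> sl12"
  "A \<in> sl12 \<Longrightarrow> cscale c A \<in> sl12"
  by (simp_all add: sl12_iff cscale_def distrib_left)

lemma part_subset: "sl12_part p \<subseteq> sl12"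
  by (auto simp: sl12_part_def)

lemma even_iff: "A \<in> gl2 \<longleftrightarrow> ent A 1 1 = ent A 2 2 + ent A 3 3 \<and>
    ent A 1 2 = 0 \<and> ent A 1 3 = 0 \<and> ent A 2 1 = 0 \<and> ent A 3 1 = 0"
  by (simp add: sl12_part_def sl12_iff forall_3)

lemma odd_iff: "A \<in> sl12_part (Suc 0) \<longleftrightarrow> ent A 1 1 = 0 \<and> ent A 2 2 = 0 \<and> ent A 3 3 = 0 \<and>
    ent A 2 3 = 0 \<and> ent A 3 2 = 0"
  by (simp add: sl12_part_def sl12_iff forall_3) fastforce

lemma part_closed:
  assumes "A \<in> sl12_part p"
  shows "B \<in> sl12_part p \<Longrightarrow> A + B \<in> sl12_part p" and "cscale c A \<in> sl12_part p"
proof -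
  have p: "sl12_part p = (if p = 0 then gl2 else sl12_part (Suc 0))"
    by (simp add: sl12_part_def)
  show "B \<in> sl12_part p \<Longrightarrow> A + B \<in> sl12_part p" and "cscale c A \<in> sl12_part p"
    using assms unfolding p
    by (simp_all add: even_iff odd_iff cscale_def distrib_left split: if_splits)
qed

lemma sbracket_nth: "ent (sbracket p q A B) i j =
    ent A i 1 * ent B 1 j + ent A i 2 * ent B 2 j + ent A i 3 * ent B 3 j
    - (- 1) ^ (p * q) * (ent B i 1 * ent A 1 j + ent B i 2 * ent A 2 j + ent B i 3 * ent A 3 j)"
  by (simp add: sbracket_def matrix_matrix_mult_def sum_3 cscale_def)

lemma sbracket_part:
  assumes "p \<in> {0,1}" "q \<in> {0,1}" "A \<in> sl12_part p" "B \<in> sl12_part q"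
  shows "sbracket p q A B \<in> sl12_part ((p + q) mod 2)"
proof -
  have "sbracket 0 0 A B \<in> sl12_part 0" if "A \<in> sl12_part 0" "B \<in> sl12_part 0"
    using that unfolding even_iff by (simp add: sbracket_nth ac_simps)
  moreover have "sbracket (Suc 0) (Suc 0) A B \<in> sl12_part 0" if "A \<in> sl12_part (Suc 0)" "B \<in> sl12_part (Suc 0)"
    using that unfolding even_iff odd_iff by (simp add: sbracket_nth ac_simps)
  moreover have "sbracket 0 (Suc 0) A B \<in> sl12_part (Suc 0)" if "A \<in> sl12_part 0" "B \<in> sl12_part (Suc 0)"
    using that unfolding even_iff odd_iff by (simp add: sbracket_nth ac_simps)
  moreover have "sbracket (Suc 0) 0 A B \<in> sl12_part (Suc 0)" if "A \<in> sl12_part (Suc 0)" "B \<in> sl12_part 0"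
    using that unfolding even_iff odd_iff by (simp add: sbracket_nth ac_simps)
  ultimately show ?thesis using assms by auto
qed

text \<open>The closure properties of a graded subalgebra. They are needed to restrict an action to the
  subalgebra by making all other matrices act by zero.\<close>

definition subalg :: "mat3 set \<Rightarrow> bool" where
  "subalg k \<longleftrightarrow> (\<forall>A\<in>k. \<forall>B\<in>k. A + B \<in> k) \<and> (\<forall>A\<in>k. \<forall>c. cscale c A \<in> k) \<and>
    (\<forall>p\<in>{0,1}. \<forall>q\<in>{0,1}. \<forall>A\<in>k \<inter> sl12_part p. \<forall>B\<in>k \<inter> sl12_part q. sbracket p q A B \<in> k)"

lemma subalg_sl12: "subalg sl12"
  unfolding subalg_def
proof (intro conjI ballI allI)
  fix p q A B assume "p \<in> {0,1}" "q \<in> {0,1}" "A \<in> sl12 \<inter> sl12_part p" "B \<in> sl12 \<inter> sl12_part q"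
  then have "sbracket p q A B \<in> sl12_part ((p + q) mod 2)"
    by (intro sbracket_part) simp_all
  then show "sbracket p q A B \<in> sl12" by (rule subsetD[OF part_subset])
qed (rule sl12_closed; assumption)+

lemma gl2_odd: "A \<in> gl2 \<Longrightarrow> A \<in> sl12_part (Suc 0) \<Longrightarrow> A = 0"
  by (simp add: even_iff odd_iff mat3_eq_iff forall_3)

lemma sbracket_zero: "sbracket p q 0 B = 0" "sbracket p q A 0 = 0"
  by (simp_all add: mat3_eq_iff sbracket_nth)

lemma subalg_gl2: "subalg gl2"
  unfolding subalg_def
proof (intro conjI ballI allI)
  fix p q A B assume pq: "p \<in> {0,1}" "q \<in> {0,1}" "A \<in> gl2 \<inter> sl12_part p" "B \<in> gl2 \<inter> sl12_part q"
  show "sbracket p q A B \<in> gl2"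
  proof (cases "p = 0 \<and> q = 0")
    case True
    then show ?thesis using sbracket_part[of 0 0 A B] pq by simp
  next
    case False
    then have "A = 0 \<or> B = 0"
      using pq gl2_odd[of A] gl2_odd[of B] by auto
    then have "sbracket p q A B = 0" by (elim disjE) (simp_all only: sbracket_zero)
    then show ?thesis by (simp add: even_iff)
  qed
qed (rule part_closed; assumption)+

section \<open>Representations on a type of vectors\<close>

text \<open>In \<open>rep\<close> the vectors range over a whole type, so that the relations hold without
  membership conditions. The module of interest is an invariant subspace of the type.\<close>

type_synonym 'v action = "mat3 \<Rightarrow> 'v \<Rightarrow> 'v"

definition rep :: "mat3 set \<Rightarrow> ('v::cvec) action \<Rightarrow> bool" where
  "rep k R \<longleftrightarrow> (\<forall>A. lin (R A)) \<and>
     (\<forall>A\<in>k. \<forall>B\<in>k. \<forall>v. R (A + B) v = R A v + R B v) \<and>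
     (\<forall>A\<in>k. \<forall>c v. R (cscale c A) v = c *\<^sub>c R A v) \<and>
     (\<forall>p\<in>{0, 1}. \<forall>q\<in>{0, 1}. \<forall>A\<in>k \<inter> sl12_part p. \<forall>B\<in>k \<inter> sl12_part q. \<forall>v.
        R (sbracket p q A B) v = R A (R B v) - ((- 1) ^ (p * q)) *\<^sub>c R B (R A v))"

definition subrep :: "mat3 set \<Rightarrow> ('v::cvec) action \<Rightarrow> 'v set \<Rightarrow> bool" where
  "subrep k R S \<longleftrightarrow> cvec.subspace S \<and> (\<forall>A\<in>k. \<forall>v\<in>S. R A v \<in> S)"

definition rep_module :: "('v::cvec) action \<Rightarrow> 'v set \<Rightarrow> 'v lmod" where
  "rep_module R S = \<lparr>carrier = S, monoid.mult = undefined, one = undefined, zero = 0, add = (+),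
     module.smult = cs, act = R\<rparr>"

lemma rep_module_simps [simp]:
  "carrier (rep_module R S) = S" "zero (rep_module R S) = 0" "add (rep_module R S) = (+)"
  "module.smult (rep_module R S) = cs" "act (rep_module R S) = R"
  by (simp_all add: rep_module_def)

lemma complex_ring_simps [simp]:
  "carrier complex_ring = UNIV" "monoid.mult complex_ring = (*)" "one complex_ring = 1"
  "zero complex_ring = 0" "add complex_ring = (+)"
  by (simp_all add: ring_of_type_algebra_def)

lemma abelian_group_rep_module:
  assumes "cvec.subspace S" shows "abelian_group (rep_module R S)"
proof (rule abelian_groupI)
  fix x assume "x \<in> carrier (rep_module R S)"
  then show "\<exists>y\<in>carrier (rep_module R S). y \<oplus>\<^bsub>rep_module R S\<^esub> x = \<zero>\<^bsub>rep_module R S\<^esub>"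
    using cvec.subspace_neg[OF assms, of x] by (auto intro!: bexI[of _ "- x"])
qed (use assms in \<open>auto simp: cvec.subspace_0 cvec.subspace_add add_ac\<close>)

lemma module_rep_module:
  assumes "cvec.subspace S" shows "Module.module complex_ring (rep_module R S)"
  by (rule Module.moduleI)
    (use assms in \<open>auto simp: abelian_group_rep_module cs_left_distrib cs_right_distrib cs_cs cs_one
       cvec.subspace_scale\<close>)

lemma a_minus_rep_module:
  assumes "cvec.subspace S" "v \<in> S" "w \<in> S"
  shows "v \<ominus>\<^bsub>rep_module R S\<^esub> w = v - w"
proof -
  interpret abelian_group "rep_module R S" by (rule abelian_group_rep_module) fact
  have "\<ominus>\<^bsub>rep_module R S\<^esub> w = - w"
    using assms by (intro minus_equality) (auto simp: cvec.subspace_neg)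
  then show ?thesis by (simp add: a_minus_def)
qed

lemma repD:
  assumes "rep k R"
  shows rep_lin: "lin (R A)"
    and rep_plus: "A \<in> k \<Longrightarrow> B \<in> k \<Longrightarrow> R (A + B) v = R A v + R B v"
    and rep_cscale: "A \<in> k \<Longrightarrow> R (cscale c A) v = c *\<^sub>c R A v"
    and rep_sbracket: "p \<in> {0, 1} \<Longrightarrow> q \<in> {0, 1} \<Longrightarrow> A \<in> k \<inter> sl12_part p \<Longrightarrow> B \<in> k \<inter> sl12_part q \<Longrightarrow>
        R (sbracket p q A B) v = R A (R B v) - ((- 1) ^ (p * q)) *\<^sub>c R B (R A v)"
  using assms unfolding rep_def by (elim conjE; blast)+

lemma lie_module_rep_module:
  assumes "rep k R" "subrep k R S" shows "lie_module k (rep_module R S)"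
proof -
  have S: "cvec.subspace S" "\<And>A v. A \<in> k \<Longrightarrow> v \<in> S \<Longrightarrow> R A v \<in> S"
    using assms(2) by (simp_all add: subrep_def)
  note R = repD[OF assms(1)]
  show ?thesis
    unfolding lie_module_def rep_module_simps
  proof (intro conjI ballI allI)
    fix p q A B v
    assume pq: "p \<in> {0::nat, 1}" "q \<in> {0::nat, 1}" "A \<in> k \<inter> sl12_part p" "B \<in> k \<inter> sl12_part q" "v \<in> S"
    have "R A (R B v) \<in> S" "((- 1) ^ (p * q)) *\<^sub>c R B (R A v) \<in> S"
      using pq S by (simp_all add: cvec.subspace_scale)
    then show "R (sbracket p q A B) v = R A (R B v) \<ominus>\<^bsub>rep_module R S\<^esub> ((- 1) ^ (p * q)) *\<^sub>c R B (R A v)"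
      using R(4)[OF pq(1-4)] S(1) by (simp add: a_minus_rep_module)
  qed (simp_all add: module_rep_module S R(2,3) lin_add[OF R(1)] lin_cs[OF R(1)])
qed

text \<open>The homomorphism part of \<^const>\<open>module_iso\<close>, separated from bijectivity.\<close>

definition lie_hom :: "mat3 set \<Rightarrow> 'v lmod \<Rightarrow> 'w lmod \<Rightarrow> ('v \<Rightarrow> 'w) \<Rightarrow> bool" where
  "lie_hom k V W f \<longleftrightarrow> (\<forall>v\<in>carrier V. f v \<in> carrier W) \<and>
       (\<forall>v\<in>carrier V. \<forall>w\<in>carrier V. f (v \<oplus>\<^bsub>V\<^esub> w) = f v \<oplus>\<^bsub>W\<^esub> f w) \<and>
       (\<forall>c. \<forall>v\<in>carrier V. f (c \<odot>\<^bsub>V\<^esub> v) = c \<odot>\<^bsub>W\<^esub> f v) \<and>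
       (\<forall>A\<in>k. \<forall>v\<in>carrier V. f (act V A v) = act W A (f v))"

lemma module_iso_iff:
  "module_iso k V W \<longleftrightarrow> (\<exists>f. lie_hom k V W f \<and> bij_betw f (carrier V) (carrier W))"
  unfolding module_iso_def lie_hom_def using bij_betwE by blast

lemma lie_module_closed:
  assumes "lie_module k V" "v \<in> carrier V"
  shows "A \<in> k \<Longrightarrow> act V A v \<in> carrier V" "c \<odot>\<^bsub>V\<^esub> v \<in> carrier V"
    "w \<in> carrier V \<Longrightarrow> v \<oplus>\<^bsub>V\<^esub> w \<in> carrier V"
proof -
  interpret Module.module complex_ring V using assms by (simp add: lie_module_def)
  show "A \<in> k \<Longrightarrow> act V A v \<in> carrier V" "c \<odot>\<^bsub>V\<^esub> v \<in> carrier V"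
    "w \<in> carrier V \<Longrightarrow> v \<oplus>\<^bsub>V\<^esub> w \<in> carrier V"
    using assms by (auto simp: lie_module_def)
qed

lemma lie_hom_inv:
  assumes "lie_module k V" "lie_hom k V W f" "bij_betw f (carrier V) (carrier W)"
  shows "lie_hom k W V (inv_into (carrier V) f)"
proof -
  let ?g = "inv_into (carrier V) f"
  have g: "?g w \<in> carrier V" "f (?g w) = w" if "w \<in> carrier W" for w
    using that assms(3) by (auto simp: bij_betw_def inv_into_into f_inv_into_f)
  have gf: "?g (f v) = v" if "v \<in> carrier V" for v
    using that assms(3) by (auto simp: bij_betw_def)
  note cl = lie_module_closed[OF assms(1)]
  have eq: "?g (f v \<oplus>\<^bsub>W\<^esub> f w) = v \<oplus>\<^bsub>V\<^esub> w" if "v \<in> carrier V" "w \<in> carrier V" for v w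
    using that cl gf[of "v \<oplus>\<^bsub>V\<^esub> w"] assms(2) by (simp add: lie_hom_def)
  have eq2: "?g (c \<odot>\<^bsub>W\<^esub> f v) = c \<odot>\<^bsub>V\<^esub> v" if "v \<in> carrier V" for v c
    using that cl gf[of "c \<odot>\<^bsub>V\<^esub> v"] assms(2) by (simp add: lie_hom_def)
  have eq3: "?g (act W A (f v)) = act V A v" if "v \<in> carrier V" "A \<in> k" for v A
    using that cl gf[of "act V A v"] assms(2) by (simp add: lie_hom_def)
  show ?thesis
    unfolding lie_hom_def
  proof (intro conjI ballI allI)
    show "?g (w \<oplus>\<^bsub>W\<^esub> w') = ?g w \<oplus>\<^bsub>V\<^esub> ?g w'" if "w \<in> carrier W" "w' \<in> carrier W" for w w'
      using eq[OF g(1)[OF that(1)] g(1)[OF that(2)]] that by (simp add: g(2))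
    show "?g (c \<odot>\<^bsub>W\<^esub> w) = c \<odot>\<^bsub>V\<^esub> ?g w" if "w \<in> carrier W" for w c
      using eq2[OF g(1)[OF that]] that by (simp add: g(2))
    show "?g (act W A w) = act V A (?g w)" if "w \<in> carrier W" "A \<in> k" for w A
      using eq3[OF g(1)[OF that(1)] that(2)] that by (simp add: g(2))
  qed (rule g(1))
qed

lemma lie_hom_comp:
  "lie_hom k V W f \<Longrightarrow> lie_hom k W Z g \<Longrightarrow> lie_hom k V Z (\<lambda>v. g (f v))"
  by (simp add: lie_hom_def)

lemma module_iso_sym:
  "lie_module k V \<Longrightarrow> module_iso k V W \<Longrightarrow> module_iso k W V"
  using lie_hom_inv bij_betw_inv_into unfolding module_iso_iff by blast

lemma module_iso_trans:
  "module_iso k V W \<Longrightarrow> module_iso k W Z \<Longrightarrow> module_iso k V Z"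
  using lie_hom_comp bij_betw_trans[unfolded comp_def] unfolding module_iso_iff by blast

lemma module_iso_mono: "k' \<subseteq> k \<Longrightarrow> module_iso k V W \<Longrightarrow> module_iso k' V W"
  unfolding module_iso_def by blast

section \<open>Embedding a module into a type of vectors\<close>

lemma subalg_sbracket:
  assumes "subalg k" "p \<in> {0, 1}" "q \<in> {0, 1}" "A \<in> k \<inter> sl12_part p" "B \<in> k \<inter> sl12_part q"
  shows "sbracket p q A B \<in> k"
  using assms unfolding subalg_def by (elim conjE) blast

lemma lie_module_sbracket:
  assumes "lie_module k V" "p \<in> {0, 1}" "q \<in> {0, 1}" "A \<in> k \<inter> sl12_part p" "B \<in> k \<inter> sl12_part q"
    "v \<in> carrier V"
  shows "act V (sbracket p q A B) v =
          act V A (act V B v) \<ominus>\<^bsub>V\<^esub> ((- 1) ^ (p * q)) \<odot>\<^bsub>V\<^esub> act V B (act V A v)"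
  using assms unfolding lie_module_def by (elim conjE) blast

text \<open>Every module is isomorphic to an invariant subspace of a representation on a whole type. The finitely
  supported functions on the type of \<open>V\<close> map onto \<open>V\<close> by evaluating formal combinations (\<open>\<sigma>\<close>).
  A projection \<open>g\<close> whose kernel is the kernel of \<open>\<sigma>\<close> gives a linear section \<open>f\<close> of \<open>\<sigma>\<close>, and
  a matrix \<open>A\<close> acts on a formal combination \<open>p\<close> by \<open>f (A (\<sigma> p))\<close>. The relations hold for all \<open>p\<close>,
  since \<open>\<sigma>\<close> after \<open>f\<close> is the identity.\<close>

lemma embed_lie_module:
  fixes V :: "'v lmod"
  assumes V: "lie_module k V" and k: "subalg k"
  obtains R :: "mat3 \<Rightarrow> ('v \<Rightarrow>\<^sub>0 complex) \<Rightarrow> ('v \<Rightarrow>\<^sub>0 complex)" and S f where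
    "rep k R" "subrep k R S" "lie_hom k V (rep_module R S) f" "bij_betw f (carrier V) S"
proof -
  interpret Module.module complex_ring V using V by (simp add: lie_module_def)
  note cl = lie_module_closed[OF V]
  note smult [simp] = smult_l_null[simplified] smult_r_null[simplified] smult_one[simplified]
  define \<sigma> where "\<sigma> p = finsum V (\<lambda>v. lookup p v \<odot>\<^bsub>V\<^esub> v) (keys p \<inter> carrier V)"
    for p :: "'v \<Rightarrow>\<^sub>0 complex"
  have \<sigma>_sup: "\<sigma> p = finsum V (\<lambda>v. lookup p v \<odot>\<^bsub>V\<^esub> v) T"
    if "finite T" "keys p \<inter> carrier V \<subseteq> T" "T \<subseteq> carrier V" for p T
    unfolding \<sigma>_def
    by (rule add.finprod_mono_neutral_cong_left[OF that(1,2)])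
       (use that(3) in \<open>auto simp: in_keys_iff\<close>)
  have \<sigma>_closed [simp]: "\<sigma> p \<in> carrier V" for p
    unfolding \<sigma>_def by (rule finsum_closed) auto
  have \<sigma>_add: "\<sigma> (p + q) = \<sigma> p \<oplus>\<^bsub>V\<^esub> \<sigma> q" for p q
  proof -
    let ?T = "(keys p \<union> keys q) \<inter> carrier V"
    have "\<sigma> (p + q) = finsum V (\<lambda>v. lookup (p + q) v \<odot>\<^bsub>V\<^esub> v) ?T"
      by (rule \<sigma>_sup) (use Poly_Mapping.keys_add[of p q] in auto)
    also have "\<dots> = finsum V (\<lambda>v. lookup p v \<odot>\<^bsub>V\<^esub> v \<oplus>\<^bsub>V\<^esub> lookup q v \<odot>\<^bsub>V\<^esub> v) ?T"
      by (rule finsum_cong') (use smult_l_distr[simplified] in \<open>auto simp: lookup_add\<close>)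
    also have "\<dots> = finsum V (\<lambda>v. lookup p v \<odot>\<^bsub>V\<^esub> v) ?T \<oplus>\<^bsub>V\<^esub>
        finsum V (\<lambda>v. lookup q v \<odot>\<^bsub>V\<^esub> v) ?T"
      by (rule finsum_addf) auto
    also have "\<dots> = \<sigma> p \<oplus>\<^bsub>V\<^esub> \<sigma> q"
      by (subst (1 2) \<sigma>_sup[symmetric]) auto
    finally show ?thesis .
  qed
  have \<sigma>_cs: "\<sigma> (c *\<^sub>c p) = c \<odot>\<^bsub>V\<^esub> \<sigma> p" for c p
  proof -
    let ?T = "keys p \<inter> carrier V"
    have "\<sigma> (c *\<^sub>c p) = finsum V (\<lambda>v. lookup (c *\<^sub>c p) v \<odot>\<^bsub>V\<^esub> v) ?T"
      by (rule \<sigma>_sup) (auto simp: in_keys_iff lookup_cs)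
    also have "\<dots> = finsum V (\<lambda>v. c \<odot>\<^bsub>V\<^esub> (lookup p v \<odot>\<^bsub>V\<^esub> v)) ?T"
      by (rule finsum_cong') (use smult_assoc1[simplified] in \<open>auto simp: lookup_cs cs_complex_def\<close>)
    also have "\<dots> = c \<odot>\<^bsub>V\<^esub> \<sigma> p"
      unfolding \<sigma>_def by (rule finsum_smult_ldistr[symmetric, simplified]) auto
    finally show ?thesis .
  qed
  have \<sigma>_single: "\<sigma> (single v 1) = v" if "v \<in> carrier V" for v
  proof -
    have "\<sigma> (single v 1) =
        finsum V (\<lambda>w. lookup (single v (1::complex)) w \<odot>\<^bsub>V\<^esub> w) {v}"
      by (rule \<sigma>_sup) (use that in auto)
    also have "\<dots> = v"
      using that by (simp add: finsum_insert)
    finally show ?thesis .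
  qed
  \<comment> \<open>A basis of the kernel, extended to a basis of the whole space, yields the projection \<open>g\<close>.\<close>
  define N where "N = {p. \<sigma> p = \<zero>\<^bsub>V\<^esub>}"
  have \<sigma>_0: "\<sigma> 0 = \<zero>\<^bsub>V\<^esub>" by (simp add: \<sigma>_def)
  have N: "cvec.subspace N"
    unfolding cvec.subspace_def N_def mem_Collect_eq
    by (intro conjI ballI allI) (simp_all add: \<sigma>_0 \<sigma>_add \<sigma>_cs)
  obtain B where B: "B \<subseteq> N" "cvec.independent B" "N \<subseteq> cvec.span B"
    by (rule cvec.maximal_independent_subset_extend[OF empty_subsetI cvec.independent_empty])
  obtain C where C: "B \<subseteq> C" "cvec.independent C" "UNIV \<subseteq> cvec.span C"
    by (rule cvec.maximal_independent_subset_extend[OF subset_UNIV B(2)])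
  define g :: "('v \<Rightarrow>\<^sub>0 complex) \<Rightarrow> ('v \<Rightarrow>\<^sub>0 complex)" where
    "g = cvec.construct C (\<lambda>b. if b \<in> B then 0 else b)"
  have g_linear: "Vector_Spaces.linear cs cs g"
    unfolding g_def by (rule cvec.linear_construct[OF C(2)])
  have g_C: "\<forall>b\<in>C. g b = (if b \<in> B then 0 else b)"
    unfolding g_def by (intro ballI cvec.construct_basis[OF C(2)])
  have g: "lin g" "\<And>b. b \<in> C \<Longrightarrow> g b = (if b \<in> B then 0 else b)"
    using g_linear g_C by (simp_all only: lin_iff_linear)
  have gN: "g p = 0" if "p \<in> N" for p
  proof -
    have "p \<in> cvec.span B" using that B by auto
    then show ?thesis
    proof (rule cvec.span_induct)
      show "cvec.subspace {a. g a = 0}"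
        unfolding cvec.subspace_def mem_Collect_eq
        by (intro conjI ballI allI) (simp_all add: lin_add[OF g(1)] lin_cs[OF g(1)] lin_zero[OF g(1)])
      show "g x = 0" if "x \<in> B" for x
        using that C(1) g(2) by auto
    qed
  qed
  have gd: "g p - p \<in> N" for p
  proof -
    have "p \<in> cvec.span C" using C by auto
    then show ?thesis
    proof (rule cvec.span_induct)
      have gxy: "g (x + y) - (x + y) = (g x - x) + (g y - y)" for x y
        by (simp add: lin_add[OF g(1)])
      have gcx: "g (c *\<^sub>c x) - c *\<^sub>c x = c *\<^sub>c (g x - x)" for x c
        by (simp only: lin_cs[OF g(1)] cvec.scale_right_diff_distrib)
      have g0: "g 0 - 0 \<in> N"
        by (simp add: lin_zero[OF g(1)] cvec.subspace_0[OF N])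
      show "cvec.subspace {a. g a - a \<in> N}"
        unfolding cvec.subspace_def mem_Collect_eq gxy gcx
        by (intro conjI ballI allI g0 cvec.subspace_add[OF N] cvec.subspace_scale[OF N])
          (simp_all only: mem_Collect_eq)
      show "g x - x \<in> N" if "x \<in> C" for x
        using that B(1) g(2)[OF that] cvec.subspace_neg[OF N, of x] by (auto simp: cvec.subspace_0[OF N])
    qed
  qed
  have \<sigma>g: "\<sigma> (g p) = \<sigma> p" for p
    using \<sigma>_add[of p "g p - p"] gd[of p] by (simp add: N_def)
  have g_eq: "g p = g q" if "\<sigma> p = \<sigma> q" for p q
  proof -
    have "\<sigma> (p - q) = \<sigma> p \<oplus>\<^bsub>V\<^esub> \<sigma> ((- 1) *\<^sub>c q)"
      by (subst \<sigma>_add[symmetric]) simp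
    also have "\<dots> = \<sigma> q \<oplus>\<^bsub>V\<^esub> \<sigma> ((- 1) *\<^sub>c q)" using that by simp
    also have "\<dots> = \<zero>\<^bsub>V\<^esub>" by (subst \<sigma>_add[symmetric]) (simp add: \<sigma>_0)
    finally have "p - q \<in> N" by (simp add: N_def)
    from gN[OF this] show ?thesis using g(1) by (simp add: lin_diff)
  qed
  define f where "f v = g (single v 1)" for v
  have gf: "g p = f (\<sigma> p)" for p
    unfolding f_def by (rule g_eq) (simp add: \<sigma>_single)
  have \<sigma>f: "\<sigma> (f v) = v" if "v \<in> carrier V" for v
    using that by (simp add: f_def \<sigma>g \<sigma>_single)
  have f_add: "f (v \<oplus>\<^bsub>V\<^esub> w) = f v + f w" if "v \<in> carrier V" "w \<in> carrier V" for v w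
  proof -
    have "f (v \<oplus>\<^bsub>V\<^esub> w) = g (f v + f w)"
      using that by (simp add: gf \<sigma>_add \<sigma>f)
    also have "\<dots> = g (f v) + g (f w)" using g by (simp add: lin_add)
    finally show ?thesis using that by (simp add: gf \<sigma>f)
  qed
  have f_cs: "f (c \<odot>\<^bsub>V\<^esub> v) = c *\<^sub>c f v" if "v \<in> carrier V" for v c
  proof -
    have "f (c \<odot>\<^bsub>V\<^esub> v) = g (c *\<^sub>c f v)"
      using that by (simp add: gf \<sigma>_cs \<sigma>f)
    also have "\<dots> = c *\<^sub>c g (f v)" using g by (simp add: lin_cs)
    finally show ?thesis using that by (simp add: gf \<sigma>f)
  qed
  have f_diff: "f (v \<ominus>\<^bsub>V\<^esub> w) = f v - f w" if "v \<in> carrier V" "w \<in> carrier V" for v w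
  proof -
    have "f v = f ((v \<ominus>\<^bsub>V\<^esub> w) \<oplus>\<^bsub>V\<^esub> w)"
      using that by (simp add: a_minus_def a_assoc l_neg)
    also have "\<dots> = f (v \<ominus>\<^bsub>V\<^esub> w) + f w" using that by (intro f_add) auto
    finally show ?thesis by simp
  qed
  have f0: "f \<zero>\<^bsub>V\<^esub> = 0" using f_add[of "\<zero>\<^bsub>V\<^esub>" "\<zero>\<^bsub>V\<^esub>"] by simp
  define R where "R A p = (if A \<in> k then f (act V A (\<sigma> p)) else 0)" for A p
  define S where "S = f ` carrier V"
  have V1: "act V A (v \<oplus>\<^bsub>V\<^esub> w) = act V A v \<oplus>\<^bsub>V\<^esub> act V A w"
    if "A \<in> k" "v \<in> carrier V" "w \<in> carrier V" for A v w
    using V that unfolding lie_module_def by simp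
  have V2: "act V A (c \<odot>\<^bsub>V\<^esub> v) = c \<odot>\<^bsub>V\<^esub> act V A v" if "A \<in> k" "v \<in> carrier V" for A v c
    using V that unfolding lie_module_def by simp
  have "rep k R"
    unfolding rep_def
  proof (intro conjI ballI allI)
    show "lin (R A)" for A
      by (intro linI) (simp_all add: R_def \<sigma>_add \<sigma>_cs V1 V2 cl f_add f_cs)
    show "R (A + B) v = R A v + R B v" if "A \<in> k" "B \<in> k" for A B v
      using that k V[unfolded lie_module_def] by (simp add: R_def subalg_def cl f_add)
    show "R (cscale c A) v = c *\<^sub>c R A v" if "A \<in> k" for A c v
      using that k V[unfolded lie_module_def] by (simp add: R_def subalg_def cl f_cs)
    show "R (sbracket p q A B) v = R A (R B v) - ((- 1) ^ (p * q)) *\<^sub>c R B (R A v)"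
      if p: "p \<in> {0, 1}" "q \<in> {0, 1}" "A \<in> k \<inter> sl12_part p" "B \<in> k \<inter> sl12_part q" for p q A B v
    proof -
      have "sbracket p q A B \<in> k" by (rule subalg_sbracket[OF k p])
      moreover have "act V (sbracket p q A B) (\<sigma> v) = act V A (act V B (\<sigma> v)) \<ominus>\<^bsub>V\<^esub>
          ((- 1) ^ (p * q)) \<odot>\<^bsub>V\<^esub> act V B (act V A (\<sigma> v))"
        by (rule lie_module_sbracket[OF V p]) simp
      ultimately show ?thesis
        using that by (simp add: R_def cl f_diff f_cs \<sigma>f)
    qed
  qed
  moreover have "subrep k R S"
    unfolding subrep_def cvec.subspace_def
  proof (intro conjI ballI allI)
    show "0 \<in> S" using f0 zero_closed unfolding S_def by (metis image_eqI)
    show "x + y \<in> S" if "x \<in> S" "y \<in> S" for x y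
      using that unfolding S_def by (auto simp: f_add[symmetric] intro!: imageI)
    show "c *\<^sub>c x \<in> S" if "x \<in> S" for x c
      using that unfolding S_def by (auto simp: f_cs[symmetric] intro!: imageI cl)
    show "R A x \<in> S" if "x \<in> S" "A \<in> k" for A x
      using that by (simp add: S_def R_def cl)
  qed
  moreover have "lie_hom k V (rep_module R S) f"
    by (simp add: lie_hom_def S_def f_add f_cs R_def \<sigma>f)
  moreover have "bij_betw f (carrier V) S"
    unfolding bij_betw_def S_def using \<sigma>f by (auto intro: inj_on_inverseI)
  ultimately show ?thesis by (rule that)
qed

section \<open>Representations from eight operators\<close>

lemma ent_named [simp]:
  "ent x1 i j = (if i = 1 \<and> j = 2 then 1 else 0)" "ent x2 i j = (if i = 2 \<and> j = 3 then 1 else 0)"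
  "ent x3 i j = (if i = 1 \<and> j = 3 then 1 else 0)" "ent y1 i j = (if i = 2 \<and> j = 1 then 1 else 0)"
  "ent y2 i j = (if i = 3 \<and> j = 2 then 1 else 0)" "ent y3 i j = (if i = 3 \<and> j = 1 then 1 else 0)"
  "ent h1 i j = (if i = j \<and> i \<noteq> 3 then 1 else 0)"
  "ent h2 i j = (if i = j \<and> i \<noteq> 1 then if i = 2 then 1 else - 1 else 0)"
  using exhaust_3[of i]
  by (auto simp: x1_def x2_def x3_def y1_def y2_def y3_def h1_def h2_def E_def transpose_def)

lemma ent_cscale [simp]: "ent (cscale c A) i j = c * ent A i j"
  by (simp add: cscale_def)

definition basis_part :: "nat \<Rightarrow> mat3 set" where
  "basis_part p = (if p = 0 then {h1, h2, x2, y2} else {x1, x3, y1, y3})"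

lemma basis_part_subset: "p \<in> {0,1} \<Longrightarrow> basis_part p \<subseteq> sl12_part p"
  by (auto simp: basis_part_def even_iff odd_iff)

lemma named_in_sl12 [simp]: "x1 \<in> sl12" "x2 \<in> sl12" "x3 \<in> sl12" "y1 \<in> sl12" "y2 \<in> sl12" "y3 \<in> sl12"
   "h1 \<in> sl12" "h2 \<in> sl12"
  by (simp_all add: sl12_iff)

lemma named_in_part [simp]: "x2 \<in> gl2" "y2 \<in> gl2" "h1 \<in> gl2" "h2 \<in> gl2"
   "x1 \<in> sl12_part (Suc 0)" "x3 \<in> sl12_part (Suc 0)" "y1 \<in> sl12_part (Suc 0)" "y3 \<in> sl12_part (Suc 0)"
  by (simp_all add: even_iff odd_iff)

lemma cartan_in_gl2 [simp]: "cartan a c \<in> gl2"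
  by (simp add: even_iff cartan_def)

lemma even_expand:
  assumes "A \<in> gl2"
  shows "A = (cscale (ent A 1 1) h1 + cscale (- ent A 3 3) h2) + (cscale (ent A 2 3) x2 + cscale (ent A 3 2) y2)"
  using assms by (simp add: mat3_eq_iff forall_3 even_iff)

lemma odd_expand:
  assumes "A \<in> sl12_part (Suc 0)"
  shows "A = (cscale (ent A 1 2) x1 + cscale (ent A 1 3) x3) + (cscale (ent A 2 1) y1 + cscale (ent A 3 1) y3)"
  using assms by (simp add: mat3_eq_iff forall_3 odd_iff)

lemma sl12_expand:
  assumes "A \<in> sl12"
  obtains B C where "B \<in> gl2" "C \<in> sl12_part (Suc 0)" "A = B + C"
proof
  let ?B = "(cscale (ent A 1 1) h1 + cscale (- ent A 3 3) h2) + (cscale (ent A 2 3) x2 + cscale (ent A 3 2) y2)"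
  let ?C = "(cscale (ent A 1 2) x1 + cscale (ent A 1 3) x3) + (cscale (ent A 2 1) y1 + cscale (ent A 3 1) y3)"
  show "?B \<in> gl2" "?C \<in> sl12_part (Suc 0)"
    by (simp_all add: part_closed)
  show "A = ?B + ?C"
    using assms by (simp add: mat3_eq_iff forall_3 sl12_iff)
qed

text \<open>A property of homogeneous matrices that is stable under linear combinations needs to be
  checked only on the named basis.\<close>

lemma part_induct:
  assumes "p \<in> {0,1}" "A \<in> sl12_part p"
    and "\<And>B. B \<in> basis_part p \<Longrightarrow> P B"
    and add: "\<And>A B. A \<in> sl12_part p \<Longrightarrow> B \<in> sl12_part p \<Longrightarrow> P A \<Longrightarrow> P B \<Longrightarrow> P (A + B)"
    and scale: "\<And>c A. A \<in> sl12_part p \<Longrightarrow> P A \<Longrightarrow> P (cscale c A)"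
  shows "P A"
proof -
  have "P ((cscale a B1 + cscale b B2) + (cscale c B3 + cscale d B4))"
    if "B1 \<in> basis_part p" "B2 \<in> basis_part p" "B3 \<in> basis_part p" "B4 \<in> basis_part p" for a b c d B1 B2 B3 B4
  proof -
    note sub = subsetD[OF basis_part_subset[OF assms(1)]]
    show ?thesis
      using that by (intro add scale part_closed sub assms(3))
  qed
  note * = this
  show ?thesis
  proof (cases "p = 0")
    case True
    show ?thesis
      using True assms(2) by (subst even_expand) (simp, intro *, simp_all add: basis_part_def)
  next
    case False
    then have "p = Suc 0" using assms(1) by simp
    then show ?thesis
      using assms(2) by (subst odd_expand) (simp, intro *, simp_all add: basis_part_def)
  qed
qed

lemma sl12_induct:
  assumes "A \<in> sl12"
    and "\<And>B p. p \<in> {0,1} \<Longrightarrow> B \<in> basis_part p \<Longrightarrow> P B"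
    and "\<And>A B. A \<in> sl12 \<Longrightarrow> B \<in> sl12 \<Longrightarrow> P A \<Longrightarrow> P B \<Longrightarrow> P (A + B)"
    and "\<And>c A. A \<in> sl12 \<Longrightarrow> P A \<Longrightarrow> P (cscale c A)"
  shows "P A"
proof -
  have P: "P C" if "p \<in> {0,1}" "C \<in> sl12_part p" for C p
    using that
  proof (rule part_induct)
    show "P B" if "B \<in> basis_part p" for B
      using \<open>p \<in> {0,1}\<close> that by (rule assms(2))
  qed (rule assms(3,4) subsetD[OF part_subset] | assumption)+
  obtain B C where "B \<in> gl2" "C \<in> sl12_part (Suc 0)" "A = B + C"
    using sl12_expand[OF assms(1)] .
  then show ?thesis
    using P[of 0 B] P[of 1 C] assms(3)[of B C] by (auto intro: subsetD[OF part_subset])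
qed

lemma sbracket_simps:
  "sbracket p q (A + B) C = sbracket p q A C + sbracket p q B C"
  "sbracket p q A (B + C) = sbracket p q A B + sbracket p q A C"
  "sbracket p q (cscale c A) B = cscale c (sbracket p q A B)"
  "sbracket p q A (cscale c B) = cscale c (sbracket p q A B)"
  by (simp_all add: mat3_eq_iff sbracket_nth algebra_simps)

lemma sbracket_swap:
  "sbracket q p B A = cscale (- ((- 1) ^ (p * q))) (sbracket p q A B)"
proof -
  define s :: complex where "s = (- 1) ^ (p * q)"
  have "s * s = 1"
    by (simp add: s_def power_mult_distrib [symmetric])
  then have *: "- s * (a - s * b) = b - s * a" for a b
    by (simp add: right_diff_distrib mult.assoc [symmetric])
  have "(- 1) ^ (q * p) = s" by (simp only: s_def mult.commute [of p q])
  then show ?thesis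
    by (simp only: mat3_eq_iff sbracket_nth ent_cscale s_def [symmetric] * simp_thms)
qed

lemmas cs_distribs = cs_right_distrib cs_left_distrib cvec.scale_right_diff_distrib cvec.scale_left_diff_distrib

text \<open>An action is determined by the operators of the eight basis matrices. The last
  coefficient is that of \<open>h2\<close> in \<open>diag(a, b, c) = a h1 - c h2\<close>, which holds for \<open>a = b + c\<close>.\<close>

definition mkrep :: "('v::cvec \<Rightarrow> 'v) \<Rightarrow> ('v \<Rightarrow> 'v) \<Rightarrow> ('v \<Rightarrow> 'v) \<Rightarrow> ('v \<Rightarrow> 'v) \<Rightarrow> ('v \<Rightarrow> 'v) \<Rightarrow> ('v \<Rightarrow> 'v) \<Rightarrow>
    ('v \<Rightarrow> 'v) \<Rightarrow> ('v \<Rightarrow> 'v) \<Rightarrow> mat3 \<Rightarrow> 'v \<Rightarrow> 'v" where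
  "mkrep X1 X2 X3 Y1 Y2 Y3 H1 H2 A v =
     ent A 1 2 *\<^sub>c X1 v + ent A 2 3 *\<^sub>c X2 v + ent A 1 3 *\<^sub>c X3 v + ent A 2 1 *\<^sub>c Y1 v + ent A 3 2 *\<^sub>c Y2 v +
     ent A 3 1 *\<^sub>c Y3 v + ent A 1 1 *\<^sub>c H1 v + (- ent A 3 3) *\<^sub>c H2 v"

lemma mkrep_named [simp]:
  "mkrep X1 X2 X3 Y1 Y2 Y3 H1 H2 x1 = X1" "mkrep X1 X2 X3 Y1 Y2 Y3 H1 H2 x2 = X2"
  "mkrep X1 X2 X3 Y1 Y2 Y3 H1 H2 x3 = X3" "mkrep X1 X2 X3 Y1 Y2 Y3 H1 H2 y1 = Y1"
  "mkrep X1 X2 X3 Y1 Y2 Y3 H1 H2 y2 = Y2" "mkrep X1 X2 X3 Y1 Y2 Y3 H1 H2 y3 = Y3"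
  "mkrep X1 X2 X3 Y1 Y2 Y3 H1 H2 h1 = H1" "mkrep X1 X2 X3 Y1 Y2 Y3 H1 H2 h2 = H2"
  by (simp_all add: mkrep_def fun_eq_iff cs_one)

lemma mkrep_add: "mkrep X1 X2 X3 Y1 Y2 Y3 H1 H2 (A + B) v =
    mkrep X1 X2 X3 Y1 Y2 Y3 H1 H2 A v + mkrep X1 X2 X3 Y1 Y2 Y3 H1 H2 B v"
  by (simp add: mkrep_def cs_distribs add_ac)

lemma mkrep_cscale: "mkrep X1 X2 X3 Y1 Y2 Y3 H1 H2 (cscale c A) v =
    c *\<^sub>c mkrep X1 X2 X3 Y1 Y2 Y3 H1 H2 A v"
  by (simp add: mkrep_def cs_distribs)

lemma lin_mkrep:
  assumes "lin X1" "lin X2" "lin X3" "lin Y1" "lin Y2" "lin Y3" "lin H1" "lin H2"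
  shows "lin (mkrep X1 X2 X3 Y1 Y2 Y3 H1 H2 A)"
proof (rule linI)
  show "mkrep X1 X2 X3 Y1 Y2 Y3 H1 H2 A (v + w) =
     mkrep X1 X2 X3 Y1 Y2 Y3 H1 H2 A v + mkrep X1 X2 X3 Y1 Y2 Y3 H1 H2 A w" for v w
    by (simp add: mkrep_def assms[THEN lin_add] cs_distribs add_ac)
  show "mkrep X1 X2 X3 Y1 Y2 Y3 H1 H2 A (c *\<^sub>c v) = c *\<^sub>c mkrep X1 X2 X3 Y1 Y2 Y3 H1 H2 A v" for c v
    by (simp add: mkrep_def assms[THEN lin_cs] cs_distribs mult.commute)
qed

text \<open>Both sides of the bracket relation are bilinear in the two matrices.\<close>

lemma bracket_extend:
  assumes lin: "\<And>A. lin (R A)" and add: "\<And>A B v. R (A + B) v = R A v + R B v"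
    and scale: "\<And>c A v. R (cscale c A) v = c *\<^sub>c R A v"
    and pq: "p \<in> {0,1}" "q \<in> {0,1}"
    and basis: "\<And>A B v. A \<in> basis_part p \<Longrightarrow> B \<in> basis_part q \<Longrightarrow>
        R (sbracket p q A B) v = R A (R B v) - ((- 1) ^ (p * q)) *\<^sub>c R B (R A v)"
    and "A \<in> sl12_part p" "B \<in> sl12_part q"
  shows "R (sbracket p q A B) v = R A (R B v) - ((- 1) ^ (p * q)) *\<^sub>c R B (R A v)"
  using pq(1) assms(7)
proof (rule part_induct)
  fix A assume A: "A \<in> basis_part p"
  show "R (sbracket p q A B) v = R A (R B v) - ((- 1) ^ (p * q)) *\<^sub>c R B (R A v)"
    using pq(2) assms(8)
  proof (rule part_induct)
    show "R (sbracket p q A B) v = R A (R B v) - ((- 1) ^ (p * q)) *\<^sub>c R B (R A v)"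
      if "B \<in> basis_part q" for B
      using A that by (rule basis)
  next
    fix B C
    assume "R (sbracket p q A B) v = R A (R B v) - ((- 1) ^ (p * q)) *\<^sub>c R B (R A v)"
      "R (sbracket p q A C) v = R A (R C v) - ((- 1) ^ (p * q)) *\<^sub>c R C (R A v)"
    then show "R (sbracket p q A (B + C)) v = R A (R (B + C) v) - ((- 1) ^ (p * q)) *\<^sub>c R (B + C) (R A v)"
      by (simp only: sbracket_simps add lin_add[OF lin] cs_right_distrib add_diff_add)
  next
    fix c B
    assume "R (sbracket p q A B) v = R A (R B v) - ((- 1) ^ (p * q)) *\<^sub>c R B (R A v)"
    then show "R (sbracket p q A (cscale c B)) v = R A (R (cscale c B) v) -
        ((- 1) ^ (p * q)) *\<^sub>c R (cscale c B) (R A v)"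
      by (simp only: sbracket_simps scale lin_cs[OF lin] cvec.scale_right_diff_distrib cs_cs mult.commute)
  qed
next
  fix A C
  assume "R (sbracket p q A B) v = R A (R B v) - ((- 1) ^ (p * q)) *\<^sub>c R B (R A v)"
    "R (sbracket p q C B) v = R C (R B v) - ((- 1) ^ (p * q)) *\<^sub>c R B (R C v)"
  then show "R (sbracket p q (A + C) B) v = R (A + C) (R B v) - ((- 1) ^ (p * q)) *\<^sub>c R B (R (A + C) v)"
    by (simp only: sbracket_simps add lin_add[OF lin] cs_right_distrib add_diff_add)
next
  fix c A
  assume "R (sbracket p q A B) v = R A (R B v) - ((- 1) ^ (p * q)) *\<^sub>c R B (R A v)"
  then show "R (sbracket p q (cscale c A) B) v = R (cscale c A) (R B v) -
      ((- 1) ^ (p * q)) *\<^sub>c R B (R (cscale c A) v)"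
    by (simp only: sbracket_simps scale lin_cs[OF lin] cvec.scale_right_diff_distrib cs_cs mult.commute)
qed

text \<open>The mixed case with the odd matrix first follows from the other mixed case by
  \<open>sbracket_swap\<close>.\<close>

lemma rep_sl12I:
  assumes lin: "\<And>A. lin (R A)" and add: "\<And>A B v. R (A + B) v = R A v + R B v"
    and scale: "\<And>c A v. R (cscale c A) v = c *\<^sub>c R A v"
    and "\<And>A B v. A \<in> basis_part 0 \<Longrightarrow> B \<in> basis_part 0 \<Longrightarrow> R (sbracket 0 0 A B) v = R A (R B v) - R B (R A v)"
    and "\<And>A B v. A \<in> basis_part 0 \<Longrightarrow> B \<in> basis_part 1 \<Longrightarrow> R (sbracket 0 1 A B) v = R A (R B v) - R B (R A v)"
    and "\<And>A B v. A \<in> basis_part 1 \<Longrightarrow> B \<in> basis_part 1 \<Longrightarrow> R (sbracket 1 1 A B) v = R A (R B v) + R B (R A v)"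
  shows "rep sl12 R"
  unfolding rep_def
proof (intro conjI ballI allI lin add scale)
  fix p q A B v
  assume pq: "p \<in> {0::nat, 1}" "q \<in> {0::nat, 1}" and A: "A \<in> sl12 \<inter> sl12_part p" and B: "B \<in> sl12 \<inter> sl12_part q"
  show "R (sbracket p q A B) v = R A (R B v) - ((- 1) ^ (p * q)) *\<^sub>c R B (R A v)"
  proof (rule bracket_extend[OF lin add scale pq])
    fix A B v assume AB: "A \<in> basis_part p" "B \<in> basis_part q"
    consider "p = 0 \<and> q = 0" | "p = 0 \<and> q = 1" | "p = 1 \<and> q = 1" | "p = 1 \<and> q = 0"
      using pq by auto
    then show "R (sbracket p q A B) v = R A (R B v) - ((- 1) ^ (p * q)) *\<^sub>c R B (R A v)"
    proof cases
      case 4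
      then show ?thesis
        using assms(5)[of B A v] AB by (simp add: sbracket_swap[of "Suc 0" 0 A B] scale cs_one)
    qed (use AB assms(4)[of A B v] assms(5)[of A B v] assms(6)[of A B v] in \<open>simp_all add: cs_one\<close>)
  qed (use A B in auto)
qed

lemma rep_gl2I:
  assumes lin: "\<And>A. lin (R A)" and add: "\<And>A B v. R (A + B) v = R A v + R B v"
    and scale: "\<And>c A v. R (cscale c A) v = c *\<^sub>c R A v"
    and "\<And>A B v. A \<in> basis_part 0 \<Longrightarrow> B \<in> basis_part 0 \<Longrightarrow> R (sbracket 0 0 A B) v = R A (R B v) - R B (R A v)"
  shows "rep gl2 R"
  unfolding rep_def
proof (intro conjI ballI allI lin add scale)
  have R0: "R 0 v = 0" for v
    using add[of 0 0 v] by simp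
  fix p q A B v
  assume pq: "p \<in> {0::nat, 1}" "q \<in> {0::nat, 1}" and A: "A \<in> gl2 \<inter> sl12_part p" and B: "B \<in> gl2 \<inter> sl12_part q"
  show "R (sbracket p q A B) v = R A (R B v) - ((- 1) ^ (p * q)) *\<^sub>c R B (R A v)"
  proof (cases "p = 0 \<and> q = 0")
    case True
    have "R (sbracket 0 0 A B) v = R A (R B v) - ((- 1) ^ (0 * 0)) *\<^sub>c R B (R A v)"
      by (rule bracket_extend[OF lin add scale]) (use A B assms(4) in \<open>simp_all add: cs_one\<close>)
    then show ?thesis using True by simp
  next
    case False
    then have "A = 0 \<or> B = 0"
      using pq A B gl2_odd[of A] gl2_odd[of B] by auto
    then show ?thesis
      by (elim disjE) (simp_all add: sbracket_zero R0 lin_zero[OF lin])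
  qed
qed

lemma gl2_subset: "A \<in> gl2 \<Longrightarrow> A \<in> sl12"
  by (rule subsetD[OF part_subset])

lemma rep_gl2:
  assumes "rep sl12 R" shows "rep gl2 R"
  unfolding rep_def
proof (intro conjI ballI allI)
  fix p q A B v
  assume pq: "p \<in> {0::nat, 1}" "q \<in> {0::nat, 1}" and A: "A \<in> gl2 \<inter> sl12_part p" and B: "B \<in> gl2 \<inter> sl12_part q"
  show "R (sbracket p q A B) v = R A (R B v) - ((- 1) ^ (p * q)) *\<^sub>c R B (R A v)"
    using pq by (rule rep_sbracket[OF assms]) (use A B gl2_subset in auto)
qed (simp_all add: rep_lin[OF assms] rep_plus[OF assms] rep_cscale[OF assms] gl2_subset)

lemma sbracket_named:
  "sbracket 0 0 h1 h2 = 0" "sbracket 0 0 h1 x2 = x2" "sbracket 0 0 h1 y2 = cscale (-1) y2"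
  "sbracket 0 0 h2 x2 = cscale 2 x2" "sbracket 0 0 h2 y2 = cscale (-2) y2" "sbracket 0 0 x2 y2 = h2"
  "sbracket 0 (Suc 0) h1 x1 = 0" "sbracket 0 (Suc 0) h1 x3 = x3"
  "sbracket 0 (Suc 0) h1 y1 = 0" "sbracket 0 (Suc 0) h1 y3 = cscale (-1) y3"
  "sbracket 0 (Suc 0) h2 x1 = cscale (-1) x1" "sbracket 0 (Suc 0) h2 x3 = x3"
  "sbracket 0 (Suc 0) h2 y1 = y1" "sbracket 0 (Suc 0) h2 y3 = cscale (-1) y3"
  "sbracket 0 (Suc 0) x2 x1 = cscale (-1) x3" "sbracket 0 (Suc 0) x2 x3 = 0"
  "sbracket 0 (Suc 0) x2 y1 = 0" "sbracket 0 (Suc 0) x2 y3 = y1"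
  "sbracket 0 (Suc 0) y2 x1 = 0" "sbracket 0 (Suc 0) y2 x3 = cscale (-1) x1"
  "sbracket 0 (Suc 0) y2 y1 = y3" "sbracket 0 (Suc 0) y2 y3 = 0"
  "sbracket (Suc 0) (Suc 0) x1 y1 = h1" "sbracket (Suc 0) (Suc 0) x3 y3 = h1 + cscale (-1) h2"
  "sbracket (Suc 0) (Suc 0) x1 y3 = y2" "sbracket (Suc 0) (Suc 0) x3 y1 = x2"
  "sbracket (Suc 0) (Suc 0) y3 y1 = 0" "sbracket (Suc 0) (Suc 0) x3 x1 = 0"
  "sbracket (Suc 0) (Suc 0) x1 x1 = 0" "sbracket (Suc 0) (Suc 0) x3 x3 = 0"
  "sbracket (Suc 0) (Suc 0) y1 y1 = 0" "sbracket (Suc 0) (Suc 0) y3 y3 = 0"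
  by (simp_all add: mat3_eq_iff forall_3 sbracket_nth)

lemma rep_zero:
  assumes "rep k R" "A \<in> k" shows "R 0 v = 0"
proof -
  have "cscale 0 A = 0" by (simp add: mat3_eq_iff)
  then show ?thesis using rep_cscale[OF assms, of 0 v] by simp
qed

lemma gl2_rels:
  assumes "rep gl2 R"
  shows "R h1 (R h2 v) = R h2 (R h1 v)" "R h1 (R x2 v) = R x2 (R h1 v) + R x2 v" "R h1 (R y2 v) = R y2 (R h1 v) - R y2 v"
    "R h2 (R x2 v) = R x2 (R h2 v) + 2 *\<^sub>c R x2 v" "R h2 (R y2 v) = R y2 (R h2 v) - 2 *\<^sub>c R y2 v"
    "R x2 (R y2 v) = R y2 (R x2 v) + R h2 v"
  using rep_sbracket[OF assms, of 0 0 h1 h2 v] rep_sbracket[OF assms, of 0 0 h1 x2 v]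
    rep_sbracket[OF assms, of 0 0 h1 y2 v] rep_sbracket[OF assms, of 0 0 h2 x2 v]
    rep_sbracket[OF assms, of 0 0 h2 y2 v] rep_sbracket[OF assms, of 0 0 x2 y2 v]
  by (simp_all add: sbracket_named cs_one rep_cscale[OF assms] rep_zero[OF assms, of h1] algebra_simps)

section \<open>Irreducible modules over gl(2)\<close>

definition lext :: "('a \<Rightarrow> 'v::cvec) \<Rightarrow> ('a \<Rightarrow>\<^sub>0 complex) \<Rightarrow> 'v" where
  "lext g p = (\<Sum>a\<in>keys p. lookup p a *\<^sub>c g a)"

lemma lext_superset:
  assumes "finite T" "keys p \<subseteq> T"
  shows "lext g p = (\<Sum>a\<in>T. lookup p a *\<^sub>c g a)"
  unfolding lext_def by (rule sum.mono_neutral_left[OF assms]) (simp add: in_keys_iff)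

lemma lin_lext: "lin (lext g)"
proof (rule linI)
  fix p q :: "'a \<Rightarrow>\<^sub>0 complex"
  let ?T = "keys p \<union> keys q"
  have "lext g (p + q) = (\<Sum>a\<in>?T. lookup (p + q) a *\<^sub>c g a)"
    by (rule lext_superset) (use Poly_Mapping.keys_add[of p q] in auto)
  also have "\<dots> = (\<Sum>a\<in>?T. lookup p a *\<^sub>c g a) + (\<Sum>a\<in>?T. lookup q a *\<^sub>c g a)"
    by (simp add: lookup_add cs_left_distrib sum.distrib)
  also have "\<dots> = lext g p + lext g q"
    by (simp add: lext_superset[of ?T p] lext_superset[of ?T q])
  finally show "lext g (p + q) = lext g p + lext g q" .
next
  fix c and p :: "'a \<Rightarrow>\<^sub>0 complex"
  have "lext g (c *\<^sub>c p) = (\<Sum>a\<in>keys p. lookup (c *\<^sub>c p) a *\<^sub>c g a)"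
    by (rule lext_superset) (auto simp: in_keys_iff lookup_cs)
  also have "\<dots> = c *\<^sub>c lext g p"
    by (simp add: lookup_cs cs_complex_def lext_def cvec.scale_sum_right)
  finally show "lext g (c *\<^sub>c p) = c *\<^sub>c lext g p" .
qed

lemma lext_single: "lext g (single a c) = c *\<^sub>c g a"
  by (subst lext_superset[of "{a}"]) simp_all

text \<open>Eigenvectors for distinct eigenvalues are independent: applying \<open>H - c j\<close> to a vanishing sum
  removes the summand \<open>j\<close> and rescales the others by nonzero factors.\<close>

lemma eigenvectors_independent:
  assumes H: "lin H" and "finite I" and "inj_on c I"
    and "\<And>i. i \<in> I \<Longrightarrow> H (w i) = c i *\<^sub>c w i" and "(\<Sum>i\<in>I. w i) = 0" and "i \<in> I"
  shows "w i = 0"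
  using assms(2-6)
proof (induction I arbitrary: w i rule: finite_induct)
  case empty
  then show ?case by simp
next
  case (insert j F)
  have wj: "w j + (\<Sum>i\<in>F. w i) = 0" using insert by simp
  have "0 = H (w j + (\<Sum>i\<in>F. w i)) - c j *\<^sub>c (w j + (\<Sum>i\<in>F. w i))"
    unfolding wj by (simp add: lin_zero[OF H])
  also have "\<dots> = (\<Sum>i\<in>F. H (w i)) - (\<Sum>i\<in>F. c j *\<^sub>c w i)"
    using insert.prems(2)[of j] by (simp add: lin_add[OF H] lin_sum[OF H] cs_right_distrib cvec.scale_sum_right)
  also have "\<dots> = (\<Sum>i\<in>F. (c i - c j) *\<^sub>c w i)"
    using insert.prems(2) by (simp add: cvec.scale_left_diff_distrib sum_subtractf)
  finally have "(\<Sum>i\<in>F. (c i - c j) *\<^sub>c w i) = 0" by simp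
  moreover have "H ((c i - c j) *\<^sub>c w i) = c i *\<^sub>c (c i - c j) *\<^sub>c w i" if "i \<in> F" for i
    using insert.prems(2)[of i] that by (simp add: lin_cs[OF H] cs_cs mult.commute)
  ultimately have "(c i - c j) *\<^sub>c w i = 0" if "i \<in> F" for i
    using insert.IH[of "\<lambda>i. (c i - c j) *\<^sub>c w i" i] insert.prems(1) that by (simp add: inj_on_def)
  then have F: "w i = 0" if "i \<in> F" for i
    using insert.prems(1) insert.hyps that by (auto simp: inj_on_def)
  then have "w j = 0" using wj by simp
  then show ?case using F insert.prems(4) by auto
qed

abbreviation ypow :: "(mat3 \<Rightarrow> 'v \<Rightarrow> 'v) \<Rightarrow> 'v \<Rightarrow> nat \<Rightarrow> 'v" where
  "ypow R v k \<equiv> (R y2 ^^ k) v"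

text \<open>The parameters are the eigenvalues of \<open>h1\<close> and \<open>h2\<close>.\<close>

definition sl2_hwv :: "('v::cvec) action \<Rightarrow> complex \<Rightarrow> complex \<Rightarrow> 'v \<Rightarrow> bool" where
  "sl2_hwv R m lam v \<longleftrightarrow> R x2 v = 0 \<and> R h1 v = m *\<^sub>c v \<and> R h2 v = lam *\<^sub>c v"

text \<open>The standard calculation in a string of \<open>sl(2)\<close>: the vectors obtained from a highest weight
  vector by powers of \<open>y2\<close> are weight vectors, and \<open>x2\<close> lowers the power by one.\<close>

lemma
  assumes R: "rep gl2 R" and v: "sl2_hwv R m lam v"
  shows h2_ypow: "R h2 (ypow R v k) = (lam - 2 * of_nat k) *\<^sub>c ypow R v k"
    and h1_ypow: "R h1 (ypow R v k) = (m - of_nat k) *\<^sub>c ypow R v k"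
    and x2_ypow: "R x2 (ypow R v (Suc k)) = (of_nat (Suc k) * (lam - of_nat k)) *\<^sub>c ypow R v k"
proof -
  note rels = gl2_rels[OF R] lin_cs[OF rep_lin[OF R]] lin_diff[OF rep_lin[OF R]]
  show 1: "R h2 (ypow R v k) = (lam - 2 * of_nat k) *\<^sub>c ypow R v k" for k
  proof (induction k)
    case 0 then show ?case using v by (simp add: sl2_hwv_def)
  next
    case (Suc k)
    have "R h2 (ypow R v (Suc k)) = ((lam - 2 * of_nat k) - 2) *\<^sub>c ypow R v (Suc k)"
      using Suc by (simp add: rels cvec.scale_left_diff_distrib)
    then show ?case by (simp add: algebra_simps)
  qed
  show "R h1 (ypow R v k) = (m - of_nat k) *\<^sub>c ypow R v k"
  proof (induction k)
    case 0 then show ?case using v by (simp add: sl2_hwv_def)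
  next
    case (Suc k)
    have "R h1 (ypow R v (Suc k)) = ((m - of_nat k) - 1) *\<^sub>c ypow R v (Suc k)"
      using Suc by (simp add: rels cvec.scale_left_diff_distrib cs_one)
    then show ?case by (simp add: algebra_simps)
  qed
  show "R x2 (ypow R v (Suc k)) = (of_nat (Suc k) * (lam - of_nat k)) *\<^sub>c ypow R v k"
  proof (induction k)
    case 0 then show ?case
      using v lin_zero[OF rep_lin[OF R]] by (simp add: sl2_hwv_def rels)
  next
    case (Suc k)
    have "R x2 (ypow R v (Suc (Suc k))) = R y2 (R x2 (ypow R v (Suc k))) + R h2 (ypow R v (Suc k))"
      by (simp add: rels)
    also have "\<dots> = (of_nat (Suc k) * (lam - of_nat k)) *\<^sub>c ypow R v (Suc k) + (lam - 2 * of_nat (Suc k)) *\<^sub>c ypow R v (Suc k)"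
      by (simp only: Suc 1 rels) simp
    also have "\<dots> = (of_nat (Suc (Suc k)) * (lam - of_nat (Suc k))) *\<^sub>c ypow R v (Suc k)"
      by (simp only: cs_left_distrib [symmetric]) (simp add: algebra_simps)
    finally show ?case .
  qed
qed

text \<open>The irreducible module of dimension \<open>d\<close>: a function \<open>f\<close> stands for
  $\sum_{k<d} f(k)\,e_k$ with $e_k = y_2^k e_0$. All values at arguments from \<open>d\<close> on are sent to zero, so
  that the relations hold for arbitrary functions. The parameter \<open>d = 0\<close> is permitted and gives the
  zero module, which is the missing summand when the second weight component vanishes.\<close>

definition LX :: "nat \<Rightarrow> (nat \<Rightarrow> complex) \<Rightarrow> nat \<Rightarrow> complex" where
  "LX d f = (\<lambda>k. if k < d then of_nat (Suc k) * (of_nat d - 1 - of_nat k) * f (Suc k) else 0)"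
definition LY :: "nat \<Rightarrow> (nat \<Rightarrow> complex) \<Rightarrow> nat \<Rightarrow> complex" where
  "LY d f = (\<lambda>k. case k of 0 \<Rightarrow> 0 | Suc j \<Rightarrow> if Suc j < d then f j else 0)"
definition LH :: "nat \<Rightarrow> (nat \<Rightarrow> complex) \<Rightarrow> nat \<Rightarrow> complex" where
  "LH d f = (\<lambda>k. if k < d then (of_nat d - 1 - 2 * of_nat k) * f k else 0)"
definition LZ :: "complex \<Rightarrow> nat \<Rightarrow> (nat \<Rightarrow> complex) \<Rightarrow> nat \<Rightarrow> complex" where
  "LZ m d f = (\<lambda>k. if k < d then (m - of_nat k) * f k else 0)"

lemmas Lops_def = LX_def LY_def LH_def LZ_def

definition Lrep :: "complex \<Rightarrow> nat \<Rightarrow> mat3 \<Rightarrow> (nat \<Rightarrow> complex) \<Rightarrow> nat \<Rightarrow> complex" where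
  "Lrep m d = mkrep (\<lambda>_. 0) (LX d) (\<lambda>_. 0) (\<lambda>_. 0) (LY d) (\<lambda>_. 0) (LZ m d) (LH d)"

definition Lcar :: "nat \<Rightarrow> (nat \<Rightarrow> complex) set" where
  "Lcar d = {f. \<forall>k\<ge>d. f k = 0}"

lemma lin_Lops [simp]: "lin (LX d)" "lin (LY d)" "lin (LH d)" "lin (LZ m d)" "lin (\<lambda>_. 0)"
  by (auto simp: lin_def Lops_def fun_eq_iff cs_fun_def cs_complex_def algebra_simps split: nat.split)

lemma Lrep_named [simp]: "Lrep m d x2 = LX d" "Lrep m d y2 = LY d" "Lrep m d h1 = LZ m d" "Lrep m d h2 = LH d"
  by (simp_all add: Lrep_def)

lemma Lops_rels:
  "LX d (LY d f) = LY d (LX d f) + LH d f"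
  "LH d (LX d f) = LX d (LH d f) + 2 *\<^sub>c LX d f" "LH d (LY d f) = LY d (LH d f) - 2 *\<^sub>c LY d f"
  "LZ m d (LX d f) = LX d (LZ m d f) + LX d f" "LZ m d (LY d f) = LY d (LZ m d f) - LY d f"
  "LZ m d (LH d f) = LH d (LZ m d f)"
proof -
  note ext_simps = fun_eq_iff Lops_def cs_fun_def cs_complex_def algebra_simps
  have top: "k < d \<Longrightarrow> \<not> Suc k < d \<Longrightarrow> d = Suc k" for k
    by simp
  show "LX d (LY d f) = LY d (LX d f) + LH d f"
    "LH d (LX d f) = LX d (LH d f) + 2 *\<^sub>c LX d f" "LZ m d (LX d f) = LX d (LZ m d f) + LX d f"
    by (auto simp: ext_simps split: nat.split dest!: top)
qed (auto simp: fun_eq_iff Lops_def cs_fun_def cs_complex_def algebra_simps split: nat.split)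

lemma rep_Lrep: "rep gl2 (Lrep m d)"
proof (rule rep_gl2I)
  show "lin (Lrep m d A)" for A
    unfolding Lrep_def by (intro lin_mkrep lin_Lops)
  show "Lrep m d (A + B) v = Lrep m d A v + Lrep m d B v" for A B v
    unfolding Lrep_def by (rule mkrep_add)
  show "Lrep m d (cscale c A) v = c *\<^sub>c Lrep m d A v" for c A v
    unfolding Lrep_def by (rule mkrep_cscale)
  show "Lrep m d (sbracket 0 0 A B) v = Lrep m d A (Lrep m d B v) - Lrep m d B (Lrep m d A v)"
    if "A \<in> basis_part 0" "B \<in> basis_part 0" for A B v
  proof -
    have e: "Lrep m d C v = ent C 2 3 *\<^sub>c LX d v + ent C 3 2 *\<^sub>c LY d v + ent C 1 1 *\<^sub>c LZ m d v - ent C 3 3 *\<^sub>c LH d v" for C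
      by (simp add: Lrep_def mkrep_def)
    show ?thesis
      using that unfolding basis_part_def
      by (auto simp: e[of "sbracket 0 0 _ _"] sbracket_nth Lops_rels cs_one)
  qed
qed

lemma subspace_Lcar: "cvec.subspace (Lcar d)"
  by (auto simp: cvec.subspace_def Lcar_def cs_fun_def)

lemma Lrep_range: "Lrep m d A f \<in> Lcar d"
  by (auto simp: Lcar_def Lrep_def mkrep_def Lops_def cs_fun_def cs_complex_def split: nat.split)

lemma subrep_Lrep: "subrep k (Lrep m d) (Lcar d)"
  by (simp add: subrep_def subspace_Lcar Lrep_range)

definition unit_fun :: "nat \<Rightarrow> nat \<Rightarrow> complex" where
  "unit_fun k = (\<lambda>j. if j = k then 1 else 0)"

lemma unit_fun_expand:
  assumes "f \<in> Lcar d" shows "f = (\<Sum>k<d. f k *\<^sub>c unit_fun k)"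
proof
  fix j
  have "lin (\<lambda>f::nat \<Rightarrow> complex. f j)" by (simp add: lin_def cs_fun_def)
  then have "(\<Sum>k<d. f k *\<^sub>c unit_fun k) j = (\<Sum>k<d. (f k *\<^sub>c unit_fun k) j)"
    by (rule lin_sum)
  also have "\<dots> = (\<Sum>k<d. if k = j then f k else 0)"
    by (rule sum.cong) (auto simp: cs_fun_def cs_complex_def unit_fun_def)
  also have "\<dots> = f j"
    using assms by (simp add: Lcar_def)
  finally show "f j = (\<Sum>k<d. f k *\<^sub>c unit_fun k) j" by simp
qed

text \<open>Applying \<open>x2\<close> repeatedly to a nonzero vector of an invariant subspace lowers its largest
  index until a multiple of $e_0$ is left, and $e_0$ generates everything under \<open>y2\<close>.\<close>

lemma Lrep_irreducible:
  assumes T: "subrep gl2 (Lrep m d) T" "T \<subseteq> Lcar d" and f: "f \<in> T" "f \<noteq> 0"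
  shows "T = Lcar d"
proof -
  have sub: "cvec.subspace T" and inv: "\<And>A g. A \<in> gl2 \<Longrightarrow> g \<in> T \<Longrightarrow> Lrep m d A g \<in> T"
    using T(1) by (simp_all add: subrep_def)
  have "unit_fun 0 \<in> T" if "g \<in> T" "g j \<noteq> 0" "\<forall>k>j. g k = 0" for g j
    using that
  proof (induction j arbitrary: g)
    case 0
    have "unit_fun 0 = inverse (g 0) *\<^sub>c g"
      using 0 by (auto simp: fun_eq_iff unit_fun_def cs_fun_def cs_complex_def)
    then show ?case using 0 sub by (simp add: cvec.subspace_scale)
  next
    case (Suc j)
    have "Suc j < d" using Suc.prems T(2) by (force simp: Lcar_def)
    have "of_nat d \<noteq> 1 + (of_nat j :: complex)"
      using \<open>Suc j < d\<close> of_nat_eq_iff[of d "Suc j", where 'a = complex] by auto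
    then have "LX d g j \<noteq> 0"
      using Suc.prems(2) \<open>Suc j < d\<close> by (auto simp: LX_def diff_diff_eq simp del: of_nat_Suc)
    moreover have "\<forall>k>j. LX d g k = 0" using Suc.prems(3) by (simp add: LX_def)
    moreover have "LX d g \<in> T" using inv[of x2 g] Suc.prems(1) by simp
    ultimately show ?case by (intro Suc.IH)
  qed
  moreover obtain j where "f j \<noteq> 0" "\<forall>k>j. f k = 0"
  proof -
    have "{k. f k \<noteq> 0} \<subseteq> {..<d}"
      using subsetD[OF T(2) f(1)] by (auto simp: Lcar_def not_less [symmetric])
    then have fin: "finite {k. f k \<noteq> 0}" by (rule finite_subset) simp
    moreover have "{k. f k \<noteq> 0} \<noteq> {}" using f(2) by (auto simp: fun_eq_iff)
    ultimately have "f (Max {k. f k \<noteq> 0}) \<noteq> 0" using Max_in[of "{k. f k \<noteq> 0}"] by simp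
    moreover have "\<forall>k > Max {k. f k \<noteq> 0}. f k = 0"
    proof (intro allI impI, rule ccontr)
      fix k assume "k > Max {k. f k \<noteq> 0}" "f k \<noteq> 0"
      then show False using Max_ge[OF fin, of k] by simp
    qed
    ultimately show ?thesis by (rule that)
  qed
  ultimately have u0: "unit_fun 0 \<in> T" using f(1) by simp
  have "unit_fun k \<in> T" if "k < d" for k
    using that
  proof (induction k)
    case 0 show ?case by (rule u0)
  next
    case (Suc k)
    have "unit_fun (Suc k) = LY d (unit_fun k)"
      using Suc.prems by (auto simp: fun_eq_iff unit_fun_def LY_def split: nat.split)
    then show ?case using Suc inv[of y2 "unit_fun k"] by simp
  qed
  then have "g \<in> T" if "g \<in> Lcar d" for g
    by (subst unit_fun_expand[OF that]) (intro cvec.subspace_sum cvec.subspace_scale sub, simp)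
  then show ?thesis using T(2) by (intro equalityI subsetI) auto
qed

text \<open>The comparison map from the model to the string of a highest weight vector \<open>v\<close>. If \<open>v\<close> has
  \<open>h2\<close>-weight \<open>d - 1\<close>, it is a homomorphism as soon as the \<open>d\<close>-th power of \<open>y2\<close> kills \<open>v\<close>.\<close>

definition iota :: "('v::cvec) action \<Rightarrow> 'v \<Rightarrow> nat \<Rightarrow> (nat \<Rightarrow> complex) \<Rightarrow> 'v" where
  "iota R v d u = (\<Sum>k<d. u k *\<^sub>c ypow R v k)"

lemma lin_iota: "lin (iota R v d)"
  by (rule linI) (simp_all add: iota_def cs_left_distrib sum.distrib cvec.scale_sum_right cs_fun_def cs_complex_def)

lemma iota_hom:
  assumes R: "rep gl2 R" and v: "sl2_hwv R m (of_nat d - 1) v" and top: "ypow R v d = 0"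
    and A: "A \<in> gl2"
  shows "R A (iota R v d u) = iota R v d (Lrep m d A u)"
proof (rule part_induct[of 0 A "\<lambda>A. R A (iota R v d u) = iota R v d (Lrep m d A u)"])
  note lR = rep_lin[OF R]
  have 1: "R h1 (iota R v d u) = iota R v d (Lrep m d h1 u)"
    by (simp add: iota_def lin_sum[OF lR] lin_cs[OF lR] h1_ypow[OF R v] cs_cs LZ_def mult.commute)
  have 2: "R h2 (iota R v d u) = iota R v d (Lrep m d h2 u)"
    by (simp add: iota_def lin_sum[OF lR] lin_cs[OF lR] h2_ypow[OF R v] cs_cs LH_def mult.commute)
  have 3: "R y2 (iota R v d u) = iota R v d (Lrep m d y2 u)"
  proof (cases d)
    case (Suc e)
    have "R y2 (iota R v d u) = (\<Sum>k<Suc e. u k *\<^sub>c ypow R v (Suc k))"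
      by (simp only: Suc iota_def lin_sum[OF lR] lin_cs[OF lR] funpow.simps comp_def)
    also have "\<dots> = (\<Sum>k<e. u k *\<^sub>c ypow R v (Suc k))" using top Suc by simp
    also have "\<dots> = iota R v d (Lrep m d y2 u)"
      by (simp only: Suc iota_def sum.lessThan_Suc_shift) (simp add: LY_def)
    finally show ?thesis .
  qed (simp add: iota_def lin_zero[OF lR])
  have 4: "R x2 (iota R v d u) = iota R v d (Lrep m d x2 u)"
  proof (cases d)
    case (Suc e)
    have "R x2 (iota R v d u) = (\<Sum>k<e. u (Suc k) *\<^sub>c R x2 (ypow R v (Suc k)))"
      using v by (simp only: Suc iota_def sum.lessThan_Suc_shift lin_add[OF lR] lin_sum[OF lR] lin_cs[OF lR])
        (simp add: sl2_hwv_def)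
    also have "\<dots> = (\<Sum>k<e. LX d u k *\<^sub>c ypow R v k)"
      by (rule sum.cong) (simp_all add: x2_ypow[OF R v] LX_def Suc cs_cs mult.commute del: funpow.simps of_nat_Suc)
    also have "\<dots> = iota R v d (Lrep m d x2 u)"
      by (simp add: iota_def Suc LX_def)
    finally show ?thesis .
  qed (simp add: iota_def lin_zero[OF lR])
  show "R B (iota R v d u) = iota R v d (Lrep m d B u)" if "B \<in> basis_part 0" for B
    using that 1 2 3 4 by (auto simp: basis_part_def)
qed (simp_all add: A rep_plus[OF R] rep_plus[OF rep_Lrep] rep_cscale[OF R] rep_cscale[OF rep_Lrep]
      lin_add[OF lin_iota] lin_cs[OF lin_iota])

lemma iota_unit: "0 < d \<Longrightarrow> iota R v d (unit_fun 0) = v"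
  by (cases d) (simp_all only: iota_def sum.lessThan_Suc_shift, simp_all add: unit_fun_def cs_one)

text \<open>Otherwise the powers of \<open>y2\<close> would give infinitely many eigenvectors of \<open>h2\<close> with distinct
  eigenvalues.\<close>

lemma ypow_finite_dim:
  assumes R: "rep gl2 R" and v: "sl2_hwv R m lam v" and B: "finite B" "\<And>k. ypow R v k \<in> cvec.span B"
  obtains n where "ypow R v n = 0"
proof (rule ccontr)
  assume "\<not> thesis"
  then have nz: "ypow R v k \<noteq> 0" for k using that by auto
  let ?I = "{..card B}"
  let ?c = "\<lambda>k. lam - 2 * of_nat k :: complex"
  have inj: "inj_on (ypow R v) ?I"
  proof (rule inj_onI)
    fix i j assume "ypow R v i = ypow R v j"
    then have "?c i *\<^sub>c ypow R v i = ?c j *\<^sub>c ypow R v i"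
      using h2_ypow[OF R v, of i] h2_ypow[OF R v, of j] by metis
    then show "i = j" using nz[of i] by (simp only: cvec.scale_cancel_right) simp
  qed
  have "cvec.independent (ypow R v ` ?I)"
  proof
    assume "cvec.dependent (ypow R v ` ?I)"
    then have "\<exists>u. (\<exists>b\<in>ypow R v ` ?I. u b \<noteq> 0) \<and> (\<Sum>b\<in>ypow R v ` ?I. u b *\<^sub>c b) = 0"
      by (simp only: cvec.dependent_finite[OF finite_imageI[OF finite_atMost]])
    then obtain u b where b: "b \<in> ypow R v ` ?I" "u b \<noteq> 0" and sum: "(\<Sum>b\<in>ypow R v ` ?I. u b *\<^sub>c b) = 0"
      by (elim exE conjE bexE)
    obtain i where i: "i \<in> ?I" "b = ypow R v i" using b by auto
    have s: "(\<Sum>k\<in>?I. u (ypow R v k) *\<^sub>c ypow R v k) = 0"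
      using sum by (simp add: sum.reindex[OF inj])
    have "u (ypow R v i) *\<^sub>c ypow R v i = 0"
      by (rule eigenvectors_independent[where c = ?c, OF rep_lin[OF R, of h2] finite_atMost _ _ s i(1)])
        (simp_all add: lin_cs[OF rep_lin[OF R]] h2_ypow[OF R v] cs_cs mult.commute inj_on_def)
    then show False using b i nz[of i] by simp
  qed
  then have "card (ypow R v ` ?I) \<le> card B"
    using cvec.independent_span_bound[OF B(1)] B(2) by (simp add: image_subset_iff)
  then show False using card_image[OF inj] by simp
qed

text \<open>At the first vanishing power of \<open>y2\<close> the coefficient in \<open>x2_ypow\<close> must vanish.\<close>

lemma sl2_weight_natural:
  assumes R: "rep gl2 R" and v: "sl2_hwv R m lam v" "v \<noteq> 0" and "ypow R v n = 0"
  obtains j where "lam = of_nat j" "ypow R v (Suc j) = 0"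
proof -
  define n' where "n' = (LEAST n. ypow R v n = 0)"
  have n': "ypow R v n' = 0" "\<And>k. k < n' \<Longrightarrow> ypow R v k \<noteq> 0"
    unfolding n'_def using assms(4) by (auto intro: LeastI dest: not_less_Least)
  then obtain j where j: "n' = Suc j" using v(2) by (cases n') auto
  have "(of_nat (Suc j) * (lam - of_nat j)) *\<^sub>c ypow R v j = 0"
    using x2_ypow[OF R v(1), of j] n'(1) lin_zero[OF rep_lin[OF R, of x2]] by (simp only: j)
  then have "lam = of_nat j"
    using n'(2)[of j] j by (simp del: of_nat_Suc)
  then show ?thesis using that n'(1) j by simp
qed

lemma lie_submodule_rep_module:
  assumes "cvec.subspace S" "lie_submodule k W (rep_module R S)"
  shows "subrep k R W" "W \<subseteq> S"
proof -
  interpret Module.module complex_ring "rep_module R S" by (rule module_rep_module) fact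
  have W: "submodule W complex_ring (rep_module R S)" "\<forall>A\<in>k. \<forall>w\<in>W. R A w \<in> W"
    using assms(2) by (simp_all add: lie_submodule_def)
  note E = submoduleE[OF W(1), simplified]
  show "W \<subseteq> S" by (rule E(1))
  obtain w where "w \<in> W" using E(2) by auto
  then have "0 \<in> W" using E(4)[of w 0] by simp
  then show "subrep k R W"
    using E(4,5) W(2) by (simp add: subrep_def cvec.subspace_def)
qed

lemma lie_module_zero_closed:
  assumes "lie_module k V" shows "\<zero>\<^bsub>V\<^esub> \<in> carrier V"
proof -
  interpret Module.module complex_ring V using assms by (simp add: lie_module_def)
  show ?thesis by (rule M.zero_closed)
qed

lemma lie_hom_zero:
  assumes "lie_module k V" "lie_hom k V (rep_module R S) f"
  shows "f \<zero>\<^bsub>V\<^esub> = 0"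
proof -
  interpret Module.module complex_ring V using assms by (simp add: lie_module_def)
  have "\<forall>v\<in>carrier V. \<forall>w\<in>carrier V. f (v \<oplus>\<^bsub>V\<^esub> w) = f v + f w"
    using assms(2) by (simp add: lie_hom_def)
  from this[rule_format, OF M.zero_closed M.zero_closed] show ?thesis by simp
qed

text \<open>The preimage of an invariant subspace is a submodule.\<close>

lemma irreducible_transfer:
  assumes V: "irreducible_module k V" and f: "lie_hom k V (rep_module R S) f" "bij_betw f (carrier V) S"
    and T: "subrep k R T" "T \<subseteq> S"
  shows "T = {0} \<or> T = S"
proof -
  have lm: "lie_module k V" using V by (simp add: irreducible_module_def)
  interpret Module.module complex_ring V using lm by (simp add: lie_module_def)
  note f0 = lie_hom_zero[OF lm f(1)]
  have fa: "f (v \<oplus>\<^bsub>V\<^esub> w) = f v + f w" if "v \<in> carrier V" "w \<in> carrier V" for v w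
    using f(1) that by (simp add: lie_hom_def)
  have fc: "f (c \<odot>\<^bsub>V\<^esub> v) = c *\<^sub>c f v" if "v \<in> carrier V" for c v
    using f(1) that by (simp add: lie_hom_def)
  have fR: "f (act V A v) = R A (f v)" if "v \<in> carrier V" "A \<in> k" for A v
    using f(1) that by (simp add: lie_hom_def)
  have sub: "cvec.subspace T" and inv: "\<And>A g. A \<in> k \<Longrightarrow> g \<in> T \<Longrightarrow> R A g \<in> T"
    using T(1) by (simp_all add: subrep_def)
  define W where "W = {v \<in> carrier V. f v \<in> T}"
  have fW: "f ` W = T"
    using f(2) T(2) by (auto simp: W_def bij_betw_def)
  have "submodule W complex_ring V"
  proof (rule submoduleI)
    show "\<ominus>\<^bsub>V\<^esub> a \<in> W" if "a \<in> W" for a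
    proof -
      have a: "a \<in> carrier V" "f a \<in> T" using that by (simp_all add: W_def)
      have "f (\<ominus>\<^bsub>V\<^esub> a) + f a = 0"
        using fa[of "\<ominus>\<^bsub>V\<^esub> a" a] a f0 by (simp add: l_neg)
      then have "f (\<ominus>\<^bsub>V\<^esub> a) = - f a" by (simp add: eq_neg_iff_add_eq_0)
      then show ?thesis using a sub by (simp add: W_def cvec.subspace_neg)
    qed
  qed (auto simp: W_def f0 fa fc sub cvec.subspace_0 cvec.subspace_add cvec.subspace_scale)
  then have "lie_submodule k W V"
    using inv lie_module_closed(1)[OF lm] by (simp add: lie_submodule_def W_def fR)
  then have "W = {\<zero>\<^bsub>V\<^esub>} \<or> W = carrier V"
    using V by (simp add: irreducible_module_def)
  then show ?thesis using fW f0 f(2) by (auto simp: bij_betw_def)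
qed

lemma mspan_induct:
  assumes "A \<in> mspan G" "P 0" "\<And>B C c. B \<in> G \<Longrightarrow> P C \<Longrightarrow> P (cscale c B + C)"
  shows "P A"
proof -
  obtain T c where T: "finite T" "T \<subseteq> G" and A: "A = (\<Sum>B\<in>T. cscale (c B) B)"
    using assms(1) by (auto simp: mspan_def)
  show ?thesis
    unfolding A using T by (induction T rule: finite_induct) (simp_all add: assms(2,3))
qed

lemma mspan_base: "B \<in> G \<Longrightarrow> B \<in> mspan G"
proof -
  assume "B \<in> G"
  moreover have "B = (\<Sum>A\<in>{B}. cscale 1 A)" by (simp add: mat3_eq_iff)
  ultimately show ?thesis unfolding mspan_def by (auto intro!: exI[of _ "{B}"] exI[of _ "\<lambda>_. 1"])
qed

lemma mspan_kills:
  assumes R: "rep k R" "subalg k" "h1 \<in> k" and G: "G \<subseteq> k" "\<And>B. B \<in> G \<Longrightarrow> R B v = 0" and A: "A \<in> mspan G"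
  shows "R A v = 0"
proof -
  have cl: "B + C \<in> k" "cscale c B \<in> k" if "B \<in> k" "C \<in> k" for B C c
    using R(2) that by (auto simp: subalg_def)
  have "cscale 0 h1 = 0" by (simp add: mat3_eq_iff)
  then have "0 \<in> k" using cl(2)[OF R(3) R(3), of 0] by simp
  have "A \<in> k \<and> R A v = 0"
    using A
  proof (rule mspan_induct)
    show "0 \<in> k \<and> R 0 v = 0" using \<open>0 \<in> k\<close> rep_zero[OF R(1,3)] by simp
    fix B C c assume "B \<in> G" "C \<in> k \<and> R C v = 0"
    moreover from this have "B \<in> k" using G(1) by auto
    ultimately show "cscale c B + C \<in> k \<and> R (cscale c B + C) v = 0"
      using G(2) by (simp add: cl rep_plus[OF R(1)] rep_cscale[OF R(1)])
  qed
  then show ?thesis ..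
qed

lemma rep_cartan:
  assumes "rep k R" "gl2 \<subseteq> k"
  shows "R (cartan a c) v = a *\<^sub>c R h1 v + c *\<^sub>c R h2 v"
  using assms(2) unfolding cartan_def
  by (simp add: subset_iff rep_plus[OF assms(1)] rep_cscale[OF assms(1)] part_closed)

lemma Lrep_hw_module:
  "irreducible_hw_module gl2 nplus0 (m, of_nat n) (rep_module (Lrep m (Suc n)) (Lcar (Suc n)))"
proof -
  let ?R = "Lrep m (Suc n)" and ?S = "Lcar (Suc n)"
  have u: "unit_fun 0 \<in> ?S" "unit_fun 0 \<noteq> 0"
    by (auto simp: Lcar_def unit_fun_def fun_eq_iff)
  have "W = {0} \<or> W = ?S" if "lie_submodule gl2 W (rep_module ?R ?S)" for W
  proof -
    note W = lie_submodule_rep_module[OF subspace_Lcar that]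
    have "0 \<in> W" using W(1) by (simp add: subrep_def cvec.subspace_0)
    then show ?thesis using Lrep_irreducible[OF W] by auto
  qed
  moreover have "?S \<noteq> {0}" using u by auto
  ultimately have irr: "irreducible_module gl2 (rep_module ?R ?S)"
    by (simp add: irreducible_module_def lie_module_rep_module[OF rep_Lrep subrep_Lrep])
  have "highest_weight_vector nplus0 (m, of_nat n) (rep_module ?R ?S) (unit_fun 0)"
    unfolding highest_weight_vector_def rep_module_simps
  proof (intro conjI ballI allI u)
    show "?R A (unit_fun 0) = 0" if "A \<in> nplus0" for A
      using that unfolding nplus0_def
      by (rule mspan_kills[OF rep_Lrep subalg_gl2 named_in_part(3), rotated 2])
        (auto simp: LX_def unit_fun_def fun_eq_iff)
    show "?R (cartan a c) (unit_fun 0) = weight_eval (m, of_nat n) a c *\<^sub>c unit_fun 0" for a c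
      by (auto simp: rep_cartan[OF rep_Lrep order_refl] weight_eval_def LZ_def LH_def unit_fun_def
          fun_eq_iff cs_fun_def cs_complex_def)
  qed
  then show ?thesis using irr unfolding irreducible_hw_module_def by (intro conjI exI)
qed

lemma sl2_ypow_nonzero:
  assumes R: "rep gl2 R" and v: "sl2_hwv R m (of_nat n) v" "v \<noteq> 0" and "k \<le> n"
  shows "ypow R v k \<noteq> 0"
  using assms(4)
proof (induction k)
  case 0
  then show ?case using v by simp
next
  case (Suc k)
  have "of_nat n - of_nat k = (of_nat (n - k) :: complex)"
    using Suc.prems by (simp add: of_nat_diff)
  also have "\<dots> \<noteq> 0" using Suc.prems by simp
  finally have "of_nat (Suc k) * (of_nat n - of_nat k) \<noteq> (0::complex)" by (simp del: of_nat_Suc)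
  then have "R x2 (ypow R v (Suc k)) \<noteq> 0"
    using Suc by (simp only: x2_ypow[OF R v(1)] cvec.scale_eq_0_iff) simp
  then show ?case using lin_zero[OF rep_lin[OF R, of x2]] by auto
qed

text \<open>The vectors $y_2^k v$ with $k>n$ span a submodule, because \<open>x2\<close> kills $y_2^{n+1}v$. It does not
  contain \<open>v\<close>, whose eigenvalue under \<open>h2\<close> differs from theirs, so it is zero by irreducibility.\<close>

lemma irreducible_string_top:
  assumes R: "rep gl2 R" and v: "sl2_hwv R m (of_nat n) v" "v \<noteq> 0" "v \<in> S" and S: "subrep gl2 R S"
    and irr: "\<And>T. subrep gl2 R T \<Longrightarrow> T \<subseteq> S \<Longrightarrow> T = {0} \<or> T = S"
  shows "ypow R v (Suc n) = 0"
proof -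
  note lR = rep_lin[OF R]
  have S': "cvec.subspace S" "\<And>A w. A \<in> gl2 \<Longrightarrow> w \<in> S \<Longrightarrow> R A w \<in> S" using S by (simp_all add: subrep_def)
  have yS: "ypow R v k \<in> S" for k by (induction k) (simp_all add: v S')
  define W where "W = ypow R v ` {Suc n..}"
  define T where "T = cvec.span W"
  have wT: "ypow R v k \<in> T" if "k > n" for k
    using that unfolding T_def W_def by (intro cvec.span_base imageI) simp
  have subT: "cvec.subspace T" unfolding T_def by (rule cvec.subspace_span)
  have "R A t \<in> T" if A: "A \<in> gl2" and t: "t \<in> T" for A t
    using t unfolding T_def
  proof (rule cvec.span_induct)
    show "cvec.subspace {t. R A t \<in> cvec.span W}"
      unfolding cvec.subspace_def mem_Collect_eq
      by (simp add: lin_zero[OF lR] lin_add[OF lR] lin_cs[OF lR] cvec.span_zero cvec.span_add cvec.span_scale)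
    fix x assume "x \<in> W"
    then obtain k where k: "x = ypow R v k" "k > n" by (auto simp: W_def)
    have "R A x \<in> T"
    proof (rule part_induct[OF _ A])
      have "R y2 x \<in> T" using wT[of "Suc k"] k by simp
      moreover have "R h1 x \<in> T" "R h2 x \<in> T"
        using wT[of k] k subT by (simp_all only: h1_ypow[OF R v(1)] h2_ypow[OF R v(1)] cvec.subspace_scale)
      moreover have "R x2 x \<in> T"
      proof -
        obtain j where j: "k = Suc j" using k by (cases k) auto
        show ?thesis
        proof (cases "j = n")
          case True
          then show ?thesis using k j subT by (simp only: x2_ypow[OF R v(1)]) (simp add: cvec.subspace_0)
        next
          case False
          then show ?thesis using k j subT wT[of j] by (simp only: x2_ypow[OF R v(1)] cvec.subspace_scale)
        qed
      qed
      ultimately show "R B x \<in> T" if "B \<in> basis_part 0" for B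
        using that by (auto simp: basis_part_def)
    qed (simp_all add: rep_plus[OF R] rep_cscale[OF R] cvec.subspace_add[OF subT] cvec.subspace_scale[OF subT])
    then show "R A x \<in> cvec.span W" by (simp add: T_def)
  qed
  then have "subrep gl2 R T" using subT by (simp add: subrep_def)
  moreover have "T \<subseteq> S" unfolding T_def by (rule cvec.span_minimal) (use yS S' in \<open>auto simp: W_def\<close>)
  ultimately have "T = {0} \<or> T = S" by (rule irr)
  moreover have "v \<notin> T"
  proof
    assume "v \<in> T"
    have "T \<subseteq> lext (ypow R v) ` {p. keys p \<subseteq> {Suc n..}}"
      unfolding T_def
    proof (rule cvec.span_minimal)
      show "W \<subseteq> lext (ypow R v) ` {p. keys p \<subseteq> {Suc n..}}"
      proof
        fix x assume "x \<in> W"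
        then obtain k where k: "x = ypow R v k" "k \<ge> Suc n" by (auto simp: W_def)
        then have "x = lext (ypow R v) (single k 1)" by (simp add: lext_single cs_one)
        then show "x \<in> lext (ypow R v) ` {p. keys p \<subseteq> {Suc n..}}"
          using k by (intro image_eqI) auto
      qed
      have "cvec.subspace {p :: nat \<Rightarrow>\<^sub>0 complex. keys p \<subseteq> {Suc n..}}"
        unfolding cvec.subspace_def mem_Collect_eq
      proof (intro conjI ballI allI)
        show "keys (p + q) \<subseteq> {Suc n..}" if "p \<in> {p. keys p \<subseteq> {Suc n..}}"
          "q \<in> {p. keys p \<subseteq> {Suc n..}}" for p q :: "nat \<Rightarrow>\<^sub>0 complex"
          using that Poly_Mapping.keys_add[of p q] by auto
        show "keys (c *\<^sub>c p) \<subseteq> {Suc n..}" if "p \<in> {p. keys p \<subseteq> {Suc n..}}"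
          for c and p :: "nat \<Rightarrow>\<^sub>0 complex"
          using that by (auto simp: in_keys_iff lookup_cs)
      qed simp
      then show "cvec.subspace (lext (ypow R v) ` {p. keys p \<subseteq> {Suc n..}})"
        by (rule cvec.linear_subspace_image[OF lin_lext[unfolded lin_iff_linear]])
    qed
    from subsetD[OF this \<open>v \<in> T\<close>]
    obtain p where p': "v = lext (ypow R v) p" "p \<in> {p. keys p \<subseteq> {Suc n..}}"
      by (rule imageE)
    have p: "keys p \<subseteq> {Suc n..}" using p'(2) by simp
    let ?K = "keys p"
    \<comment> \<open>The index 0 is free because all keys exceed \<open>n\<close>; it carries \<open>- v\<close>, whose eigenvalue is the one for \<open>k = 0\<close>.\<close>
    define w where "w k = (if k = 0 then - v else lookup p k *\<^sub>c ypow R v k)" for k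
    have 0: "0 \<notin> ?K" using p by auto
    then have "(\<Sum>k\<in>?K. w k) = (\<Sum>k\<in>?K. lookup p k *\<^sub>c ypow R v k)"
      by (intro sum.cong) (auto simp: w_def)
    then have s: "(\<Sum>k\<in>insert 0 ?K. w k) = 0"
      using 0 p'(1)[symmetric] by (simp add: w_def lext_def)
    have e: "R h2 (w k) = (of_nat n - 2 * of_nat k) *\<^sub>c w k" for k
    proof (cases "k = 0")
      case True
      then show ?thesis using h2_ypow[OF R v(1), of 0] by (simp add: w_def lin_minus[OF lR])
    next
      case False
      then show ?thesis
        by (simp only: w_def if_False lin_cs[OF lR] h2_ypow[OF R v(1)] cs_cs mult.commute)
    qed
    have "w 0 = 0"
      by (rule eigenvectors_independent[OF lR[of h2] _ _ e s insertI1]) (simp_all add: inj_on_def)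
    then show False using v(2) by (simp add: w_def)
  qed
  ultimately have "T = {0}" using v(3) by auto
  then show ?thesis using wT[of "Suc n"] by simp
qed

lemma irreducible_hw_module_iso_Lrep:
  fixes V :: "'v lmod"
  assumes V: "irreducible_hw_module gl2 nplus0 (m, of_nat n) V"
  shows "module_iso gl2 V (rep_module (Lrep m (Suc n)) (Lcar (Suc n)))"
proof -
  have irr: "irreducible_module gl2 V" and lm: "lie_module gl2 V"
    using V by (simp_all add: irreducible_hw_module_def irreducible_module_def)
  obtain v0 where v0: "highest_weight_vector nplus0 (m, of_nat n) V v0"
    using V by (auto simp: irreducible_hw_module_def)
  obtain R :: "mat3 \<Rightarrow> ('v \<Rightarrow>\<^sub>0 complex) \<Rightarrow> ('v \<Rightarrow>\<^sub>0 complex)" and S f where R: "rep gl2 R" and S: "subrep gl2 R S" and f: "lie_hom gl2 V (rep_module R S) f" "bij_betw f (carrier V) S"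
    using embed_lie_module[OF lm subalg_gl2] .
  define v where "v = f v0"
  have v0c: "v0 \<in> carrier V" "v0 \<noteq> \<zero>\<^bsub>V\<^esub>" using v0 by (simp_all add: highest_weight_vector_def)
  have vS: "v \<in> S" using f(2) v0c by (auto simp: v_def bij_betw_def)
  note f0 = lie_hom_zero[OF lm f(1)]
  have zc: "\<zero>\<^bsub>V\<^esub> \<in> carrier V"
    by (rule lie_module_zero_closed[OF lm])
  have vn: "v \<noteq> 0"
    using f(2) v0c f0 zc by (auto simp: v_def bij_betw_def inj_on_def)
  have Rv: "R A v = f (act V A v0)" if "A \<in> gl2" for A
    using f(1) that v0c by (simp add: v_def lie_hom_def)
  have fc: "f (c \<odot>\<^bsub>V\<^esub> v0) = c *\<^sub>c v" for c
    using f(1) v0c by (simp add: lie_hom_def v_def)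
  have ca: "R (cartan a c) v = weight_eval (m, of_nat n) a c *\<^sub>c v" for a c
    using v0 fc by (simp add: Rv highest_weight_vector_def)
  have "R x2 v = 0"
    using v0 f0 mspan_base[of x2 "{x2}"] by (simp add: Rv highest_weight_vector_def nplus0_def)
  then have hw: "sl2_hwv R m (of_nat n) v"
    using ca[of 1 0] ca[of 0 1] by (simp add: sl2_hwv_def rep_cartan[OF R order_refl] weight_eval_def cs_one)
  note irrS = irreducible_transfer[OF irr f]
  have top: "ypow R v (Suc n) = 0"
    by (rule irreducible_string_top[OF R hw vn vS S]) (rule irrS)
  have hw': "sl2_hwv R m (of_nat (Suc n) - 1) v" using hw by simp
  let ?L = "Lcar (Suc n)" and ?i = "iota R v (Suc n)"
  note hom = iota_hom[OF R hw' top]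
  have i0: "?i (unit_fun 0) = v" by (rule iota_unit) simp
  have u: "unit_fun 0 \<in> ?L" by (simp add: Lcar_def unit_fun_def)
  have subS: "cvec.subspace S" and inv: "\<And>A w. A \<in> gl2 \<Longrightarrow> w \<in> S \<Longrightarrow> R A w \<in> S"
    using S by (simp_all add: subrep_def)
  have yS: "ypow R v k \<in> S" for k by (induction k) (simp_all add: vS inv)
  have "subrep gl2 R (?i ` ?L)"
    unfolding subrep_def
  proof (intro conjI ballI)
    show "cvec.subspace (?i ` ?L)"
      by (rule cvec.linear_subspace_image[OF lin_iota[unfolded lin_iff_linear] subspace_Lcar])
    show "R A w \<in> ?i ` ?L" if "A \<in> gl2" and w: "w \<in> ?i ` ?L" for A w
    proof -
      obtain u where u: "w = ?i u" "u \<in> ?L" using w by (rule imageE)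
      show ?thesis unfolding u(1) hom[OF that(1)] by (rule imageI) (rule Lrep_range)
    qed
  qed
  moreover have "?i ` ?L \<subseteq> S"
    unfolding iota_def by (intro image_subsetI cvec.subspace_sum cvec.subspace_scale subS yS)
  ultimately have "?i ` ?L = {0} \<or> ?i ` ?L = S" by (rule irrS)
  moreover have "?i (unit_fun 0) \<in> ?i ` ?L" using u by (rule imageI)
  ultimately have surj: "?i ` ?L = S"
  proof (elim disjE)
    assume "?i (unit_fun 0) \<in> ?i ` ?L" "?i ` ?L = {0}"
    then have "?i (unit_fun 0) = 0" by simp
    then show ?thesis using vn by (simp only: i0)
  qed
  have inj: "inj_on ?i ?L"
  proof (rule inj_onI)
    fix a b assume ab: "a \<in> ?L" "b \<in> ?L" "?i a = ?i b"
    have "?i (a - b) = 0" using ab by (simp add: lin_diff[OF lin_iota])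
    then have s: "(\<Sum>k<Suc n. (a - b) k *\<^sub>c ypow R v k) = 0" by (simp only: iota_def)
    have "(a - b) k = 0" if "k < Suc n" for k
    proof -
      have "(a - b) k *\<^sub>c ypow R v k = 0"
        by (rule eigenvectors_independent[OF rep_lin[OF R, of h2] finite_lessThan _ _ s, where c = "\<lambda>k. of_nat n - 2 * of_nat k"])
          (use that in \<open>simp_all add: lin_cs[OF rep_lin[OF R]] h2_ypow[OF R hw] cs_cs mult.commute inj_on_def\<close>)
      then show ?thesis using sl2_ypow_nonzero[OF R hw vn, of k] that by simp
    qed
    moreover have "(a - b) k = 0" if "\<not> k < Suc n" for k
      using ab(1,2) that by (simp add: Lcar_def)
    ultimately have "(a - b) k = 0" for k by (cases "k < Suc n")
    then show "a = b" by (simp add: fun_eq_iff)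
  qed
  have a: "module_iso gl2 (rep_module (Lrep m (Suc n)) ?L) (rep_module R S)"
    unfolding module_iso_iff
  proof (intro exI[of _ ?i] conjI)
    have "?i u \<in> S" if "u \<in> ?L" for u
      unfolding surj[symmetric] using that by (rule imageI)
    then show "lie_hom gl2 (rep_module (Lrep m (Suc n)) ?L) (rep_module R S) ?i"
      by (simp add: lie_hom_def hom lin_add[OF lin_iota] lin_cs[OF lin_iota])
    show "bij_betw ?i (carrier (rep_module (Lrep m (Suc n)) ?L)) (carrier (rep_module R S))"
      by (simp add: bij_betw_def surj inj)
  qed
  have b: "module_iso gl2 V (rep_module R S)"
    unfolding module_iso_iff by (rule exI[of _ f]) (simp add: f)
  show ?thesis
    by (rule module_iso_trans[OF b module_iso_sym[OF lie_module_rep_module[OF rep_Lrep subrep_Lrep] a]])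
qed

text \<open>The choice in \<^const>\<open>L_gl\<close> is harmless: a module as described exists, namely the model, and every such module
  is isomorphic to it.\<close>

theorem L_gl_iso_Lrep: "module_iso gl2 (L_gl (m, of_nat n)) (rep_module (Lrep m (Suc n)) (Lcar (Suc n)))"
  and L_gl_lie_module: "lie_module gl2 (L_gl (m, of_nat n))"
proof -
  have "irreducible_hw_module gl2 nplus0 (m, of_nat n) (L_gl (m, of_nat n))"
    unfolding L_gl_def by (rule someI) (rule Lrep_hw_module)
  note V = this
  show "module_iso gl2 (L_gl (m, of_nat n)) (rep_module (Lrep m (Suc n)) (Lcar (Suc n)))"
    by (rule irreducible_hw_module_iso_Lrep[OF V])
  show "lie_module gl2 (L_gl (m, of_nat n))"
    using V by (simp add: irreducible_hw_module_def irreducible_module_def)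
qed

section \<open>The induced module\<close>

lemma cs_two: "2 *\<^sub>c (w :: 'v::cvec) = w + w"
proof -
  have "2 *\<^sub>c w = (1 + 1) *\<^sub>c w" by simp
  then show ?thesis by (simp only: cs_left_distrib cs_one)
qed

lemma double_zero: "(w :: 'v::cvec) + w = 0 \<Longrightarrow> w = 0"
  by (simp only: cs_two [symmetric] cvec.scale_eq_0_iff) simp

lemma cs_Pair: "c *\<^sub>c (a, b) = (c *\<^sub>c a, c *\<^sub>c b)"
  by (simp add: cs_prod_def)

text \<open>The tuple \<open>(a, b, c, d)\<close> stands for $a + y_1 b + y_3 c + y_1y_3 d$ in the module induced from the
  \<open>gl(2)\<close>-module \<open>Q\<close> with \<open>x1\<close> and \<open>x3\<close> acting on it by zero. The formulas result from moving a
  matrix to the right of \<open>y1\<close> and \<open>y3\<close> by the bracket relations.\<close>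

definition Ind :: "('v::cvec) action \<Rightarrow> mat3 \<Rightarrow> 'v \<times> 'v \<times> 'v \<times> 'v \<Rightarrow> 'v \<times> 'v \<times> 'v \<times> 'v" where
  "Ind Q = mkrep
     (\<lambda>(a, b, c, d). (Q h1 b + Q y2 c, - Q y2 d, Q h1 d - d, 0))
     (\<lambda>(a, b, c, d). (Q x2 a, Q x2 b + c, Q x2 c, Q x2 d))
     (\<lambda>(a, b, c, d). (Q x2 b + Q h1 c - Q h2 c, d - Q h1 d + Q h2 d, Q x2 d, 0))
     (\<lambda>(a, b, c, d). (0, a, 0, c))
     (\<lambda>(a, b, c, d). (Q y2 a, Q y2 b, Q y2 c + b, Q y2 d))
     (\<lambda>(a, b, c, d). (0, 0, a, - b))
     (\<lambda>(a, b, c, d). (Q h1 a, Q h1 b, Q h1 c - c, Q h1 d - d))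
     (\<lambda>(a, b, c, d). (Q h2 a, Q h2 b + b, Q h2 c - c, Q h2 d))"

lemma Ind_named [simp]:
  "Ind Q x1 (a, b, c, d) = (Q h1 b + Q y2 c, - Q y2 d, Q h1 d - d, 0)"
  "Ind Q x2 (a, b, c, d) = (Q x2 a, Q x2 b + c, Q x2 c, Q x2 d)"
  "Ind Q x3 (a, b, c, d) = (Q x2 b + Q h1 c - Q h2 c, d - Q h1 d + Q h2 d, Q x2 d, 0)"
  "Ind Q y1 (a, b, c, d) = (0, a, 0, c)"
  "Ind Q y2 (a, b, c, d) = (Q y2 a, Q y2 b, Q y2 c + b, Q y2 d)"
  "Ind Q y3 (a, b, c, d) = (0, 0, a, - b)"
  "Ind Q h1 (a, b, c, d) = (Q h1 a, Q h1 b, Q h1 c - c, Q h1 d - d)"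
  "Ind Q h2 (a, b, c, d) = (Q h2 a, Q h2 b + b, Q h2 c - c, Q h2 d)"
  by (simp_all add: Ind_def)

lemma rep_Ind:
  assumes Q: "rep gl2 Q" shows "rep sl12 (Ind Q)"
proof -
  note lQ = rep_lin[OF Q]
  note linQ = lin_add[OF lQ] lin_cs[OF lQ] lin_zero[OF lQ] lin_minus[OF lQ] lin_diff[OF lQ]
  note rels = gl2_rels[OF Q]
  have e: "Ind Q A v = ent A 1 2 *\<^sub>c Ind Q x1 v + ent A 2 3 *\<^sub>c Ind Q x2 v + ent A 1 3 *\<^sub>c Ind Q x3 v +
      ent A 2 1 *\<^sub>c Ind Q y1 v + ent A 3 2 *\<^sub>c Ind Q y2 v +
      ent A 3 1 *\<^sub>c Ind Q y3 v + ent A 1 1 *\<^sub>c Ind Q h1 v + (- ent A 3 3) *\<^sub>c Ind Q h2 v" for A v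
    unfolding Ind_def by (simp only: mkrep_def[of _ _ _ _ _ _ _ _ A] mkrep_named)
  note calc = e[of "sbracket _ _ _ _"] sbracket_nth cs_one cs_two linQ rels cs_Pair zero_prod_def algebra_simps
  show ?thesis
  proof (rule rep_sl12I)
    show "lin (Ind Q A)" for A
      unfolding Ind_def
      by (intro lin_mkrep linI)
        (auto simp: linQ cs_distribs cs_Pair zero_prod_def algebra_simps)
    show "Ind Q (A + B) v = Ind Q A v + Ind Q B v" for A B v
      unfolding Ind_def by (rule mkrep_add)
    show "Ind Q (cscale c A) v = c *\<^sub>c Ind Q A v" for c A v
      unfolding Ind_def by (rule mkrep_cscale)
    fix A B and v :: "'a \<times> 'a \<times> 'a \<times> 'a"
    obtain a b c d where v: "v = (a, b, c, d)" by (cases v) auto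
    show "Ind Q (sbracket 0 0 A B) v = Ind Q A (Ind Q B v) - Ind Q B (Ind Q A v)"
      if "A \<in> basis_part 0" "B \<in> basis_part 0"
      using that unfolding basis_part_def v
      by (simp, elim disjE; simp add: calc)
    show "Ind Q (sbracket 0 1 A B) v = Ind Q A (Ind Q B v) - Ind Q B (Ind Q A v)"
      if "A \<in> basis_part 0" "B \<in> basis_part 1"
      using that unfolding basis_part_def v
      by (simp, elim disjE; simp add: calc)
    show "Ind Q (sbracket 1 1 A B) v = Ind Q A (Ind Q B v) + Ind Q B (Ind Q A v)"
      if "A \<in> basis_part 1" "B \<in> basis_part 1"
      using that unfolding basis_part_def v
      by (simp, elim disjE; simp add: calc)
  qed
qed

text \<open>The relations that move \<open>y1\<close> and \<open>y3\<close> to the left. As rewrite rules they bring every product into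
  the normal form used in \<open>Ind\<close>.\<close>

lemma sl12_rels:
  assumes "rep sl12 R"
  shows "R h1 (R y1 v) = R y1 (R h1 v)"
    "R h1 (R y3 v) = R y3 (R h1 v) - R y3 v"
    "R h2 (R y1 v) = R y1 (R h2 v) + R y1 v"
    "R h2 (R y3 v) = R y3 (R h2 v) - R y3 v"
    "R x2 (R y1 v) = R y1 (R x2 v)"
    "R x2 (R y3 v) = R y3 (R x2 v) + R y1 v"
    "R y2 (R y1 v) = R y1 (R y2 v) + R y3 v"
    "R y2 (R y3 v) = R y3 (R y2 v)"
    "R x1 (R y1 v) = R h1 v - R y1 (R x1 v)"
    "R x1 (R y3 v) = R y2 v - R y3 (R x1 v)"
    "R x3 (R y1 v) = R x2 v - R y1 (R x3 v)"
    "R x3 (R y3 v) = R h1 v - R h2 v - R y3 (R x3 v)"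
    "R y3 (R y1 v) = - R y1 (R y3 v)"
    "R y1 (R y1 v) = 0"
    "R y3 (R y3 v) = 0"
proof -
  note b = rep_sbracket[OF assms] and z = rep_zero[OF assms, of h1]
  note s = sbracket_named cs_one rep_cscale[OF assms] rep_plus[OF assms] z
  show "R h1 (R y1 v) = R y1 (R h1 v)"
    using b[of 0 1 h1 y1 v] by (simp add: s algebra_simps)
  show "R h1 (R y3 v) = R y3 (R h1 v) - R y3 v"
    using b[of 0 1 h1 y3 v] by (simp add: s algebra_simps)
  show "R h2 (R y1 v) = R y1 (R h2 v) + R y1 v"
    using b[of 0 1 h2 y1 v] by (simp add: s algebra_simps)
  show "R h2 (R y3 v) = R y3 (R h2 v) - R y3 v"
    using b[of 0 1 h2 y3 v] by (simp add: s algebra_simps)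
  show "R x2 (R y1 v) = R y1 (R x2 v)"
    using b[of 0 1 x2 y1 v] by (simp add: s algebra_simps)
  show "R x2 (R y3 v) = R y3 (R x2 v) + R y1 v"
    using b[of 0 1 x2 y3 v] by (simp add: s algebra_simps)
  show "R y2 (R y1 v) = R y1 (R y2 v) + R y3 v"
    using b[of 0 1 y2 y1 v] by (simp add: s algebra_simps)
  show "R y2 (R y3 v) = R y3 (R y2 v)"
    using b[of 0 1 y2 y3 v] by (simp add: s algebra_simps)
  show "R x1 (R y1 v) = R h1 v - R y1 (R x1 v)"
    using b[of 1 1 x1 y1 v] by (simp add: s algebra_simps)
  show "R x1 (R y3 v) = R y2 v - R y3 (R x1 v)"
    using b[of 1 1 x1 y3 v] by (simp add: s algebra_simps)
  show "R x3 (R y1 v) = R x2 v - R y1 (R x3 v)"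
    using b[of 1 1 x3 y1 v] by (simp add: s algebra_simps)
  have hh: "R (h1 + cscale (- 1) h2) v = R h1 v - R h2 v"
    by (subst rep_plus[OF assms]) (simp_all add: sl12_closed(2) rep_cscale[OF assms] cs_one)
  show "R x3 (R y3 v) = R h1 v - R h2 v - R y3 (R x3 v)"
    using b[of 1 1 x3 y3 v] by (simp add: s hh algebra_simps)
  show "R y3 (R y1 v) = - R y1 (R y3 v)"
    using b[of 1 1 y3 y1 v] by (simp add: s algebra_simps eq_neg_iff_add_eq_0)
  show "R y1 (R y1 v) = 0"
    by (rule double_zero) (use b[of 1 1 y1 y1 v] in \<open>simp add: s\<close>)
  show "R y3 (R y3 v) = 0"
    by (rule double_zero) (use b[of 1 1 y3 y3 v] in \<open>simp add: s\<close>)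
qed

lemma sl12_rels_x:
  assumes "rep sl12 R"
  shows "R h1 (R x1 v) = R x1 (R h1 v)"
    "R h2 (R x1 v) = R x1 (R h2 v) - R x1 v"
    "R x2 (R x1 v) = R x1 (R x2 v) - R x3 v"
    "R y2 (R x1 v) = R x1 (R y2 v)"
    "R x3 (R y2 v) = R y2 (R x3 v) + R x1 v"
    "R x3 (R x1 v) = - R x1 (R x3 v)"
    "R x1 (R x1 v) = 0"
proof -
  note b = rep_sbracket[OF assms] and z = rep_zero[OF assms, of h1]
  note s = sbracket_named cs_one rep_cscale[OF assms] rep_plus[OF assms] z
  show "R h1 (R x1 v) = R x1 (R h1 v)"
    using b[of 0 1 h1 x1 v] by (simp add: s algebra_simps)
  show "R h2 (R x1 v) = R x1 (R h2 v) - R x1 v"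
    using b[of 0 1 h2 x1 v] by (simp add: s algebra_simps)
  show "R x2 (R x1 v) = R x1 (R x2 v) - R x3 v"
    using b[of 0 1 x2 x1 v] by (simp add: s algebra_simps)
  show "R y2 (R x1 v) = R x1 (R y2 v)"
    using b[of 0 1 y2 x1 v] by (simp add: s algebra_simps)
  show "R x3 (R y2 v) = R y2 (R x3 v) + R x1 v"
    using b[of 0 1 y2 x3 v] by (simp add: s algebra_simps)
  show "R x3 (R x1 v) = - R x1 (R x3 v)"
    using b[of 1 1 x3 x1 v] by (simp add: s algebra_simps eq_neg_iff_add_eq_0)
  show "R x1 (R x1 v) = 0"
    by (rule double_zero) (use b[of 1 1 x1 x1 v] in \<open>simp add: s\<close>)
qed

section \<open>The enveloping superalgebra and generalized Kac modules\<close>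

lemma poly_mapping_sum_singles:
  "(\<Sum>a\<in>keys p. single a (lookup p a)) = p"
proof (rule poly_mapping_eqI)
  fix k
  show "lookup (\<Sum>a\<in>keys p. single a (lookup p a)) k
    = lookup p k"
    by (simp add: lookup_sum lookup_single when_def in_keys_iff)
qed

lemma additive_eqI:
  fixes f g :: "('a \<Rightarrow>\<^sub>0 complex) \<Rightarrow> 'b::ab_group_add"
  assumes f: "\<And>p q. f (p + q) = f p + f q" and g: "\<And>p q. g (p + q) = g p + g q"
    and single: "\<And>a c. f (single a c) = g (single a c)"
  shows "f p = g p"
proof -
  have f0: "f 0 = 0" and g0: "g 0 = 0" using f[of 0 0] g[of 0 0] by simp_all
  have fs: "f (sum h T) = (\<Sum>a\<in>T. f (h a))" "g (sum h T) = (\<Sum>a\<in>T. g (h a))" if "finite T" for h and T :: "'a set"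
    using that by (induction T rule: finite_induct) (simp_all add: f g f0 g0)
  have p: "(\<Sum>a\<in>keys p. single a (lookup p a)) = p"
    by (rule poly_mapping_sum_singles)
  have "f (\<Sum>a\<in>keys p. single a (lookup p a)) =
      g (\<Sum>a\<in>keys p. single a (lookup p a))"
    by (simp only: fs[OF finite_keys] single)
  then show ?thesis by (simp only: p)
qed

lemma scal_central: "scal c * p = p * scal c"
  by (rule additive_eqI[where p = p and f = "\<lambda>p. scal c * p" and g = "\<lambda>p. p * scal c"])
    (simp_all add: distrib_left distrib_right scal_def mult_single mult.commute)

lemma scal_simps: "scal (a + b) = scal a + scal b" "scal (a * b) = scal a * scal b" "scal 1 = 1" "scal (- a) = - scal a"
  by (simp_all add: scal_def single_add mult_single single_uminus)

text \<open>A word of matrices acts by the composite operator; \<open>ev\<close> extends this linearly to the free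
  algebra.\<close>

definition wordact :: "(mat3 \<Rightarrow> 'v \<Rightarrow> 'v) \<Rightarrow> 'v::cvec \<Rightarrow> mat3 fword \<Rightarrow> 'v" where
  "wordact Q u w = foldr Q (letters w) u"

definition ev :: "(mat3 \<Rightarrow> 'v \<Rightarrow> 'v) \<Rightarrow> free_alg \<Rightarrow> 'v::cvec \<Rightarrow> 'v" where
  "ev Q p u = lext (wordact Q u) p"

lemma ev_add: "ev Q (p + q) u = ev Q p u + ev Q q u"
  unfolding ev_def by (rule lin_add[OF lin_lext])

lemma ev_diff: "ev Q (p - q) u = ev Q p u - ev Q q u"
  unfolding ev_def by (rule lin_diff[OF lin_lext])

lemma ev_single: "ev Q (single w c) u = c *\<^sub>c wordact Q u w"
  by (simp add: ev_def lext_single)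

lemma ev_gen: "ev Q (gen A) u = Q A u" and ev_scal: "ev Q (scal c) u = c *\<^sub>c u" and ev_one: "ev Q 1 u = u"
  by (simp_all add: gen_def scal_def ev_single wordact_def cs_one zero_fword_def flip: single_one)

lemma lin_wordact:
  assumes "\<And>A. lin (Q A)" shows "lin (\<lambda>u. wordact Q u w)"
proof -
  have "lin (\<lambda>u. foldr Q ws u)" for ws
    by (induction ws) (simp_all add: lin_def lin_add[OF assms] lin_cs[OF assms])
  then show ?thesis by (simp add: wordact_def)
qed

lemma lin_ev:
  assumes "\<And>A. lin (Q A)" shows "lin (ev Q p)"
proof (rule linI)
  note l = lin_wordact[of Q, OF assms]
  show "ev Q p (x + y) = ev Q p x + ev Q p y" for x y
    by (simp add: ev_def lext_def lin_add[OF l] cs_right_distrib sum.distrib)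
  show "ev Q p (c *\<^sub>c x) = c *\<^sub>c ev Q p x" for c x
    by (simp add: ev_def lext_def lin_cs[OF l] cvec.scale_sum_right mult.commute)
qed

lemma ev_mult:
  assumes "\<And>A. lin (Q A)" shows "ev Q (p * q) u = ev Q p (ev Q q u)"
proof -
  note l = lin_ev[of Q, OF assms]
  have "ev Q (single w c * q) u = ev Q (single w c) (ev Q q u)" for w c
  proof (rule additive_eqI[where p = q and f = "\<lambda>q. ev Q (single w c * q) u"
        and g = "\<lambda>q. ev Q (single w c) (ev Q q u)"])
    fix a d
    have "wordact Q u (w + a) = wordact Q (wordact Q u a) w"
      by (simp add: wordact_def plus_fword_def)
    then show "ev Q (single w c * single a d) u =
        ev Q (single w c) (ev Q (single a d) u)"
      by (simp add: mult_single ev_single lin_cs[OF lin_wordact[of Q, OF assms]])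
  qed (simp_all add: distrib_left ev_add lin_add[OF l])
  then show ?thesis
    by (intro additive_eqI[where p = p and f = "\<lambda>p. ev Q (p * q) u" and g = "\<lambda>p. ev Q p (ev Q q u)"])
      (simp_all add: distrib_right ev_add)
qed

abbreviation Fset :: "free_alg set" where "Fset \<equiv> carrier free_sl12"

lemma Fset_def: "Fset = {p. \<forall>w\<in>keys p. set (letters w) \<subseteq> sl12}"
  by (simp add: free_sl12_def)

lemma free_simps [simp]:
  "monoid.mult free_sl12 = (*)" "one free_sl12 = 1" "zero free_sl12 = 0" "add free_sl12 = (+)"
  by (simp_all add: free_sl12_def ring_of_type_algebra_def)

lemma Fset_closed [simp]:
  "0 \<in> Fset" "1 \<in> Fset" "scal c \<in> Fset" "A \<in> sl12 \<Longrightarrow> gen A \<in> Fset"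
  "p \<in> Fset \<Longrightarrow> - p \<in> Fset"
proof -
  show "1 \<in> Fset" "scal c \<in> Fset" "A \<in> sl12 \<Longrightarrow> gen A \<in> Fset"
    by (auto simp: Fset_def scal_def gen_def zero_fword_def split: if_splits)
qed (auto simp: Fset_def in_keys_iff)

lemma Fset_add [simp]: "p \<in> Fset \<Longrightarrow> q \<in> Fset \<Longrightarrow> p + q \<in> Fset"
  using Poly_Mapping.keys_add[of p q] by (auto simp: Fset_def)

lemma Fset_diff [simp]: "p \<in> Fset \<Longrightarrow> q \<in> Fset \<Longrightarrow> p - q \<in> Fset"
  using Fset_add[of p "- q"] by simp

lemma Fset_mult [simp]: "p \<in> Fset \<Longrightarrow> q \<in> Fset \<Longrightarrow> p * q \<in> Fset"
  using keys_mult[of p q] by (fastforce simp: Fset_def plus_fword_def)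

lemma Fset_power [simp]: "p \<in> Fset \<Longrightarrow> p ^ n \<in> Fset"
  by (induction n) simp_all

lemma Fset_induct:
  assumes "p \<in> Fset" and "P 0"
    and "\<And>w c q. set (letters w) \<subseteq> sl12 \<Longrightarrow> q \<in> Fset \<Longrightarrow> P q \<Longrightarrow> P (single w c + q)"
  shows "P p"
proof -
  have "P (\<Sum>a\<in>T. single a (lookup p a)) \<and>
      (\<Sum>a\<in>T. single a (lookup p a)) \<in> Fset"
    if "finite T" "T \<subseteq> keys p" for T
    using that
  proof (induction T rule: finite_induct)
    case (insert a T)
    then have a: "set (letters a) \<subseteq> sl12" using assms(1) by (auto simp: Fset_def)
    then have "single a (lookup p a) \<in> Fset" by (auto simp: Fset_def split: if_splits)
    then show ?case using insert a assms(3) by simp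
  qed (simp add: assms(2))
  from this[OF finite_keys order_refl] show ?thesis
    by (simp only: poly_mapping_sum_singles)
qed

lemma ring_free: "ring free_sl12"
proof (rule ringI)
  show "abelian_group free_sl12"
  proof (rule abelian_groupI)
    show "\<exists>y\<in>Fset. y \<oplus>\<^bsub>free_sl12\<^esub> x = \<zero>\<^bsub>free_sl12\<^esub>" if "x \<in> Fset" for x
      by (rule bexI[of _ "- x"]) (simp_all add: that)
  qed (simp_all add: add_ac)
  show "monoid free_sl12"
    by (rule monoidI) (simp_all add: mult.assoc)
qed (simp_all add: distrib_left distrib_right)

lemma minus_free: "p \<in> Fset \<Longrightarrow> q \<in> Fset \<Longrightarrow> p \<ominus>\<^bsub>free_sl12\<^esub> q = p - q"
proof -
  interpret ring free_sl12 by (rule ring_free)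
  assume "p \<in> Fset" "q \<in> Fset"
  then have "\<ominus>\<^bsub>free_sl12\<^esub> q = - q" by (intro minus_equality) simp_all
  then show ?thesis by (simp add: a_minus_def)
qed

lemma U_relations_subset: "U_relations \<subseteq> Fset"
proof -
  have s: "sbracket p q A B \<in> sl12" if "p \<in> {0,1}" "q \<in> {0,1}" "A \<in> sl12_part p" "B \<in> sl12_part q" for p q A B
    using sbracket_part[OF that] by (rule subsetD[OF part_subset])
  have m: "A \<in> sl12_part p \<Longrightarrow> A \<in> sl12" for A p by (rule subsetD[OF part_subset])
  show ?thesis
    unfolding U_relations_def
    by (intro Un_least subsetI; elim CollectE exE conjE; hypsubst)
      (simp_all add: sl12_closed s m)
qed

lemma ideal_U: "ideal U_ideal free_sl12"
  unfolding U_ideal_def by (rule ring.genideal_ideal[OF ring_free U_relations_subset])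

lemma U_relations_in: "U_relations \<subseteq> U_ideal"
  unfolding U_ideal_def by (rule ring.genideal_self[OF ring_free U_relations_subset])

lemma ring_U: "ring U"
  unfolding U_def by (rule ideal.quotient_is_ring[OF ideal_U])

text \<open>The class of an element of the free algebra in \<^const>\<open>U\<close>. All calculations in \<^const>\<open>U\<close> and in
  the Kac module are done with representatives in the free algebra, which is a ring type.\<close>

definition proj :: "free_alg \<Rightarrow> free_alg set" where "proj p = U_ideal +>\<^bsub>free_sl12\<^esub> p"

lemma proj_hom: "proj \<in> ring_hom free_sl12 U"
  unfolding U_def proj_def by (rule ideal.rcos_ring_hom[OF ideal_U])

lemma carrier_U: "carrier U = proj ` Fset"
  by (auto simp: U_def FactRing_def A_RCOSETS_def' proj_def)

lemma proj_simps:
  assumes "p \<in> Fset" "q \<in> Fset"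
  shows "proj p \<in> carrier U" "proj (p + q) = proj p \<oplus>\<^bsub>U\<^esub> proj q" "proj (p * q) = proj p \<otimes>\<^bsub>U\<^esub> proj q"
  using ring_hom_closed[OF proj_hom assms(1)] ring_hom_add[OF proj_hom assms] ring_hom_mult[OF proj_hom assms]
  by simp_all

lemma proj_closed [simp]: "p \<in> Fset \<Longrightarrow> proj p \<in> carrier U"
  by (rule proj_simps(1))

lemma proj_eq_iff: "p \<in> Fset \<Longrightarrow> q \<in> Fset \<Longrightarrow> proj p = proj q \<longleftrightarrow> p - q \<in> U_ideal"
  using ring.quotient_eq_iff_same_a_r_cos[OF ring_free ideal_U, of p q] by (simp add: minus_free proj_def)

lemma proj_zero: "proj 0 = \<zero>\<^bsub>U\<^esub>"
proof -
  interpret ring U by (rule ring_U)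
  have c: "proj 0 \<in> carrier U" using proj_simps(1)[of 0 0] by simp
  have e: "proj 0 \<oplus>\<^bsub>U\<^esub> proj 0 = proj 0" using proj_simps(2)[of 0 0, symmetric] by simp
  show ?thesis by (rule add.l_cancel_one[OF c c, THEN iffD1, OF e])
qed

lemma proj_diff: "p \<in> Fset \<Longrightarrow> q \<in> Fset \<Longrightarrow> proj (p - q) = proj p \<ominus>\<^bsub>U\<^esub> proj q"
proof -
  interpret ring U by (rule ring_U)
  assume pq: "p \<in> Fset" "q \<in> Fset"
  have "proj (p - q) \<oplus>\<^bsub>U\<^esub> proj q = proj p"
    using proj_simps(2)[of "p - q" q] pq by simp
  then have "proj p \<ominus>\<^bsub>U\<^esub> proj q = (proj (p - q) \<oplus>\<^bsub>U\<^esub> proj q) \<ominus>\<^bsub>U\<^esub> proj q" by simp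
  also have "\<dots> = proj (p - q)"
    using pq proj_simps(1)[of p p] proj_simps(1)[of q q] proj_simps(1)[of "p - q" q]
    by (simp add: a_minus_def a_assoc r_neg)
  finally show ?thesis by simp
qed

lemma proj_power: "p \<in> Fset \<Longrightarrow> proj (p ^ n) = proj p [^]\<^bsub>U\<^esub> n"
proof (induction n)
  case 0
  then show ?case using ring_hom_one[OF proj_hom] by simp
next
  case (Suc n)
  interpret ring U by (rule ring_U)
  show ?case using Suc proj_simps(3)[of "p ^ n" p] by (simp add: power_commutes)
qed

lemma left_ideal_gen:
  assumes "ring R" "G \<subseteq> carrier R"
  shows "left_ideal (left_ideal_gen R G) R" and "G \<subseteq> left_ideal_gen R G"
    and "left_ideal I R \<Longrightarrow> G \<subseteq> I \<Longrightarrow> left_ideal_gen R G \<subseteq> I"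
proof -
  interpret ring R by fact
  have top: "left_ideal (carrier R) R"
    unfolding left_ideal_def additive_subgroup_def using add.subgroup_self by auto
  let ?C = "{I. left_ideal I R \<and> G \<subseteq> I}"
  have "subgroup (\<Inter>?C) (add_monoid R)"
    by (rule add.subgroups_Inter) (use top assms(2) in \<open>auto simp: left_ideal_def additive_subgroup_def\<close>)
  then show "left_ideal (left_ideal_gen R G) R"
    by (auto simp: left_ideal_def left_ideal_gen_def additive_subgroup_def)
  show "G \<subseteq> left_ideal_gen R G" by (auto simp: left_ideal_gen_def)
  show "left_ideal I R \<Longrightarrow> G \<subseteq> I \<Longrightarrow> left_ideal_gen R G \<subseteq> I" by (auto simp: left_ideal_gen_def)
qed

text \<open>Representatives of the generators of \<^const>\<open>kac_ideal\<close>.\<close>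

definition kac_gens :: "borel \<Rightarrow> weight \<Rightarrow> free_alg set" where
  "kac_gens b l = gen ` nplus b \<union> {gen (cartan s t) - scal (weight_eval l s t) | s t. True} \<union>
     {gen y2 ^ (nat \<lfloor>Re (snd l)\<rfloor> + 1)}"

lemma mspan_subset: "G \<subseteq> sl12 \<Longrightarrow> mspan G \<subseteq> sl12"
proof
  fix A assume "A \<in> mspan G" "G \<subseteq> sl12"
  from this(1) show "A \<in> sl12"
    by (rule mspan_induct) (use \<open>G \<subseteq> sl12\<close> in \<open>auto simp: sl12_closed sl12_iff[of 0]\<close>)
qed

lemma nplus_subset: "nplus b \<subseteq> sl12"
  by (cases b) (simp_all add: mspan_subset)

lemma cartan_sl12 [simp]: "cartan s t \<in> sl12"
  by (rule gl2_subset) simp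

lemma kac_gens_subset: "kac_gens b l \<subseteq> Fset"
  using nplus_subset[of b] by (auto simp: kac_gens_def)

lemma kac_ideal_eq: "kac_ideal b l = left_ideal_gen U (proj ` kac_gens b l)"
proof -
  have g: "U_gen A = proj (gen A)" and sc: "U_scal c = proj (scal c)" for A c
    by (simp_all add: U_gen_def U_scal_def proj_def)
  have 1: "U_gen ` nplus b = proj ` gen ` nplus b"
    by (simp add: image_image g)
  have d: "U_gen (cartan s t) \<ominus>\<^bsub>U\<^esub> U_scal c = proj (gen (cartan s t) - scal c)" for s t c
    by (simp add: g sc proj_diff)
  have 2: "{U_gen (cartan s t) \<ominus>\<^bsub>U\<^esub> U_scal (weight_eval l s t) | s t. True} =
      proj ` {gen (cartan s t) - scal (weight_eval l s t) | s t. True}"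
    unfolding d by (auto simp: image_iff)
  have 3: "U_gen y2 [^]\<^bsub>U\<^esub> (k::nat) = proj (gen y2 ^ k)" for k
    by (simp only: g proj_power[of "gen y2" k, OF Fset_closed(4)[OF named_in_sl12(5)]])
  show ?thesis
    unfolding kac_ideal_def kac_gens_def image_Un 1 2 3 by simp
qed

lemma a_inv_free: "p \<in> Fset \<Longrightarrow> \<ominus>\<^bsub>free_sl12\<^esub> p = - p"
  using minus_free[of 0 p] ring.ring_simprules(3,8,15)[OF ring_free] 
  by (simp add: a_minus_def abelian_monoid.l_zero[OF abelian_group.axioms(1)[OF ring.is_abelian_group[OF ring_free]]]
      abelian_group.a_inv_closed[OF ring.is_abelian_group[OF ring_free]])

lemma a_inv_U: "p \<in> Fset \<Longrightarrow> \<ominus>\<^bsub>U\<^esub> proj p = proj (- p)"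
proof -
  interpret ring U by (rule ring_U)
  assume p: "p \<in> Fset"
  show ?thesis
    by (rule minus_equality)
      (use p proj_simps(2)[of "- p" p] in \<open>simp_all add: proj_zero\<close>)
qed

lemma left_ideal_proj:
  assumes W: "W \<subseteq> Fset" "0 \<in> W" "\<And>p q. p \<in> W \<Longrightarrow> q \<in> W \<Longrightarrow> p + q \<in> W" "\<And>p. p \<in> W \<Longrightarrow> - p \<in> W"
    "\<And>r p. r \<in> Fset \<Longrightarrow> p \<in> W \<Longrightarrow> r * p \<in> W"
  shows "left_ideal (proj ` W) U"
proof -
  interpret ring U by (rule ring_U)
  have W': "p \<in> Fset" if "p \<in> W" for p using W(1) that by (rule subsetD)
  have "subgroup (proj ` W) (add_monoid U)"
  proof (rule add.subgroupI)
    show "proj ` W \<subseteq> carrier U" using W' by auto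
    show "proj ` W \<noteq> {}" using W(2) by auto
    show "\<ominus>\<^bsub>U\<^esub> a \<in> proj ` W" if "a \<in> proj ` W" for a
      using that W' W(4) by (auto simp: a_inv_U)
    show "a \<oplus>\<^bsub>U\<^esub> c \<in> proj ` W" if "a \<in> proj ` W" "c \<in> proj ` W" for a c
      using that W' W(3) by (auto simp: proj_simps(2) [symmetric])
  qed
  moreover have "r \<otimes>\<^bsub>U\<^esub> a \<in> proj ` W" if "r \<in> carrier U" "a \<in> proj ` W" for r a
    using that W' W(5) by (auto simp: carrier_U proj_simps(3) [symmetric])
  ultimately show ?thesis by (simp add: left_ideal_def additive_subgroup_def)
qed

text \<open>The elements of the free algebra that act by zero on a representation form an ideal, and it
  contains the defining relations of \<^const>\<open>U\<close>.\<close>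

lemma ev_U_ideal:
  assumes Q: "rep sl12 Q" and p: "p \<in> U_ideal"
  shows "ev Q p u = 0"
proof -
  interpret ring free_sl12 by (rule ring_free)
  note lQ = rep_lin[OF Q]
  define N where "N = {p \<in> Fset. \<forall>u. ev Q p u = 0}"
  have ev0: "ev Q 0 u = 0" for u using ev_diff[of Q 0 0 u] by simp
  have evz: "ev Q q 0 = 0" for q by (rule lin_zero[OF lin_ev[of Q, OF lQ]])
  have evm: "ev Q (- q) u = - ev Q q u" for q u using ev_diff[of Q 0 q u] by (simp add: ev0)
  have "subgroup N (add_monoid free_sl12)"
  proof (rule add.subgroupI)
    show "N \<noteq> {}" using ev0 by (auto simp: N_def intro!: exI[of _ 0])
  qed (auto simp: N_def a_inv_free evm ev_add)
  then have "ideal N free_sl12"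
    by (intro idealI ring_free) (auto simp: N_def ev_mult[of Q, OF lQ] evz)
  moreover have "U_relations \<subseteq> N"
  proof
    fix r assume r: "r \<in> U_relations"
    then have "r \<in> Fset" using U_relations_subset by (rule subsetD[rotated])
    moreover have "ev Q r u = 0" for u
      using r unfolding U_relations_def
    proof (elim UnE CollectE exE conjE)
      fix A B assume "r = gen (A + B) - gen A - gen B" "A \<in> sl12" "B \<in> sl12"
      then show ?thesis by (simp add: ev_diff ev_gen rep_plus[OF Q])
    next
      fix c A assume "r = gen (cscale c A) - scal c * gen A" "A \<in> sl12"
      then show ?thesis by (simp add: ev_diff ev_mult[of Q, OF lQ] ev_gen ev_scal rep_cscale[OF Q])
    next
      fix p q A B assume pq: "r = gen A * gen B - scal ((- 1) ^ (p * q)) * gen B * gen A - gen (sbracket p q A B)"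
        "p \<in> {0::nat, 1}" "q \<in> {0::nat, 1}" "A \<in> sl12_part p" "B \<in> sl12_part q"
      have "Q (sbracket p q A B) u = Q A (Q B u) - ((- 1) ^ (p * q)) *\<^sub>c Q B (Q A u)"
        by (rule rep_sbracket[OF Q pq(2,3)]) (use pq(4,5) subsetD[OF part_subset] in auto)
      then show ?thesis
        unfolding pq(1) by (simp add: ev_diff ev_mult[of Q, OF lQ] ev_gen ev_scal)
    qed
    ultimately show "r \<in> N" by (simp add: N_def)
  qed
  ultimately have "U_ideal \<subseteq> N" unfolding U_ideal_def by (rule genideal_minimal)
  then show ?thesis using p by (auto simp: N_def)
qed

text \<open>The relations satisfied by the generator of the generalized Kac module.\<close>

definition kac_hwv :: "borel \<Rightarrow> weight \<Rightarrow> ('v::cvec) action \<Rightarrow> 'v \<Rightarrow> bool" where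
  "kac_hwv b l R v \<longleftrightarrow> (\<forall>A\<in>nplus b. R A v = 0) \<and> (\<forall>a c. R (cartan a c) v = weight_eval l a c *\<^sub>c v) \<and>
     ypow R v (nat \<lfloor>Re (snd l)\<rfloor> + 1) = 0"

text \<open>The kernel of the map from the free algebra onto the Kac module that sends 1 to its generator.\<close>

definition kac_rel :: "borel \<Rightarrow> weight \<Rightarrow> free_alg set" where
  "kac_rel b l = {p \<in> Fset. proj p \<in> kac_ideal b l}"

lemma proj_kac_gens: "proj ` kac_gens b l \<subseteq> carrier U"
  unfolding carrier_U by (rule image_mono[OF kac_gens_subset])

lemma left_ideal_kac: "left_ideal (kac_ideal b l) U"
  unfolding kac_ideal_eq by (rule left_ideal_gen(1)[OF ring_U proj_kac_gens])

lemma kac_rel_subset: "kac_rel b l \<subseteq> Fset" by (auto simp: kac_rel_def)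

lemma U_ideal_subset: "U_ideal \<subseteq> Fset"
  by (rule additive_subgroup.a_subset[OF ideal.axioms(1)[OF ideal_U]])

lemma kac_rel_closed:
  shows "p \<in> kac_rel b l \<Longrightarrow> q \<in> kac_rel b l \<Longrightarrow> p + q \<in> kac_rel b l"
    and "r \<in> Fset \<Longrightarrow> p \<in> kac_rel b l \<Longrightarrow> r * p \<in> kac_rel b l"
    and "p \<in> U_ideal \<Longrightarrow> p \<in> kac_rel b l"
    and "p \<in> kac_gens b l \<Longrightarrow> p \<in> kac_rel b l"
proof -
  have asub: "additive_subgroup (kac_ideal b l) U" and
    lm: "\<And>r a. r \<in> carrier U \<Longrightarrow> a \<in> kac_ideal b l \<Longrightarrow> r \<otimes>\<^bsub>U\<^esub> a \<in> kac_ideal b l"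
    using left_ideal_kac by (simp_all add: left_ideal_def)
  show "p \<in> kac_rel b l \<Longrightarrow> q \<in> kac_rel b l \<Longrightarrow> p + q \<in> kac_rel b l"
    by (simp add: kac_rel_def proj_simps additive_subgroup.a_closed[OF asub])
  show "r \<in> Fset \<Longrightarrow> p \<in> kac_rel b l \<Longrightarrow> r * p \<in> kac_rel b l"
    by (simp add: kac_rel_def proj_simps(3) lm proj_simps(1)[of r r])
  show "p \<in> U_ideal \<Longrightarrow> p \<in> kac_rel b l"
  proof -
    assume p: "p \<in> U_ideal"
    then have pF: "p \<in> Fset" by (rule subsetD[OF U_ideal_subset])
    then have "proj p = \<zero>\<^bsub>U\<^esub>"
      using proj_eq_iff[of p 0] p by (simp add: proj_zero)
    then show ?thesis using pF additive_subgroup.zero_closed[OF asub] by (simp add: kac_rel_def)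
  qed
  show "p \<in> kac_gens b l \<Longrightarrow> p \<in> kac_rel b l"
    using subsetD[OF left_ideal_gen(2)[OF ring_U proj_kac_gens] imageI, of p b l] subsetD[OF kac_gens_subset, of p b l]
    by (simp add: kac_rel_def kac_ideal_eq)
qed

lemma ev_gen_power: "ev Q (gen A ^ n) u = (Q A ^^ n) u" if "\<And>A. lin (Q A)"
  by (induction n) (simp_all add: ev_one ev_mult[of Q, OF that] ev_gen)

text \<open>The elements that annihilate a vector form a left ideal. If the vector satisfies the relations of
  the generator, this left ideal contains \<^const>\<open>kac_ideal\<close>; this is the universal property.\<close>

lemma ev_kac_rel:
  assumes Q: "rep sl12 Q" and w: "kac_hwv b l Q w" and p: "p \<in> kac_rel b l"
  shows "ev Q p w = 0"
proof -
  note lQ = rep_lin[OF Q]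
  define W where "W = {p \<in> Fset. ev Q p w = 0}"
  have ev0: "ev Q 0 u = 0" for u using ev_diff[of Q 0 0 u] by simp
  have evz: "ev Q q 0 = 0" for q by (rule lin_zero[OF lin_ev[of Q, OF lQ]])
  have evm: "ev Q (- q) u = - ev Q q u" for q u using ev_diff[of Q 0 q u] by (simp add: ev0)
  have "left_ideal (proj ` W) U"
    by (rule left_ideal_proj) (auto simp: W_def ev0 ev_add evm ev_mult[of Q, OF lQ] evz)
  moreover have "kac_gens b l \<subseteq> W"
  proof
    fix r assume r: "r \<in> kac_gens b l"
    then have "r \<in> Fset" by (rule subsetD[OF kac_gens_subset])
    moreover have "ev Q r w = 0"
      using r unfolding kac_gens_def
    proof (elim UnE imageE CollectE exE conjE singletonE)
      show "r = gen A \<Longrightarrow> A \<in> nplus b \<Longrightarrow> ?thesis" for A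
        using w by (simp add: kac_hwv_def ev_gen)
      show "r = gen (cartan s t) - scal (weight_eval l s t) \<Longrightarrow> ?thesis" for s t
        using w by (simp add: kac_hwv_def ev_diff ev_gen ev_scal)
      show "r = gen y2 ^ (nat \<lfloor>Re (snd l)\<rfloor> + 1) \<Longrightarrow> ?thesis"
        using w by (simp only: kac_hwv_def ev_gen_power[of Q, OF lQ])
    qed
    ultimately show "r \<in> W" by (simp add: W_def)
  qed
  ultimately have "kac_ideal b l \<subseteq> proj ` W"
    unfolding kac_ideal_eq by (intro left_ideal_gen(3)[OF ring_U proj_kac_gens] image_mono)
  then obtain q where q: "q \<in> Fset" "ev Q q w = 0" "proj p = proj q" and pF: "p \<in> Fset"
    using p by (auto simp: kac_rel_def W_def)
  then have "ev Q (p - q) w = 0"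
    using proj_eq_iff[of p q] by (intro ev_U_ideal[OF Q]) simp
  then show ?thesis using q(2) by (simp add: ev_diff)
qed

text \<open>The class of an element of the free algebra in the Kac module, as a coset of a left ideal of cosets.\<close>

definition kac_class :: "borel \<Rightarrow> weight \<Rightarrow> free_alg \<Rightarrow> free_alg set set" where
  "kac_class b l p = kac_ideal b l +>\<^bsub>U\<^esub> proj p"

lemma abelian_subgroup_kac: "abelian_subgroup (kac_ideal b l) U"
  using left_ideal_kac[of b l] ring.is_abelian_group[OF ring_U]
  by (intro abelian_subgroupI3) (simp_all add: left_ideal_def)

lemma kac_class_eq_iff:
  assumes "p \<in> Fset" "q \<in> Fset"
  shows "kac_class b l p = kac_class b l q \<longleftrightarrow> p - q \<in> kac_rel b l"
proof -
  interpret abelian_subgroup "kac_ideal b l" U by (rule abelian_subgroup_kac)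
  have c: "proj p \<in> carrier U" "proj q \<in> carrier U" using assms by (simp_all add: proj_simps(1)[of _ 0])
  have "kac_class b l p = kac_class b l q \<longleftrightarrow> proj p \<in> kac_class b l q"
    unfolding kac_class_def using a_rcos_self[OF c(1)] a_repr_independence'[OF _ c(2), of "proj p"] by auto
  also have "\<dots> \<longleftrightarrow> proj p \<ominus>\<^bsub>U\<^esub> proj q \<in> kac_ideal b l"
    unfolding kac_class_def by (rule a_rcos_module_minus[OF ring_U c(2,1)])
  also have "\<dots> \<longleftrightarrow> p - q \<in> kac_rel b l"
    using assms by (simp add: kac_rel_def proj_diff)
  finally show ?thesis .
qed

text \<open>The union over representatives in the definition of the action is a union of equal cosets.\<close>

lemma kac_class_mult:
  assumes "r \<in> Fset" "p \<in> Fset"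
  shows "(\<Union>u\<in>kac_class b l p. kac_ideal b l +>\<^bsub>U\<^esub> (proj r \<otimes>\<^bsub>U\<^esub> u)) = kac_class b l (r * p)"
proof -
  interpret abelian_subgroup "kac_ideal b l" U by (rule abelian_subgroup_kac)
  have c: "proj p \<in> carrier U" using assms by (simp add: proj_simps(1)[of _ 0])
  have self: "proj p \<in> kac_class b l p" unfolding kac_class_def by (rule a_rcos_self[OF c])
  have "kac_ideal b l +>\<^bsub>U\<^esub> (proj r \<otimes>\<^bsub>U\<^esub> u) = kac_class b l (r * p)" if u: "u \<in> kac_class b l p" for u
  proof -
    have "u \<in> carrier U" using u a_elemrcos_carrier[OF c] by (simp add: kac_class_def)
    then obtain q where q: "q \<in> Fset" "u = proj q" by (auto simp: carrier_U)
    have "kac_class b l p = kac_class b l q"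
      using a_repr_independence'[OF u[unfolded kac_class_def] c] q by (simp add: kac_class_def)
    then have "p - q \<in> kac_rel b l" using assms q by (simp add: kac_class_eq_iff)
    then have "r * (p - q) \<in> kac_rel b l" using assms(1) by (simp add: kac_rel_closed)
    then have "kac_class b l (r * p) = kac_class b l (r * q)"
      using assms q kac_class_eq_iff[of "r * p" "r * q"] by (simp add: right_diff_distrib)
    then show ?thesis using assms q by (simp add: kac_class_def proj_simps(3))
  qed
  then show ?thesis using self by auto
qed

lemma kac_module_simps:
  shows "carrier (kac_module b l) = kac_class b l ` Fset"
    and "zero (kac_module b l) = kac_class b l 0"
    and "p \<in> Fset \<Longrightarrow> q \<in> Fset \<Longrightarrow> kac_class b l p \<oplus>\<^bsub>kac_module b l\<^esub> kac_class b l q = kac_class b l (p + q)"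
    and "p \<in> Fset \<Longrightarrow> c \<odot>\<^bsub>kac_module b l\<^esub> kac_class b l p = kac_class b l (scal c * p)"
    and "p \<in> Fset \<Longrightarrow> A \<in> sl12 \<Longrightarrow> act (kac_module b l) A (kac_class b l p) = kac_class b l (gen A * p)"
proof -
  interpret abelian_subgroup "kac_ideal b l" U by (rule abelian_subgroup_kac)
  have g: "U_gen A = proj (gen A)" and sc: "U_scal c = proj (scal c)" for A c
    by (simp_all add: U_gen_def U_scal_def proj_def)
  show "carrier (kac_module b l) = kac_class b l ` Fset"
    by (auto simp: kac_module_def Let_def A_RCOSETS_def' carrier_U kac_class_def)
  show "zero (kac_module b l) = kac_class b l 0"
    using a_coset_add_zero[OF a_subset] by (simp add: kac_module_def Let_def kac_class_def proj_zero)
  show "p \<in> Fset \<Longrightarrow> q \<in> Fset \<Longrightarrow> kac_class b l p \<oplus>\<^bsub>kac_module b l\<^esub> kac_class b l q = kac_class b l (p + q)"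
    using a_rcos_sum[of "proj p" "proj q"] by (simp add: kac_module_def Let_def kac_class_def proj_simps)
  show "p \<in> Fset \<Longrightarrow> c \<odot>\<^bsub>kac_module b l\<^esub> kac_class b l p = kac_class b l (scal c * p)"
    by (simp add: kac_module_def Let_def sc kac_class_mult)
  show "p \<in> Fset \<Longrightarrow> A \<in> sl12 \<Longrightarrow> act (kac_module b l) A (kac_class b l p) = kac_class b l (gen A * p)"
    by (simp add: kac_module_def Let_def g kac_class_mult)
qed

lemma kac_class_cong: "p \<in> Fset \<Longrightarrow> q \<in> Fset \<Longrightarrow> p - q \<in> U_ideal \<Longrightarrow> kac_class b l p = kac_class b l q"
  by (simp add: kac_class_eq_iff kac_rel_closed)

lemma U_relations_mult: "r \<in> U_relations \<Longrightarrow> p \<in> Fset \<Longrightarrow> r * p \<in> U_ideal"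
  using ideal.I_r_closed[OF ideal_U subsetD[OF U_relations_in], of r p] by simp

lemma abelian_group_kac: "abelian_group (kac_module b l)"
proof (rule abelian_groupI)
  let ?K = "kac_module b l"
  note ks = kac_module_simps
  show "\<exists>y\<in>carrier ?K. y \<oplus>\<^bsub>?K\<^esub> x = \<zero>\<^bsub>?K\<^esub>" if x: "x \<in> carrier ?K" for x
  proof -
    obtain p where p: "p \<in> Fset" "x = kac_class b l p" using x by (auto simp: ks)
    show ?thesis
      by (rule bexI[of _ "kac_class b l (- p)"]) (simp_all add: p ks)
  qed
qed (auto simp: kac_module_simps add_ac)

lemma kac_minus:
  assumes "p \<in> Fset" "q \<in> Fset"
  shows "kac_class b l p \<ominus>\<^bsub>kac_module b l\<^esub> kac_class b l q = kac_class b l (p - q)"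
proof -
  interpret abelian_group "kac_module b l" by (rule abelian_group_kac)
  have "\<ominus>\<^bsub>kac_module b l\<^esub> kac_class b l q = kac_class b l (- q)"
    by (rule minus_equality) (use assms in \<open>simp_all add: kac_module_simps\<close>)
  then show ?thesis using assms by (simp add: a_minus_def kac_module_simps)
qed

lemma lie_module_kac: "lie_module sl12 (kac_module b l)"
  unfolding lie_module_def
proof (intro conjI ballI allI)
  let ?K = "kac_module b l"
  note ks = kac_module_simps
  show "Module.module complex_ring ?K"
  proof (rule Module.moduleI)
    show "cring complex_ring" by (rule cring_from_type_algebra)
    show "abelian_group ?K" by (rule abelian_group_kac)
  qed (auto simp: ks scal_simps distrib_left distrib_right mult.assoc)
  fix A v assume A: "A \<in> sl12" and v: "v \<in> carrier ?K"
  obtain p where p: "p \<in> Fset" "v = kac_class b l p" using v by (auto simp: ks)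
  show "act ?K A v \<in> carrier ?K" using A p by (simp add: ks)
  show "act ?K A (v \<oplus>\<^bsub>?K\<^esub> w) = act ?K A v \<oplus>\<^bsub>?K\<^esub> act ?K A w" if "w \<in> carrier ?K" for w
    using that A p by (auto simp: ks distrib_left)
  show "act ?K A (c \<odot>\<^bsub>?K\<^esub> v) = c \<odot>\<^bsub>?K\<^esub> act ?K A v" for c
  proof -
    have "gen A * (scal c * p) = scal c * (gen A * p)"
      using scal_central[of c "gen A"] by (simp add: mult.assoc [symmetric])
    then show ?thesis using A p by (simp add: ks)
  qed
  show "act ?K (cscale c A) v = c \<odot>\<^bsub>?K\<^esub> act ?K A v" for c
  proof -
    have "(gen (cscale c A) - scal c * gen A) * p \<in> U_ideal"
      by (rule U_relations_mult) (use A p in \<open>auto simp: U_relations_def\<close>)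
    then have "kac_class b l (gen (cscale c A) * p) = kac_class b l (scal c * (gen A * p))"
      using A p by (intro kac_class_cong) (simp_all add: sl12_closed left_diff_distrib mult.assoc)
    then show ?thesis using A p by (simp add: ks sl12_closed)
  qed
  show "act ?K (A + B) v = act ?K A v \<oplus>\<^bsub>?K\<^esub> act ?K B v" if B: "B \<in> sl12" for B
  proof -
    have "(gen (A + B) - gen A - gen B) * p \<in> U_ideal"
      by (rule U_relations_mult) (use A B p in \<open>auto simp: U_relations_def\<close>)
    then have "kac_class b l (gen (A + B) * p) = kac_class b l (gen A * p + gen B * p)"
      using A B p by (intro kac_class_cong) (simp_all add: sl12_closed left_diff_distrib distrib_right diff_diff_add)
    then show ?thesis using A B p by (simp add: ks sl12_closed)
  qed
next
  let ?K = "kac_module b l"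
  note ks = kac_module_simps
  fix p q A B v
  assume pq: "p \<in> {0::nat, 1}" "q \<in> {0::nat, 1}" and A: "A \<in> sl12 \<inter> sl12_part p" and B: "B \<in> sl12 \<inter> sl12_part q"
    and v: "v \<in> carrier ?K"
  obtain r where r: "r \<in> Fset" "v = kac_class b l r" using v by (auto simp: ks)
  have AB: "A \<in> sl12" "B \<in> sl12" "sbracket p q A B \<in> sl12"
    using A B subalg_sbracket[OF subalg_sl12 pq A B] by auto
  let ?s = "scal ((- 1) ^ (p * q))"
  have "(gen A * gen B - ?s * gen B * gen A - gen (sbracket p q A B)) * r \<in> U_ideal"
  proof (rule U_relations_mult)
    show "gen A * gen B - ?s * gen B * gen A - gen (sbracket p q A B) \<in> U_relations"
      unfolding U_relations_def using pq A B by (intro UnI2 CollectI exI[of _ p] exI[of _ q] exI[of _ A] exI[of _ B]) simp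
  qed (rule r)
  then have "kac_class b l (gen A * (gen B * r) - ?s * (gen B * (gen A * r))) = kac_class b l (gen (sbracket p q A B) * r)"
    using AB r by (intro kac_class_cong) (simp_all add: left_diff_distrib mult.assoc)
  then show "act ?K (sbracket p q A B) v = act ?K A (act ?K B v) \<ominus>\<^bsub>?K\<^esub> (- 1) ^ (p * q) \<odot>\<^bsub>?K\<^esub> act ?K B (act ?K A v)"
    using AB r by (simp add: ks kac_minus)
qed

lemma kac_cyclic:
  assumes T: "kac_class b l 1 \<in> T" "kac_class b l 0 \<in> T"
    and add: "\<And>v w. v \<in> T \<inter> carrier (kac_module b l) \<Longrightarrow> w \<in> T \<inter> carrier (kac_module b l) \<Longrightarrow> v \<oplus>\<^bsub>kac_module b l\<^esub> w \<in> T"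
    and smult: "\<And>c v. v \<in> T \<inter> carrier (kac_module b l) \<Longrightarrow> c \<odot>\<^bsub>kac_module b l\<^esub> v \<in> T"
    and act: "\<And>A v. A \<in> sl12 \<Longrightarrow> v \<in> T \<inter> carrier (kac_module b l) \<Longrightarrow> act (kac_module b l) A v \<in> T"
  shows "carrier (kac_module b l) \<subseteq> T"
proof -
  note ks = kac_module_simps
  have single_F: "single w c \<in> Fset" if "set (letters w) \<subseteq> sl12" for w c
    using that by (auto simp: Fset_def split: if_splits)
  have "kac_class b l (single (FWord ws) c) \<in> T" if "set ws \<subseteq> sl12" for ws c
    using that
  proof (induction ws)
    case Nil
    have "single (FWord []) c = scal c * 1" by (simp add: scal_def zero_fword_def)
    then show ?case using smult[of "kac_class b l 1" c] T(1) by (simp add: ks)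
  next
    case (Cons A ws)
    have "single (FWord (A # ws)) c = gen A * single (FWord ws) c"
      by (simp add: gen_def mult_single plus_fword_def)
    then show ?case
      using Cons act[of A "kac_class b l (single (FWord ws) c)"] single_F[of "FWord ws" c] by (simp add: ks)
  qed
  then have single: "kac_class b l (single w c) \<in> T" if "set (letters w) \<subseteq> sl12" for w c
    using that by (cases w) simp
  have "kac_class b l p \<in> T" if "p \<in> Fset" for p
    using that
  proof (rule Fset_induct)
    show "kac_class b l 0 \<in> T" by (rule T(2))
    fix w c q assume "set (letters w) \<subseteq> sl12" "q \<in> Fset" "kac_class b l q \<in> T"
    then show "kac_class b l (single w c + q) \<in> T"
      using add[of "kac_class b l (single w c)" "kac_class b l q"] single single_F by (simp add: ks)
  qed
  then show ?thesis by (auto simp: ks)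
qed

type_synonym kac_space = "free_alg set set \<Rightarrow>\<^sub>0 complex"

abbreviation intertwines :: "('v::cvec) action \<Rightarrow> ('w::cvec) action \<Rightarrow> 'v set \<Rightarrow> ('v \<Rightarrow> 'w) \<Rightarrow> bool" where
  "intertwines R Q S f \<equiv> (\<forall>a\<in>S. \<forall>c\<in>S. f (a + c) = f a + f c) \<and> (\<forall>a\<in>S. \<forall>c. f (c *\<^sub>c a) = c *\<^sub>c f a) \<and>
     (\<forall>A\<in>sl12. \<forall>a\<in>S. f (R A a) = Q A (f a))"

text \<open>The three properties through which Kac modules are used below: the generator satisfies its
  relations, it generates, and it maps to any vector that satisfies the relations.\<close>

theorem kac_module_embedding:
  "\<exists>(R :: kac_space action) S v.
     rep sl12 R \<and> subrep sl12 R S \<and> v \<in> S \<and> kac_hwv b l R v \<and>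
     (\<forall>T. subrep sl12 R T \<longrightarrow> v \<in> T \<longrightarrow> S \<subseteq> T) \<and>
     (\<forall>(Q :: ('w::cvec) action) w. rep sl12 Q \<longrightarrow> kac_hwv b l Q w \<longrightarrow>
        (\<exists>f. f v = w \<and> intertwines R Q S f)) \<and>
     module_iso sl12 (kac_module b l) (rep_module R S)"
proof -
  let ?K = "kac_module b l"
  note ks = kac_module_simps
  obtain R :: "kac_space action" and S j where
    R: "rep sl12 R" and S: "subrep sl12 R S" and j: "lie_hom sl12 ?K (rep_module R S) j" "bij_betw j (carrier ?K) S"
    by (rule embed_lie_module[OF lie_module_kac subalg_sl12])
  define h where "h p = j (kac_class b l p)" for p
  have hS: "h p \<in> S" if "p \<in> Fset" for p using j(2) that by (auto simp: h_def bij_betw_def ks)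
  have S_eq: "S = h ` Fset" using j(2) by (auto simp: h_def bij_betw_def ks image_image)
  have h_add: "h (p + q) = h p + h q" if "p \<in> Fset" "q \<in> Fset" for p q
    using j(1) that by (simp add: lie_hom_def h_def ks)
  have h_scal: "h (scal c * p) = c *\<^sub>c h p" if "p \<in> Fset" for p c
    using j(1) that by (simp add: lie_hom_def h_def ks)
  have h_gen: "h (gen A * p) = R A (h p)" if "p \<in> Fset" "A \<in> sl12" for p A
    using j(1) that by (simp add: lie_hom_def h_def ks)
  have h_eq: "h p = h q \<longleftrightarrow> p - q \<in> kac_rel b l" if "p \<in> Fset" "q \<in> Fset" for p q
    using j(2) that by (simp add: h_def bij_betw_def ks kac_class_eq_iff [symmetric] inj_on_eq_iff[of j "kac_class b l ` Fset"])
  have h0: "h 0 = 0" using h_add[of 0 0] by simp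
  have h_rel: "h p = 0" if "p \<in> kac_rel b l" for p
    using that h_eq[of p 0] kac_rel_subset[of b l] h0 by (simp add: subset_iff)
  have gens: "h p = 0" if "p \<in> kac_gens b l" for p
    by (rule h_rel) (rule kac_rel_closed(4)[OF that])
  have h1: "R A (h 1) = h (gen A)" if "A \<in> sl12" for A
    using h_gen[of 1 A] that by simp
  have hw: "kac_hwv b l R (h 1)"
    unfolding kac_hwv_def
  proof (intro conjI ballI allI)
    show "R A (h 1) = 0" if "A \<in> nplus b" for A
      using that nplus_subset[of b] gens[of "gen A"] by (simp add: h1 subset_iff kac_gens_def)
    show "R (cartan a c) (h 1) = weight_eval l a c *\<^sub>c h 1" for a c
    proof -
      have "gen (cartan a c) - scal (weight_eval l a c) \<in> kac_gens b l" by (auto simp: kac_gens_def)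
      then have "h (gen (cartan a c)) = h (scal (weight_eval l a c) * 1)"
        by (subst h_eq) (simp_all add: kac_rel_closed(4))
      then show ?thesis by (simp only: h1 cartan_sl12 h_scal Fset_closed(2))
    qed
    have "h (gen y2 ^ k) = ypow R (h 1) k" for k
      by (induction k) (simp_all add: h_gen)
    then show "ypow R (h 1) (nat \<lfloor>Re (snd l)\<rfloor> + 1) = 0"
      using gens[of "gen y2 ^ (nat \<lfloor>Re (snd l)\<rfloor> + 1)"] by (simp only: kac_gens_def Un_iff singleton_iff simp_thms)
  qed
  have cyc: "S \<subseteq> T" if T: "subrep sl12 R T" "h 1 \<in> T" for T
  proof -
    have T': "cvec.subspace T" "\<And>A v. A \<in> sl12 \<Longrightarrow> v \<in> T \<Longrightarrow> R A v \<in> T" using T(1) by (simp_all add: subrep_def)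
    have "carrier ?K \<subseteq> {x. j x \<in> T}"
    proof (rule kac_cyclic)
      show "kac_class b l 1 \<in> {x. j x \<in> T}" using T(2) by (simp add: h_def)
      show "kac_class b l 0 \<in> {x. j x \<in> T}" using h0 cvec.subspace_0[OF T'(1)] by (simp add: h_def)
    qed (use j(1) in \<open>simp_all add: lie_hom_def cvec.subspace_add[OF T'(1)] cvec.subspace_scale[OF T'(1)] T'(2)\<close>)
    then show ?thesis using j(2) by (auto simp: bij_betw_def)
  qed
  have univ: "\<exists>f. f (h 1) = w \<and> intertwines R Q S f"
    if Q: "rep sl12 Q" and w: "kac_hwv b l Q w" for Q :: "'w action" and w
  proof -
    define f where "f a = ev Q (SOME p. p \<in> Fset \<and> h p = a) w" for a
    have f: "f (h p) = ev Q p w" if p: "p \<in> Fset" for p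
    proof -
      define q where "q = (SOME q. q \<in> Fset \<and> h q = h p)"
      have "q \<in> Fset \<and> h q = h p"
        unfolding q_def by (rule someI[of _ p]) (simp add: p)
      then have "q - p \<in> kac_rel b l" using h_eq[of q p] p by simp
      then have "ev Q (q - p) w = 0" by (rule ev_kac_rel[OF Q w])
      then show ?thesis by (simp add: f_def ev_diff q_def)
    qed
    note lQ = rep_lin[OF Q]
    show ?thesis
    proof (intro exI[of _ f] conjI)
      show "f (h 1) = w" by (simp add: f ev_one)
      show "\<forall>a\<in>S. \<forall>c\<in>S. f (a + c) = f a + f c"
        unfolding S_eq by (simp add: h_add [symmetric] f ev_add)
      show "\<forall>a\<in>S. \<forall>c. f (c *\<^sub>c a) = c *\<^sub>c f a"
        unfolding S_eq by (simp add: h_scal [symmetric] f ev_mult[of Q, OF lQ] ev_scal)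
      show "\<forall>A\<in>sl12. \<forall>a\<in>S. f (R A a) = Q A (f a)"
        unfolding S_eq by (simp add: h_gen [symmetric] f ev_mult[of Q, OF lQ] ev_gen)
    qed
  qed
  have iso: "module_iso sl12 ?K (rep_module R S)"
    unfolding module_iso_iff by (rule exI[of _ j]) (simp add: j)
  show ?thesis
    by (intro exI[of _ R] exI[of _ S] exI[of _ "h 1"] conjI allI impI R S hw iso hS Fset_closed(2);
        (rule cyc univ; assumption)?)
qed

section \<open>Modules generated by a singular vector of the first Borel subalgebra\<close>

text \<open>The map $(a,b,c,d)\mapsto \iota a + y_1\iota b + y_3\iota c + y_1y_3\iota d$ out of the induced
  module.\<close>

definition Phi :: "('v::cvec) action \<Rightarrow> ('u::cvec \<Rightarrow> 'v) \<Rightarrow> 'u \<times> 'u \<times> 'u \<times> 'u \<Rightarrow> 'v" where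
  "Phi R io = (\<lambda>(a, b, c, d). io a + R y1 (io b) + R y3 (io c) + R y1 (R y3 (io d)))"

lemma lin_Phi:
  assumes "rep k R" "lin io" shows "lin (Phi R io)"
proof (rule linI)
  note l = lin_add[OF assms(2)] lin_cs[OF assms(2)] lin_add[OF rep_lin[OF assms(1)]] lin_cs[OF rep_lin[OF assms(1)]]
  show "Phi R io (u + w) = Phi R io u + Phi R io w" for u w
    by (cases u; cases w) (simp add: Phi_def l add_ac)
  show "Phi R io (c *\<^sub>c u) = c *\<^sub>c Phi R io u" for c u
    by (cases u) (simp add: Phi_def l cs_Pair cs_right_distrib)
qed

text \<open>This is Frobenius reciprocity: a \<open>gl(2)\<close>-homomorphism \<open>io\<close> whose image is killed by \<open>x1\<close> and
  \<open>x3\<close> extends to the induced module.\<close>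

lemma Phi_hom:
  assumes R: "rep sl12 R" and Q: "rep gl2 Q" and io: "lin io" and hom: "\<And>A u. A \<in> gl2 \<Longrightarrow> R A (io u) = io (Q A u)"
    and kill: "\<And>u. R x1 (io u) = 0" "\<And>u. R x3 (io u) = 0" and A: "A \<in> sl12"
  shows "R A (Phi R io u) = Phi R io (Ind Q A u)"
proof (rule sl12_induct[of A "\<lambda>A. R A (Phi R io u) = Phi R io (Ind Q A u)", OF A])
  note lR = rep_lin[OF R]
  note linR = lin_add[OF lR] lin_zero[OF lR] lin_minus[OF lR] lin_diff[OF lR]
  note lini = lin_add[OF io] lin_zero[OF io] lin_minus[OF io] lin_diff[OF io]
  note calc = Phi_def linR lini sl12_rels[OF R] hom kill
  fix p B assume B: "p \<in> {0::nat, 1}" "B \<in> basis_part p"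
  obtain a b c d where u: "u = (a, b, c, d)" by (cases u) auto
  have eh1: "R h1 (Phi R io u) = Phi R io (Ind Q h1 u)" by (simp add: u calc)
  have eh2: "R h2 (Phi R io u) = Phi R io (Ind Q h2 u)" by (simp add: u calc)
  have ex2: "R x2 (Phi R io u) = Phi R io (Ind Q x2 u)" by (simp add: u calc add_ac)
  have ey2: "R y2 (Phi R io u) = Phi R io (Ind Q y2 u)" by (simp add: u calc add_ac)
  have ex1: "R x1 (Phi R io u) = Phi R io (Ind Q x1 u)" by (simp add: u calc)
  have ex3: "R x3 (Phi R io u) = Phi R io (Ind Q x3 u)" by (simp add: u calc)
  have ey1: "R y1 (Phi R io u) = Phi R io (Ind Q y1 u)" by (simp add: u calc)
  have ey3: "R y3 (Phi R io u) = Phi R io (Ind Q y3 u)" by (simp add: u calc)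
  show "R B (Phi R io u) = Phi R io (Ind Q B u)"
  proof (cases "p = 0")
    case True
    then have "B = h1 \<or> B = h2 \<or> B = x2 \<or> B = y2" using B by (simp add: basis_part_def)
    then show ?thesis by (elim disjE; hypsubst) (rule eh1 eh2 ex2 ey2)+
  next
    case False
    then have "B = x1 \<or> B = x3 \<or> B = y1 \<or> B = y3" using B by (simp add: basis_part_def)
    then show ?thesis by (elim disjE; hypsubst) (rule ex1 ex3 ey1 ey3)+
  qed
next
  note lR = rep_lin[OF R]
  fix A B assume "A \<in> sl12" "B \<in> sl12" "R A (Phi R io u) = Phi R io (Ind Q A u)" "R B (Phi R io u) = Phi R io (Ind Q B u)"
  then show "R (A + B) (Phi R io u) = Phi R io (Ind Q (A + B) u)"
    by (simp add: rep_plus[OF R] rep_plus[OF rep_Ind[OF Q]] lin_add[OF lin_Phi[OF R io]])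
next
  fix c A assume "A \<in> sl12" "R A (Phi R io u) = Phi R io (Ind Q A u)"
  then show "R (cscale c A) (Phi R io u) = Phi R io (Ind Q (cscale c A) u)"
    by (simp add: rep_cscale[OF R] rep_cscale[OF rep_Ind[OF Q]] lin_cs[OF lin_Phi[OF R io]])
qed

lemma zero_fun_fold [simp]: "(\<lambda>_. 0) = (0 :: 'a \<Rightarrow> 'b::zero)"
  by (rule ext) simp

text \<open>The relations of the generator for the first Borel subalgebra and the weight \<open>(m, n)\<close>.\<close>

definition singular1 :: "('v::cvec) action \<Rightarrow> complex \<Rightarrow> nat \<Rightarrow> 'v \<Rightarrow> bool" where
  "singular1 R m n v \<longleftrightarrow> sl2_hwv R m (of_nat n) v \<and> R x1 v = 0 \<and> R x3 v = 0 \<and> ypow R v (Suc n) = 0"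

type_synonym ispace = "(nat \<Rightarrow> complex) \<times> (nat \<Rightarrow> complex) \<times> (nat \<Rightarrow> complex) \<times> (nat \<Rightarrow> complex)"

definition Icar :: "nat \<Rightarrow> (ispace) set" where
  "Icar d = Lcar d \<times> Lcar d \<times> Lcar d \<times> Lcar d"

lemma subrep_Ind: "subrep k (Ind (Lrep m d)) (Icar d)"
proof -
  note cl = cvec.subspace_0[OF subspace_Lcar] cvec.subspace_add[OF subspace_Lcar]
    cvec.subspace_diff[OF subspace_Lcar] cvec.subspace_neg[OF subspace_Lcar] cvec.subspace_scale[OF subspace_Lcar]
    Lrep_range
  have r: "(\<lambda>_. 0) = (0 :: nat \<Rightarrow> complex)" by (simp add: fun_eq_iff)
  have "Ind (Lrep m d) A u \<in> Icar d" if "u \<in> Icar d" for A u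
    using that unfolding Ind_def mkrep_def Icar_def
    by (auto simp: cs_Pair simp del: Lrep_named intro!: cl)
  then show ?thesis
    unfolding subrep_def cvec.subspace_def Icar_def
    by (auto simp: zero_prod_def cs_Pair intro!: cl)
qed

lemma singular1_Ind: "singular1 (Ind (Lrep m (Suc n))) m n (unit_fun 0, 0, 0, 0)"
proof -
  let ?d = "Suc n"
  have z: "LX ?d 0 = 0" "LY ?d 0 = 0" "LH ?d 0 = 0" "LZ m ?d 0 = 0"
    by (simp_all add: lin_zero)
  have "LX ?d (unit_fun 0) = 0" "LZ m ?d (unit_fun 0) = m *\<^sub>c unit_fun 0" "LH ?d (unit_fun 0) = of_nat n *\<^sub>c unit_fun 0"
    by (auto simp: fun_eq_iff Lops_def unit_fun_def cs_fun_def cs_complex_def)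
  moreover have "ypow (Ind (Lrep m ?d)) (unit_fun 0, 0, 0, 0) k = (if k < ?d then unit_fun k else 0, 0, 0, 0)" for k
  proof (induction k)
    case (Suc k)
    have "LY ?d (unit_fun k) = (if Suc k < ?d then unit_fun (Suc k) else 0)"
      by (auto simp: fun_eq_iff unit_fun_def LY_def split: nat.split)
    then show ?case using Suc by (simp add: z)
  qed simp
  ultimately show ?thesis
    by (simp add: singular1_def sl2_hwv_def z cs_Pair zero_prod_def del: funpow.simps)
qed

text \<open>The map \<open>Phi\<close> is onto because its image is invariant and contains the generator. It is
  injective because the given map \<open>f\<close> to the induced module, which exists for Kac modules by the universal
  property, is a left inverse: both maps respect the generators and the action.\<close>

theorem singular1_generated_iso_Ind:
  assumes R: "rep sl12 R" and S: "subrep sl12 R S" and v: "v \<in> S" "singular1 R m n v"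
    and cyclic: "\<And>T. subrep sl12 R T \<Longrightarrow> v \<in> T \<Longrightarrow> S \<subseteq> T"
    and f: "\<And>a b. a \<in> S \<Longrightarrow> b \<in> S \<Longrightarrow> f (a + b) = f a + f b" "\<And>c a. a \<in> S \<Longrightarrow> f (c *\<^sub>c a) = c *\<^sub>c f a"
      "\<And>A a. A \<in> sl12 \<Longrightarrow> a \<in> S \<Longrightarrow> f (R A a) = Ind (Lrep m (Suc n)) A (f a)"
      "f v = (unit_fun 0, 0, 0, 0)"
  shows "\<exists>F. lin F \<and> bij_betw F (Icar (Suc n)) S \<and> (\<forall>A\<in>sl12. \<forall>u. R A (F u) = F (Ind (Lrep m (Suc n)) A u))"
proof -
  let ?d = "Suc n" and ?i = "iota R v (Suc n)"
  let ?F = "Phi R ?i"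
  note R0 = rep_gl2[OF R]
  note lR = rep_lin[OF R]
  have hw: "sl2_hwv R m (of_nat ?d - 1) v" and top: "ypow R v ?d = 0" and kill: "R x1 v = 0" "R x3 v = 0"
    using v(2) by (simp_all add: singular1_def del: funpow.simps)
  note hom = iota_hom[OF R0 hw top]
  have y1k: "R x1 (ypow R v k) = 0" for k
    by (induction k) (simp_all add: kill sl12_rels_x(4)[OF R, symmetric] lin_zero[OF lR])
  have y3k: "R x3 (ypow R v k) = 0" for k
    by (induction k) (simp_all add: kill sl12_rels_x(5)[OF R] lin_zero[OF lR] y1k)
  have ki: "R x1 (?i u) = 0" "R x3 (?i u) = 0" for u
    by (simp_all only: iota_def lin_sum[OF lR] lin_cs[OF lR] y1k y3k) simp_all
  have Fhom: "R A (?F u) = ?F (Ind (Lrep m ?d) A u)" if "A \<in> sl12" for A u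
    by (rule Phi_hom[OF R rep_Lrep lin_iota]) (simp_all only: hom ki that)
  have linF: "lin ?F" by (rule lin_Phi[OF R lin_iota])
  have subS: "cvec.subspace S" and inv: "\<And>A w. A \<in> sl12 \<Longrightarrow> w \<in> S \<Longrightarrow> R A w \<in> S"
    using S by (simp_all add: subrep_def)
  have yS: "ypow R v k \<in> S" for k by (induction k) (simp_all add: v inv)
  have iS: "?i u \<in> S" for u
    unfolding iota_def by (intro cvec.subspace_sum cvec.subspace_scale subS yS)
  have FS: "?F u \<in> S" for u
    by (cases u) (auto simp: Phi_def intro!: cvec.subspace_add[OF subS] inv iS)
  have v0: "?F (unit_fun 0, 0, 0, 0) = v"
    by (simp add: Phi_def iota_unit lin_zero[OF lin_iota] lin_zero[OF lR])
  have subI: "cvec.subspace (Icar ?d)" and invI: "\<And>A w. w \<in> Icar ?d \<Longrightarrow> Ind (Lrep m ?d) A w \<in> Icar ?d"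
    using subrep_Ind[of UNIV m ?d] by (simp_all add: subrep_def)
  have "subrep sl12 R (?F ` Icar ?d)"
    unfolding subrep_def
  proof (intro conjI ballI)
    show "cvec.subspace (?F ` Icar ?d)"
      by (rule cvec.linear_subspace_image[OF linF[unfolded lin_iff_linear] subI])
    show "R A w \<in> ?F ` Icar ?d" if "A \<in> sl12" "w \<in> ?F ` Icar ?d" for A w
      using that invI by (auto simp: Fhom)
  qed
  moreover have "v \<in> ?F ` Icar ?d"
    by (rule image_eqI[of _ _ "(unit_fun 0, 0, 0, 0)"])
      (simp_all add: v0 Icar_def cvec.subspace_0[OF subspace_Lcar], simp add: Lcar_def unit_fun_def)
  ultimately have surj: "?F ` Icar ?d = S" using cyclic FS by auto
  have f0: "f 0 = 0" using f(2)[of v 0] v(1) by simp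
  have fsum: "f (\<Sum>k\<in>K. g k) = (\<Sum>k\<in>K. f (g k))" if "finite K" "\<And>k. g k \<in> S" for K and g :: "nat \<Rightarrow> _"
    using that(1) by (induction K rule: finite_induct)
      (simp_all add: f0 f(1) that(2) cvec.subspace_sum[OF subS])
  have fy: "f (ypow R v k) = (unit_fun k, 0, 0, 0)" if "k < ?d" for k
    using that
  proof (induction k)
    case 0 then show ?case by (simp add: f(4))
  next
    case (Suc k)
    have "LY ?d (unit_fun k) = unit_fun (Suc k)"
      using Suc.prems by (auto simp: fun_eq_iff unit_fun_def LY_def split: nat.split)
    then show ?case using Suc f(3)[OF _ yS, of y2 k] by (simp add: lin_zero)
  qed
  have linE: "lin (\<lambda>u::nat \<Rightarrow> complex. (u, 0::nat \<Rightarrow> complex, 0::nat \<Rightarrow> complex, 0::nat \<Rightarrow> complex))"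
    by (rule linI) (simp_all add: cs_Pair)
  have fi: "f (?i u) = (u, 0, 0, 0)" if "u \<in> Lcar ?d" for u
  proof -
    have "f (?i u) = (\<Sum>k<?d. u k *\<^sub>c f (ypow R v k))"
      unfolding iota_def by (subst fsum) (simp_all add: f(2) yS cvec.subspace_scale[OF subS] del: sum.lessThan_Suc)
    also have "\<dots> = (\<Sum>k<?d. u k *\<^sub>c (unit_fun k, 0, 0, 0))"
      by (rule sum.cong) (simp_all add: fy)
    also have "\<dots> = (\<Sum>k<?d. (u k *\<^sub>c unit_fun k, 0, 0, 0))"
      by (simp only: cs_Pair cvec.scale_zero_right)
    also have "\<dots> = (\<Sum>k<?d. u k *\<^sub>c unit_fun k, 0, 0, 0)"
      by (rule lin_sum[OF linE, symmetric])
    also have "\<dots> = (u, 0, 0, 0)" by (simp only: unit_fun_expand[OF that, symmetric])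
    finally show ?thesis .
  qed
  have fF: "f (?F u) = u" if uI: "u \<in> Icar ?d" for u
  proof -
    obtain a b c d where u: "u = (a, b, c, d)" by (cases u) auto
    have L: "a \<in> Lcar ?d" "b \<in> Lcar ?d" "c \<in> Lcar ?d" "d \<in> Lcar ?d"
      using uI by (simp_all add: u Icar_def)
    show ?thesis
      by (simp add: u Phi_def f(1,3) cvec.subspace_add[OF subS] inv iS fi L)
  qed
  then have "inj_on ?F (Icar ?d)" by (rule inj_on_inverseI)
  then have "bij_betw ?F (Icar ?d) S" using surj by (simp add: bij_betw_def)
  then show ?thesis using linF Fhom by (intro exI[of _ ?F]) simp
qed

section \<open>The Clebsch-Gordan decomposition\<close>

text \<open>The tensor product of the span of \<open>y1\<close>, \<open>y3\<close> with the module of dimension \<open>n + 1\<close> has highest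
  weight vectors $y_1\otimes e_0$ and $n\,y_3\otimes e_0 - y_1\otimes e_1$, generating modules of
  dimension \<open>n + 2\<close> and \<open>n\<close>. Powers of \<open>y2\<close> applied to them are
  $y_1\otimes e_k + k\,y_3\otimes e_{k-1}$ and $(n-k)\,y_3\otimes e_k - y_1\otimes e_{k+1}$. The
  functions \<open>p2\<close>, \<open>p3\<close> hold the coefficients of these vectors; \<open>p0\<close>, \<open>p1\<close> belong to the summands $L$
  and $y_1y_3 L$.\<close>

definition CG :: "nat \<Rightarrow> ispace \<Rightarrow>
    ispace" where
  "CG n = (\<lambda>(p0, p1, p2, p3). (p0,
     \<lambda>k. if k \<le> n then p2 k - (case k of 0 \<Rightarrow> 0 | Suc j \<Rightarrow> p3 j) else 0,
     \<lambda>k. if k \<le> n then of_nat (Suc k) * p2 (Suc k) + (of_nat n - of_nat k) * p3 k else 0, p1))"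

definition Dcar :: "nat \<Rightarrow> (ispace) set" where
  "Dcar n = Lcar (Suc n) \<times> Lcar (Suc n) \<times> Lcar (Suc (Suc n)) \<times> Lcar n"

definition Drep :: "nat \<Rightarrow> complex \<Rightarrow> complex \<Rightarrow> complex \<Rightarrow> complex \<Rightarrow> mat3 \<Rightarrow>
  ispace \<Rightarrow>
  ispace" where
  "Drep n m0 m1 m2 m3 A = (\<lambda>(p0, p1, p2, p3).
     (Lrep m0 (Suc n) A p0, Lrep m1 (Suc n) A p1, Lrep m2 (Suc (Suc n)) A p2, Lrep m3 n A p3))"

lemma lin_CG: "lin (CG n)"
  by (rule linI) (auto simp: CG_def cs_Pair fun_eq_iff cs_fun_def cs_complex_def algebra_simps split: nat.split)

lemma Drep_add: "Drep n m0 m1 m2 m3 (A + B) p = Drep n m0 m1 m2 m3 A p + Drep n m0 m1 m2 m3 B p"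
  and Drep_cscale: "Drep n m0 m1 m2 m3 (cscale c A) p = c *\<^sub>c Drep n m0 m1 m2 m3 A p"
  by (cases p; simp add: Drep_def Lrep_def mkrep_add mkrep_cscale cs_Pair)+

lemma CG_hom:
  assumes "A \<in> gl2" "p \<in> Dcar n"
  shows "CG n (Drep n m (m - 1) m (m - 1) A p) = Ind (Lrep m (Suc n)) A (CG n p)"
proof -
  obtain p0 p1 p2 p3 where p: "p = (p0, p1, p2, p3)" and
    L: "\<And>k. Suc (Suc n) \<le> k \<Longrightarrow> p2 k = 0" "\<And>k. n \<le> k \<Longrightarrow> p3 k = 0"
      "\<And>k. Suc n \<le> k \<Longrightarrow> p0 k = 0" "\<And>k. Suc n \<le> k \<Longrightarrow> p1 k = 0"
    using assms(2) by (cases p) (auto simp: Dcar_def Lcar_def)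
  have top: "k \<le> n \<Longrightarrow> \<not> k < n \<Longrightarrow> k = n" for k by simp
  note calc = CG_def Drep_def Lops_def fun_eq_iff L algebra_simps cs_fun_def cs_complex_def
  have "CG n (Drep n m (m - 1) m (m - 1) x2 p) = Ind (Lrep m (Suc n)) x2 (CG n p)"
    unfolding p by (auto simp: calc split: nat.split dest!: top)
  moreover have "CG n (Drep n m (m - 1) m (m - 1) y2 p) = Ind (Lrep m (Suc n)) y2 (CG n p)"
    unfolding p by (auto simp: calc split: nat.split dest!: top)
  moreover have "CG n (Drep n m (m - 1) m (m - 1) h1 p) = Ind (Lrep m (Suc n)) h1 (CG n p)"
    unfolding p by (auto simp: calc split: nat.split dest!: top)
  moreover have "CG n (Drep n m (m - 1) m (m - 1) h2 p) = Ind (Lrep m (Suc n)) h2 (CG n p)"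
    unfolding p by (auto simp: calc split: nat.split dest!: top)
  ultimately have "CG n (Drep n m (m - 1) m (m - 1) B p) = Ind (Lrep m (Suc n)) B (CG n p)"
    if "B \<in> basis_part 0" for B
    using that by (auto simp: basis_part_def)
  then show ?thesis
    by (rule part_induct[OF _ assms(1), of "\<lambda>A. CG n (Drep n m (m - 1) m (m - 1) A p) = Ind (Lrep m (Suc n)) A (CG n p)", rotated 1])
      (simp_all add: Drep_add Drep_cscale rep_plus[OF rep_Ind[OF rep_Lrep]] rep_cscale[OF rep_Ind[OF rep_Lrep]]
        lin_add[OF lin_CG] lin_cs[OF lin_CG] gl2_subset)
qed

text \<open>Eliminating \<open>p2\<close> from the equations $b_{k+1} = p_2(k+1) - p_3(k)$ and
  $c_k = (k+1)\,p_2(k+1) + (n-k)\,p_3(k)$ gives $c_k - (k+1)\,b_{k+1} = (n+1)\,p_3(k)$.\<close>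

definition CG_inv :: "nat \<Rightarrow> ispace \<Rightarrow>
    ispace" where
  "CG_inv n = (\<lambda>(a, b, c, d). let q = \<lambda>j. (c j - of_nat (Suc j) * b (Suc j)) / of_nat (Suc n) in
     (a, d, \<lambda>k. b k + (case k of 0 \<Rightarrow> 0 | Suc j \<Rightarrow> q j), \<lambda>k. if k < n then q k else 0))"

lemma bij_CG: "bij_betw (CG n) (Dcar n) (Icar (Suc n))"
proof (rule bij_betwI[where g = "CG_inv n"])
  have nz: "1 + of_nat n \<noteq> (0 :: complex)"
    using of_nat_neq_0[of n, where 'a = complex] by simp
  have top: "k \<le> n \<Longrightarrow> \<not> k < n \<Longrightarrow> k = n" for k by simp
  show "CG n \<in> Dcar n \<rightarrow> Icar (Suc n)"
    by (auto simp: CG_def Dcar_def Icar_def Lcar_def)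
  show "CG_inv n \<in> Icar (Suc n) \<rightarrow> Dcar n"
    by (auto simp: CG_inv_def Dcar_def Icar_def Lcar_def split: nat.split)
  show "CG_inv n (CG n p) = p" if "p \<in> Dcar n" for p
    using that
    by (auto simp: CG_def CG_inv_def Dcar_def Lcar_def fun_eq_iff field_simps nz not_le not_less Suc_le_eq dest!: top split: nat.split)
  show "CG n (CG_inv n p) = p" if "p \<in> Icar (Suc n)" for p
  proof -
    obtain a b c d where p: "p = (a, b, c, d)" by (cases p) auto
    have L: "b k = 0" "c k = 0" if "n < k" for k
      using \<open>p \<in> Icar (Suc n)\<close> that by (simp_all add: p Icar_def Lcar_def)
    define q where "q j = (c j - of_nat (Suc j) * b (Suc j)) / of_nat (Suc n)" for j
    have q: "of_nat (Suc n) * q j = c j - of_nat (Suc j) * b (Suc j)" for j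
      by (simp add: q_def nz del: of_nat_Suc)
    have b: "(if k \<le> n then b k + (case k of 0 \<Rightarrow> 0 | Suc j \<Rightarrow> q j) - (case k of 0 \<Rightarrow> 0 | Suc j \<Rightarrow> if j < n then q j else 0) else 0) = b k" for k
      using L(1)[of k] by (auto split: nat.split)
    have c: "(if k \<le> n then of_nat (Suc k) * (b (Suc k) + q k) + (of_nat n - of_nat k) * (if k < n then q k else 0) else 0) = c k" for k
    proof (cases "k \<le> n")
      case True
      have "(of_nat n - of_nat k) * (if k < n then q k else 0) = (of_nat n - of_nat k) * q k"
        using True by (cases "k = n") simp_all
      then have "of_nat (Suc k) * (b (Suc k) + q k) + (of_nat n - of_nat k) * (if k < n then q k else 0) =
          of_nat (Suc k) * b (Suc k) + of_nat (Suc n) * q k"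
        by (simp add: algebra_simps)
      then show ?thesis using True by (simp only: if_True q) simp
    qed (simp add: L(2))
    have "CG_inv n p = (a, d, \<lambda>k. b k + (case k of 0 \<Rightarrow> 0 | Suc j \<Rightarrow> q j), \<lambda>k. if k < n then q k else 0)"
      by (simp only: p CG_inv_def prod.case Let_def q_def)
    then show ?thesis
      by (simp only: CG_def prod.case nat.case b c p)
  qed
qed

section \<open>An involution that exchanges the Borel subalgebras\<close>

text \<open>The negative supertranspose followed by conjugation with the Weyl reflection, with signs chosen so
  that \<open>x2\<close>, \<open>y2\<close> and \<open>h2\<close> are fixed; the odd matrices are mapped by \<open>x1 \<mapsto> - y3\<close>, \<open>x3 \<mapsto> y1\<close>,
  \<open>y1 \<mapsto> x3\<close>, \<open>y3 \<mapsto> - x1\<close>, and \<open>h1\<close> is mapped to \<open>h2 - h1\<close>.\<close>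

definition invol :: "mat3 \<Rightarrow> mat3" where
  "invol A = (\<chi> i j.
     if i = 1 \<and> j = 1 then - ent A 1 1 else if i = 2 \<and> j = 2 then - ent A 3 3
     else if i = 3 \<and> j = 3 then - ent A 2 2 else if i = 3 \<and> j = 1 then - ent A 1 2
     else if i = 2 \<and> j = 1 then ent A 1 3 else if i = 1 \<and> j = 3 then ent A 2 1
     else if i = 1 \<and> j = 2 then - ent A 3 1 else ent A i j)"

lemma ent_invol [simp]:
  "ent (invol A) 1 1 = - ent A 1 1" "ent (invol A) 2 2 = - ent A 3 3" "ent (invol A) 3 3 = - ent A 2 2"
  "ent (invol A) 3 1 = - ent A 1 2" "ent (invol A) 2 1 = ent A 1 3" "ent (invol A) 1 3 = ent A 2 1"
  "ent (invol A) 1 2 = - ent A 3 1" "ent (invol A) 2 3 = ent A 2 3" "ent (invol A) 3 2 = ent A 3 2"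
  by (simp_all add: invol_def)

lemma invol_invol [simp]: "invol (invol A) = A"
  by (simp add: mat3_eq_iff forall_3)

lemma invol_add: "invol (A + B) = invol A + invol B" and invol_cscale: "invol (cscale c A) = cscale c (invol A)"
  by (simp_all add: mat3_eq_iff forall_3)

lemma invol_part: "p \<in> {0,1} \<Longrightarrow> A \<in> sl12_part p \<Longrightarrow> invol A \<in> sl12_part p"
proof -
  have "A \<in> gl2 \<Longrightarrow> invol A \<in> gl2" by (simp add: even_iff)
  moreover have "A \<in> sl12_part (Suc 0) \<Longrightarrow> invol A \<in> sl12_part (Suc 0)" by (simp add: odd_iff)
  ultimately show "p \<in> {0,1} \<Longrightarrow> A \<in> sl12_part p \<Longrightarrow> invol A \<in> sl12_part p" by auto
qed

lemma invol_sl12: "A \<in> sl12 \<Longrightarrow> invol A \<in> sl12"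
  by (simp add: sl12_iff)

lemma sbracket_invol:
  assumes "p \<in> {0,1}" "q \<in> {0,1}" "A \<in> sl12_part p" "B \<in> sl12_part q"
  shows "sbracket p q (invol A) (invol B) = invol (sbracket p q A B)"
proof -
  note calc = mat3_eq_iff forall_3 sbracket_nth
  have "sbracket 0 0 (invol A) (invol B) = invol (sbracket 0 0 A B)" if "A \<in> gl2" "B \<in> gl2"
    using that unfolding even_iff by (simp add: calc) (simp add: algebra_simps)?
  moreover have "sbracket 0 (Suc 0) (invol A) (invol B) = invol (sbracket 0 (Suc 0) A B)" if "A \<in> gl2" "B \<in> sl12_part (Suc 0)"
    using that unfolding even_iff odd_iff by (simp add: calc) (simp add: algebra_simps)?
  moreover have "sbracket (Suc 0) 0 (invol A) (invol B) = invol (sbracket (Suc 0) 0 A B)" if "A \<in> sl12_part (Suc 0)" "B \<in> gl2"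
    using that unfolding even_iff odd_iff by (simp add: calc) (simp add: algebra_simps)?
  moreover have "sbracket (Suc 0) (Suc 0) (invol A) (invol B) = invol (sbracket (Suc 0) (Suc 0) A B)"
    if "A \<in> sl12_part (Suc 0)" "B \<in> sl12_part (Suc 0)"
    using that unfolding odd_iff by (simp add: calc) (simp add: algebra_simps)?
  ultimately show ?thesis using assms by auto
qed

lemma invol_named:
  "invol x1 = cscale (- 1) y3" "invol x3 = y1" "invol y1 = x3" "invol y3 = cscale (- 1) x1" "invol x2 = x2" "invol y2 = y2"
  "invol h1 = h2 + cscale (- 1) h1" "invol h2 = h2"
  by (simp_all add: mat3_eq_iff forall_3)

lemma rep_invol: "rep sl12 R \<Longrightarrow> rep sl12 (\<lambda>A. R (invol A))"
  unfolding rep_def[of sl12 "\<lambda>A. R (invol A)"]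
proof (intro conjI ballI allI)
  assume R: "rep sl12 R"
  show "lin (R (invol A))" for A by (rule rep_lin[OF R])
  show "R (invol (A + B)) v = R (invol A) v + R (invol B) v" if "A \<in> sl12" "B \<in> sl12" for A B v
    using that by (simp add: invol_add rep_plus[OF R] invol_sl12)
  show "R (invol (cscale c A)) v = c *\<^sub>c R (invol A) v" if "A \<in> sl12" for A c v
    using that by (simp add: invol_cscale rep_cscale[OF R] invol_sl12)
  fix p q A B v
  assume pq: "p \<in> {0::nat, 1}" "q \<in> {0::nat, 1}" and A: "A \<in> sl12 \<inter> sl12_part p" and B: "B \<in> sl12 \<inter> sl12_part q"
  have "invol (sbracket p q A B) = sbracket p q (invol A) (invol B)"
    using sbracket_invol[OF pq] A B by simp
  then show "R (invol (sbracket p q A B)) v = R (invol A) (R (invol B) v) - ((- 1) ^ (p * q)) *\<^sub>c R (invol B) (R (invol A) v)"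
    using rep_sbracket[OF R pq, of "invol A" "invol B" v] A B pq by (simp only: invol_sl12 invol_part Int_iff simp_thms)
qed

lemma subrep_invol: "subrep sl12 (\<lambda>A. R (invol A)) S \<longleftrightarrow> subrep sl12 R S"
proof -
  have "(\<forall>A\<in>sl12. \<forall>v\<in>S. R (invol A) v \<in> S) \<longleftrightarrow> (\<forall>A\<in>sl12. \<forall>v\<in>S. R A v \<in> S)"
    using invol_sl12 invol_invol by metis
  then show ?thesis by (simp add: subrep_def)
qed

fun gens :: "borel \<Rightarrow> mat3 set" where
  "gens Borel1 = {x1, x2, x3}" | "gens Borel2 = {y1, x2, x3}" | "gens Borel3 = {y1, x2, y3}"

lemma nplus_gens: "nplus b = mspan (gens b)" and gens_sl12: "gens b \<subseteq> sl12"
  by (cases b; simp)+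

lemma kac_hwv_iff:
  assumes R: "rep sl12 R"
  shows "kac_hwv b (m, of_nat n) R v \<longleftrightarrow> (\<forall>A\<in>gens b. R A v = 0) \<and> R h1 v = m *\<^sub>c v \<and> R h2 v = of_nat n *\<^sub>c v \<and>
    ypow R v (Suc n) = 0"
proof -
  have "(\<forall>A\<in>nplus b. R A v = 0) \<longleftrightarrow> (\<forall>A\<in>gens b. R A v = 0)"
    unfolding nplus_gens using mspan_base[of _ "gens b"] mspan_kills[OF R subalg_sl12 named_in_sl12(7) gens_sl12] by metis
  moreover have "(\<forall>a c. R (cartan a c) v = weight_eval (m, of_nat n) a c *\<^sub>c v) \<longleftrightarrow> R h1 v = m *\<^sub>c v \<and> R h2 v = of_nat n *\<^sub>c v"
  proof
    assume *: "\<forall>a c. R (cartan a c) v = weight_eval (m, of_nat n) a c *\<^sub>c v"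
    show "R h1 v = m *\<^sub>c v \<and> R h2 v = of_nat n *\<^sub>c v"
      using *[rule_format, of 1 0] *[rule_format, of 0 1]
      by (simp add: rep_cartan[OF R part_subset] weight_eval_def cs_one)
  qed (simp add: rep_cartan[OF R part_subset] weight_eval_def cs_left_distrib cs_cs)
  ultimately show ?thesis by (simp add: kac_hwv_def del: funpow.simps)
qed

text \<open>The properties that characterise Kac modules up to isomorphism. They are stated for an arbitrary
  action because they are also applied to actions twisted by \<^const>\<open>invol\<close>. Universality is stated
  towards the type of the induced module, to which it is applied.\<close>

definition kac_like :: "borel \<Rightarrow> complex \<Rightarrow> nat \<Rightarrow> ('v::cvec) action \<Rightarrow> 'v set \<Rightarrow> 'v \<Rightarrow> bool" where
  "kac_like b m n R S v \<longleftrightarrow> rep sl12 R \<and> subrep sl12 R S \<and> v \<in> S \<and> kac_hwv b (m, of_nat n) R v \<and>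
     (\<forall>T. subrep sl12 R T \<longrightarrow> v \<in> T \<longrightarrow> S \<subseteq> T) \<and>
     (\<forall>(Q :: ispace action) w. rep sl12 Q \<longrightarrow> kac_hwv b (m, of_nat n) Q w \<longrightarrow>
        (\<exists>f. f v = w \<and> intertwines R Q S f))"

lemma kac_like_univ:
  fixes Q :: "ispace action"
  assumes K: "kac_like b m n R S v" and Q: "rep sl12 Q" "kac_hwv b (m, of_nat n) Q w"
  obtains f where "f v = w" "\<forall>a\<in>S. \<forall>c\<in>S. f (a + c) = f a + f c" "\<forall>a\<in>S. \<forall>c. f (c *\<^sub>c a) = c *\<^sub>c f a"
    "\<forall>A\<in>sl12. \<forall>a\<in>S. f (R A a) = Q A (f a)"
proof -
  have "\<forall>(Q :: ispace action) w. rep sl12 Q \<longrightarrow> kac_hwv b (m, of_nat n) Q w \<longrightarrow>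
        (\<exists>f. f v = w \<and> intertwines R Q S f)"
    using K unfolding kac_like_def by (elim conjE)
  from this[THEN spec, THEN spec, THEN mp, THEN mp, OF Q] show ?thesis
    by (elim exE conjE) (rule that)
qed

fun twist :: "borel \<Rightarrow> borel" where
  "twist Borel1 = Borel3" | "twist Borel2 = Borel2" | "twist Borel3 = Borel1"

lemma twist_twist [simp]: "twist (twist b) = b" by (cases b) simp_all

text \<open>Twisting turns the weight \<open>(m, n)\<close> into \<open>(n - m, n)\<close>, since \<open>h1\<close> becomes \<open>h2 - h1\<close>.\<close>

lemma kac_hwv_twist:
  assumes R: "rep sl12 R" and "kac_hwv b (m, of_nat n) R v"
  shows "kac_hwv (twist b) (of_nat n - m, of_nat n) (\<lambda>A. R (invol A)) v"
  using assms(2) unfolding kac_hwv_iff[OF R] kac_hwv_iff[OF rep_invol[OF R]]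
  by (cases b) (simp_all add: invol_named rep_plus[OF R] rep_cscale[OF R] sl12_closed cvec.scale_left_diff_distrib del: funpow.simps)

lemma kac_like_twist:
  assumes "kac_like b m n R S v"
  shows "kac_like (twist b) (of_nat n - m) n (\<lambda>A. R (invol A)) S v"
proof -
  have R: "rep sl12 R" and S: "subrep sl12 R S" and v: "v \<in> S" "kac_hwv b (m, of_nat n) R v"
    and cyc: "\<And>T. subrep sl12 R T \<Longrightarrow> v \<in> T \<Longrightarrow> S \<subseteq> T"
    using assms by (simp_all add: kac_like_def)
  show ?thesis
    unfolding kac_like_def
  proof (intro conjI allI impI)
    show "rep sl12 (\<lambda>A. R (invol A))" by (rule rep_invol[OF R])
    show "subrep sl12 (\<lambda>A. R (invol A)) S" using S by (simp only: subrep_invol)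
    show "v \<in> S" by (rule v)
    show "kac_hwv (twist b) (of_nat n - m, of_nat n) (\<lambda>A. R (invol A)) v" by (rule kac_hwv_twist[OF R v(2)])
    show "S \<subseteq> T" if "subrep sl12 (\<lambda>A. R (invol A)) T" "v \<in> T" for T
      using that by (intro cyc) (simp_all only: subrep_invol)
    fix Q :: "ispace action" and w
    assume Q: "rep sl12 Q" and w: "kac_hwv (twist b) (of_nat n - m, of_nat n) Q w"
    have "kac_hwv b (m, of_nat n) (\<lambda>A. Q (invol A)) w"
      using kac_hwv_twist[OF Q w] by simp
    obtain f where f: "f v = w" "\<forall>a\<in>S. \<forall>c\<in>S. f (a + c) = f a + f c" "\<forall>a\<in>S. \<forall>c. f (c *\<^sub>c a) = c *\<^sub>c f a"
      "\<forall>A\<in>sl12. \<forall>a\<in>S. f (R A a) = Q (invol A) (f a)"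
      by (rule kac_like_univ[OF assms rep_invol[OF Q] \<open>kac_hwv b (m, of_nat n) (\<lambda>A. Q (invol A)) w\<close>])
    have "\<forall>A\<in>sl12. \<forall>a\<in>S. f (R (invol A) a) = Q A (f a)"
      using f(4) by (simp add: invol_sl12)
    then show "\<exists>f. f v = w \<and> (\<forall>a\<in>S. \<forall>c\<in>S. f (a + c) = f a + f c) \<and> (\<forall>a\<in>S. \<forall>c. f (c *\<^sub>c a) = c *\<^sub>c f a) \<and>
          (\<forall>A\<in>sl12. \<forall>a\<in>S. f (R (invol A) a) = Q A (f a))"
      using f(1-3) by (intro exI[of _ f] conjI)
  qed
qed

lemma singular1_generated_decomp:
  assumes R: "rep sl12 R" and S: "subrep sl12 R S" and v: "v \<in> S" "singular1 R m n v"
    and cyclic: "\<And>T. subrep sl12 R T \<Longrightarrow> v \<in> T \<Longrightarrow> S \<subseteq> T"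
    and f: "\<And>a b. a \<in> S \<Longrightarrow> b \<in> S \<Longrightarrow> f (a + b) = f a + f b" "\<And>c a. a \<in> S \<Longrightarrow> f (c *\<^sub>c a) = c *\<^sub>c f a"
      "\<And>A a. A \<in> sl12 \<Longrightarrow> a \<in> S \<Longrightarrow> f (R A a) = Ind (Lrep m (Suc n)) A (f a)"
      "f v = (unit_fun 0, 0, 0, 0)"
  shows "\<exists>G. lin G \<and> bij_betw G (Dcar n) S \<and>
    (\<forall>A\<in>gl2. \<forall>p\<in>Dcar n. R A (G p) = G (Drep n m (m - 1) m (m - 1) A p))"
proof -
  have "\<exists>F. lin F \<and> bij_betw F (Icar (Suc n)) S \<and> (\<forall>A\<in>sl12. \<forall>u. R A (F u) = F (Ind (Lrep m (Suc n)) A u))"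
    by (rule singular1_generated_iso_Ind[where f = f, OF R S v]) (simp_all add: cyclic f)
  then obtain F where F: "lin F" "bij_betw F (Icar (Suc n)) S" "\<forall>A\<in>sl12. \<forall>u. R A (F u) = F (Ind (Lrep m (Suc n)) A u)"
    by (elim exE conjE)
  let ?G = "\<lambda>p. F (CG n p)"
  have "lin ?G" by (rule linI) (simp_all add: lin_add[OF F(1)] lin_cs[OF F(1)] lin_add[OF lin_CG] lin_cs[OF lin_CG])
  moreover have "bij_betw ?G (Dcar n) S"
    using bij_betw_trans[OF bij_CG F(2)] by (simp add: comp_def)
  moreover have "\<forall>A\<in>gl2. \<forall>p\<in>Dcar n. R A (?G p) = ?G (Drep n m (m - 1) m (m - 1) A p)"
    by (intro ballI) (simp only: CG_hom F(3)[rule_format, OF gl2_subset])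
  ultimately show ?thesis by (intro exI[of _ ?G] conjI)
qed

lemma kac_like_Borel1_decomp:
  assumes "kac_like Borel1 m n R S v"
  shows "\<exists>G. lin G \<and> bij_betw G (Dcar n) S \<and>
    (\<forall>A\<in>gl2. \<forall>p\<in>Dcar n. R A (G p) = G (Drep n m (m - 1) m (m - 1) A p))"
proof -
  let ?Q = "Ind (Lrep m (Suc n))"
  have R: "rep sl12 R" and S: "subrep sl12 R S" and v: "v \<in> S" "kac_hwv Borel1 (m, of_nat n) R v"
    and cyc: "\<And>T. subrep sl12 R T \<Longrightarrow> v \<in> T \<Longrightarrow> S \<subseteq> T"
    using assms by (simp_all add: kac_like_def)
  have w: "kac_hwv Borel1 (m, of_nat n) ?Q (unit_fun 0, 0, 0, 0)"
    using singular1_Ind[of m n] by (simp add: kac_hwv_iff[OF rep_Ind[OF rep_Lrep]] singular1_def sl2_hwv_def del: funpow.simps)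
  obtain f where f: "f v = (unit_fun 0, 0, 0, 0)" "\<forall>a\<in>S. \<forall>c\<in>S. f (a + c) = f a + f c" "\<forall>a\<in>S. \<forall>c. f (c *\<^sub>c a) = c *\<^sub>c f a"
      "\<forall>A\<in>sl12. \<forall>a\<in>S. f (R A a) = ?Q A (f a)"
    by (rule kac_like_univ[OF assms rep_Ind[OF rep_Lrep] w])
  have "singular1 R m n v"
    using v(2) by (simp add: kac_hwv_iff[OF R] singular1_def sl2_hwv_def del: funpow.simps)
  then show ?thesis
    by (intro singular1_generated_decomp[where f = f, OF R S v(1) _ cyc]) (simp_all add: f)
qed

section \<open>Odd reflection for the second Borel subalgebra\<close>

lemma x3_ypow:
  assumes R: "rep sl12 R" and "R x3 v = 0"
  shows "R x3 (ypow R v (Suc k)) = of_nat (Suc k) *\<^sub>c R x1 (ypow R v k)"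
proof (induction k)
  case 0
  then show ?case using assms(2) by (simp add: sl12_rels_x(5)[OF R] lin_zero[OF rep_lin[OF R]] cs_one)
next
  case (Suc k)
  have step: "R y2 (R x3 (ypow R v (Suc k))) = of_nat (Suc k) *\<^sub>c R x1 (ypow R v (Suc k))"
    by (simp only: Suc lin_cs[OF rep_lin[OF R]] sl12_rels_x(4)[OF R]) simp
  have "R x3 (ypow R v (Suc (Suc k))) = R y2 (R x3 (ypow R v (Suc k))) + R x1 (ypow R v (Suc k))"
    by (simp add: sl12_rels_x(5)[OF R])
  also have "\<dots> = of_nat (Suc k) *\<^sub>c R x1 (ypow R v (Suc k)) + 1 *\<^sub>c R x1 (ypow R v (Suc k))"
    by (simp only: step cs_one)
  also have "\<dots> = of_nat (Suc (Suc k)) *\<^sub>c R x1 (ypow R v (Suc k))"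
    by (simp only: cs_left_distrib [symmetric]) (simp add: add.commute)
  finally show ?case .
qed

lemma ypow_x1: "rep sl12 R \<Longrightarrow> ypow R (R x1 v) k = R x1 (ypow R v k)"
  by (induction k) (simp_all add: sl12_rels_x(4))

lemma ypow_y1:
  assumes R: "rep sl12 R"
  shows "ypow R (R y1 v) (Suc k) = R y1 (ypow R v (Suc k)) + of_nat (Suc k) *\<^sub>c R y3 (ypow R v k)"
proof (induction k)
  case 0
  then show ?case by (simp add: sl12_rels(7)[OF R] cs_one)
next
  case (Suc k)
  have "ypow R (R y1 v) (Suc (Suc k)) = R y2 (ypow R (R y1 v) (Suc k))" by simp
  also have "\<dots> = R y1 (ypow R v (Suc (Suc k))) + (1 *\<^sub>c R y3 (ypow R v (Suc k)) + of_nat (Suc k) *\<^sub>c R y3 (ypow R v (Suc k)))"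
    by (simp only: Suc lin_cs[OF rep_lin[OF R]] lin_add[OF rep_lin[OF R]] sl12_rels(7,8)[OF R] cs_one) (simp add: add.assoc)
  also have "\<dots> = R y1 (ypow R v (Suc (Suc k))) + of_nat (Suc (Suc k)) *\<^sub>c R y3 (ypow R v (Suc k))"
    by (simp only: cs_left_distrib [symmetric]) (simp add: add.commute)
  finally show ?case .
qed

lemma ypow_cs: "rep k R \<Longrightarrow> ypow R (c *\<^sub>c v) j = c *\<^sub>c ypow R v j"
  by (induction j) (simp_all add: lin_cs[OF rep_lin])

text \<open>The vector \<open>x1 v\<close> is singular for the first Borel subalgebra. The top power of \<open>y2\<close> kills it because
  \<open>x3\<close> applied to $y_2^{n+2}v = 0$ is $(n+2)\,x_1y_2^{n+1}v$. It generates because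
  \<open>y1 (x1 v) = m v\<close>. The map to the induced module sends \<open>v\<close> to $m^{-1}y_1$ times the generator, so that
  \<open>x1 v\<close> goes to the generator.\<close>

lemma kac_like_Borel2_decomp:
  assumes "kac_like Borel2 m (Suc n) R S v" and m: "m \<noteq> 0"
  shows "\<exists>G. lin G \<and> bij_betw G (Dcar n) S \<and>
    (\<forall>A\<in>gl2. \<forall>p\<in>Dcar n. R A (G p) = G (Drep n m (m - 1) m (m - 1) A p))"
proof -
  let ?Q = "Ind (Lrep m (Suc n))" and ?u = "(unit_fun 0, 0, 0, 0) :: ispace"
  have R: "rep sl12 R" and S: "subrep sl12 R S" and v: "v \<in> S" "kac_hwv Borel2 (m, of_nat (Suc n)) R v"
    and cyc: "\<And>T. subrep sl12 R T \<Longrightarrow> v \<in> T \<Longrightarrow> S \<subseteq> T"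
    using assms(1) by (simp_all add: kac_like_def del: of_nat_Suc)
  have Q: "rep sl12 ?Q" by (rule rep_Ind[OF rep_Lrep])
  have u: "?Q x1 ?u = 0" "?Q x2 ?u = 0" "?Q x3 ?u = 0" "?Q h1 ?u = m *\<^sub>c ?u" "?Q h2 ?u = of_nat n *\<^sub>c ?u" "ypow ?Q ?u (Suc n) = 0"
    using singular1_Ind[of m n] by (simp_all only: singular1_def sl2_hwv_def)
  let ?w = "inverse m *\<^sub>c ?Q y1 ?u"
  note lQ = lin_cs[OF rep_lin[OF Q]] lin_zero[OF rep_lin[OF Q]]
  have "ypow ?Q (?Q y1 ?u) (Suc (Suc n)) = 0"
    using u(6) by (simp only: ypow_y1[OF Q]) (simp only: funpow.simps comp_def lQ cvec.scale_zero_right add_0)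
  then have "ypow ?Q ?w (Suc (Suc n)) = 0"
    by (simp only: ypow_cs[OF Q] cvec.scale_zero_right)
  moreover have "?Q y1 ?w = 0" "?Q x2 ?w = 0" "?Q x3 ?w = 0"
    by (simp_all only: lQ sl12_rels[OF Q] u cvec.scale_zero_right diff_0_right)
  moreover have "?Q h1 ?w = m *\<^sub>c ?w"
    by (simp only: lQ sl12_rels[OF Q] u cs_cs mult.commute)
  moreover have "?Q h2 ?w = of_nat (Suc n) *\<^sub>c ?w"
    by (simp only: lQ sl12_rels[OF Q] u of_nat_Suc cs_left_distrib cs_one cs_cs cs_right_distrib mult.commute add.commute)
      (simp add: distrib_left cs_left_distrib)
  ultimately have w: "kac_hwv Borel2 (m, of_nat (Suc n)) ?Q ?w"
    by (simp only: kac_hwv_iff[OF Q] gens.simps ball_simps simp_thms)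
  obtain f where f: "f v = ?w" "\<forall>a\<in>S. \<forall>c\<in>S. f (a + c) = f a + f c" "\<forall>a\<in>S. \<forall>c. f (c *\<^sub>c a) = c *\<^sub>c f a"
      "\<forall>A\<in>sl12. \<forall>a\<in>S. f (R A a) = ?Q A (f a)"
    by (rule kac_like_univ[OF assms(1) Q w])
  have g: "R y1 v = 0" "R x2 v = 0" "R x3 v = 0" "R h1 v = m *\<^sub>c v" "R h2 v = of_nat (Suc n) *\<^sub>c v" "ypow R v (Suc (Suc n)) = 0"
    using v(2) by (simp_all only: kac_hwv_iff[OF R] gens.simps ball_simps simp_thms)
  let ?v = "R x1 v"
  note lR = lin_cs[OF rep_lin[OF R]] lin_zero[OF rep_lin[OF R]]
  have "R x1 (ypow R v (Suc n)) = 0"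
  proof -
    have "of_nat (Suc (Suc n)) *\<^sub>c R x1 (ypow R v (Suc n)) = 0"
      using x3_ypow[OF R g(3), of "Suc n"] by (simp only: g(6) lR)
    then show ?thesis by (simp only: cvec.scale_eq_0_iff of_nat_eq_0_iff) simp
  qed
  then have "ypow R ?v (Suc n) = 0" by (simp only: ypow_x1[OF R])
  moreover have "R x1 ?v = 0" "R x2 ?v = 0" "R x3 ?v = 0"
    by (simp_all only: sl12_rels_x[OF R] g lR diff_0_right minus_zero)
  moreover have "R h1 ?v = m *\<^sub>c ?v" by (simp only: sl12_rels_x[OF R] g lR)
  moreover have "R h2 ?v = of_nat n *\<^sub>c ?v"
    by (simp only: sl12_rels_x[OF R] g lR) (simp add: cs_left_distrib cs_one)
  ultimately have sing: "singular1 R m n ?v"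
    by (simp only: singular1_def sl2_hwv_def simp_thms)
  have inv: "\<And>A w. A \<in> sl12 \<Longrightarrow> w \<in> S \<Longrightarrow> R A w \<in> S" using S by (simp add: subrep_def)
  have y1v: "R y1 ?v = m *\<^sub>c v"
    using sl12_rels(9)[OF R, of v] by (simp add: g lR)
  have cyc': "S \<subseteq> T" if T: "subrep sl12 R T" "?v \<in> T" for T
  proof (rule cyc[OF T(1)])
    have T': "cvec.subspace T" "\<And>A w. A \<in> sl12 \<Longrightarrow> w \<in> T \<Longrightarrow> R A w \<in> T" using T(1) by (simp_all add: subrep_def)
    have "m *\<^sub>c v \<in> T" using T'(2)[of y1 ?v] T(2) by (simp add: y1v)
    then have "inverse m *\<^sub>c m *\<^sub>c v \<in> T" by (rule cvec.subspace_scale[OF T'(1)])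
    then show "v \<in> T" using m by (simp add: cs_cs cs_one)
  qed
  have fv: "f ?v = ?u"
  proof -
    have "f ?v = ?Q x1 ?w" using f(1,4) v(1) by simp
    also have "\<dots> = inverse m *\<^sub>c m *\<^sub>c ?u" by (simp only: lQ sl12_rels[OF Q] u diff_0_right)
    also have "\<dots> = ?u" using m by (simp add: cs_cs cs_one)
    finally show ?thesis .
  qed
  show ?thesis
    by (rule singular1_generated_decomp[where f = f, OF R S inv[OF named_in_sl12(1) v(1)] sing cyc'])
      (simp_all add: f(2-4) fv del: Ind_named)
qed

text \<open>On a vector with \<open>h1\<close>-weight \<open>m - k\<close> and \<open>h2\<close>-weight \<open>d - 1 - 2 k\<close> the matrix \<open>h2 - h1\<close> has
  weight \<open>(d - 1 - m) - k\<close>.\<close>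

lemma Lrep_invol:
  assumes "A \<in> gl2" shows "Lrep m d (invol A) = Lrep (of_nat d - 1 - m) d A"
  using assms unfolding even_iff
  by (auto simp: fun_eq_iff Lrep_def mkrep_def LZ_def LH_def cs_fun_def cs_complex_def algebra_simps)

lemma twisted_decomp:
  assumes "lin G" and bij: "bij_betw G (Dcar n) S"
    and G: "\<forall>A\<in>gl2. \<forall>p\<in>Dcar n. R (invol A) (G p) = G (Drep n m (m - 1) m (m - 1) A p)"
  shows "\<forall>A\<in>gl2. \<forall>p\<in>Dcar n. R A (G p) =
    G (Drep n (of_nat n - m) (of_nat n - m + 1) (of_nat n - m + 1) (of_nat n - m) A p)"
proof (intro ballI)
  fix A p assume A: "A \<in> gl2" and p: "p \<in> Dcar n"
  have "R A (G p) = G (Drep n m (m - 1) m (m - 1) (invol A) p)"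
    using G[rule_format, OF invol_part[of 0, OF _ A] p] by simp
  also have "Drep n m (m - 1) m (m - 1) (invol A) p = Drep n (of_nat n - m) (of_nat n - m + 1) (of_nat n - m + 1) (of_nat n - m) A p"
    by (cases p) (simp add: Drep_def Lrep_invol[OF A] algebra_simps)
  finally show "R A (G p) = G (Drep n (of_nat n - m) (of_nat n - m + 1) (of_nat n - m + 1) (of_nat n - m) A p)" .
qed

section \<open>Direct sums and the decomposition of Kac modules\<close>

lemma rep_Drep: "rep gl2 (Drep n m0 m1 m2 m3)"
  unfolding rep_def
proof (intro conjI ballI allI)
  note lL = rep_lin[OF rep_Lrep]
  show "lin (Drep n m0 m1 m2 m3 A)" for A
  proof (rule linI)
    show "Drep n m0 m1 m2 m3 A (p + q) = Drep n m0 m1 m2 m3 A p + Drep n m0 m1 m2 m3 A q" for p q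
      by (cases p; cases q) (simp add: Drep_def lin_add[OF lL])
    show "Drep n m0 m1 m2 m3 A (c *\<^sub>c p) = c *\<^sub>c Drep n m0 m1 m2 m3 A p" for c p
      by (cases p) (simp add: Drep_def lin_cs[OF lL] cs_Pair)
  qed
  show "Drep n m0 m1 m2 m3 (A + B) p = Drep n m0 m1 m2 m3 A p + Drep n m0 m1 m2 m3 B p" for A B p
    by (rule Drep_add)
  show "Drep n m0 m1 m2 m3 (cscale c A) p = c *\<^sub>c Drep n m0 m1 m2 m3 A p" for c A p
    by (rule Drep_cscale)
  fix p q A B and v :: ispace
  assume pq: "p \<in> {0::nat, 1}" "q \<in> {0::nat, 1}" "A \<in> gl2 \<inter> sl12_part p" "B \<in> gl2 \<inter> sl12_part q"
  note br = rep_sbracket[OF rep_Lrep pq]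
  obtain a b c d where v: "v = (a, b, c, d)" by (cases v) auto
  show "Drep n m0 m1 m2 m3 (sbracket p q A B) v = Drep n m0 m1 m2 m3 A (Drep n m0 m1 m2 m3 B v) -
      ((- 1) ^ (p * q)) *\<^sub>c Drep n m0 m1 m2 m3 B (Drep n m0 m1 m2 m3 A v)"
    by (simp add: v Drep_def cs_Pair br)
qed

lemma subrep_Drep: "subrep gl2 (Drep n m0 m1 m2 m3) (Dcar n)"
  unfolding subrep_def cvec.subspace_def
proof (intro conjI ballI allI)
  note cl = cvec.subspace_0[OF subspace_Lcar] cvec.subspace_add[OF subspace_Lcar] cvec.subspace_scale[OF subspace_Lcar]
  show "0 \<in> Dcar n" by (simp add: Dcar_def zero_prod_def cl)
  show "p + q \<in> Dcar n" if "p \<in> Dcar n" "q \<in> Dcar n" for p q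
    using that by (cases p; cases q) (simp add: Dcar_def cl)
  show "c *\<^sub>c p \<in> Dcar n" if "p \<in> Dcar n" for c p
    using that by (cases p) (simp add: Dcar_def cs_Pair cl)
  show "Drep n m0 m1 m2 m3 A p \<in> Dcar n" for A p
    by (cases p) (simp add: Dcar_def Drep_def Lrep_range)
qed

lemma bij_betw_obtain:
  assumes "bij_betw f A B" "b \<in> B" obtains a where "b = f a" "a \<in> A"
proof -
  have "b \<in> f ` A" using assms by (simp add: bij_betw_def)
  then show ?thesis using that by (rule imageE)
qed

lemma direct_sum_iso4:
  assumes k: "lie_hom gl2 (rep_module (Lrep m0 (Suc n)) (Lcar (Suc n))) V0 k0" "bij_betw k0 (Lcar (Suc n)) (carrier V0)"
    "lie_hom gl2 (rep_module (Lrep m1 (Suc n)) (Lcar (Suc n))) V1 k1" "bij_betw k1 (Lcar (Suc n)) (carrier V1)"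
    "lie_hom gl2 (rep_module (Lrep m2 (Suc (Suc n))) (Lcar (Suc (Suc n)))) V2 k2" "bij_betw k2 (Lcar (Suc (Suc n))) (carrier V2)"
    "lie_hom gl2 (rep_module (Lrep m3 n) (Lcar n)) V3 k3" "bij_betw k3 (Lcar n) (carrier V3)"
  shows "module_iso gl2 (rep_module (Drep n m0 m1 m2 m3) (Dcar n)) (direct_sum [V0, V1, V2, V3])"
  unfolding module_iso_iff
proof (intro exI conjI)
  let ?f = "\<lambda>(a, b, c, d). [k0 a, k1 b, k2 c, k3 d]"
  have upt: "[0..<length [V0, V1, V2, V3]] = [0, 1, 2, 3]" by (simp add: upt_rec)
  have car: "carrier (direct_sum [V0, V1, V2, V3]) =
      {[a, b, c, d] | a b c d. a \<in> carrier V0 \<and> b \<in> carrier V1 \<and> c \<in> carrier V2 \<and> d \<in> carrier V3}"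
    by (auto simp: direct_sum_def list_all2_Cons2)
  show "lie_hom gl2 (rep_module (Drep n m0 m1 m2 m3) (Dcar n)) (direct_sum [V0, V1, V2, V3]) ?f"
    using k(1,3,5,7) unfolding lie_hom_def car
    by (auto simp: Dcar_def Drep_def direct_sum_def upt cs_Pair simp del: length_Cons)
  have "inj_on ?f (Dcar n)"
    using k(2,4,6,8) by (auto simp: inj_on_def bij_betw_def Dcar_def)
  moreover have "?f ` Dcar n = carrier (direct_sum [V0, V1, V2, V3])"
  proof (intro equalityI subsetI)
    fix x assume "x \<in> carrier (direct_sum [V0, V1, V2, V3])"
    then obtain a b c d where x: "x = [a, b, c, d]" "a \<in> carrier V0" "b \<in> carrier V1" "c \<in> carrier V2" "d \<in> carrier V3"
      by (auto simp: car)
    obtain a' where "a = k0 a'" "a' \<in> Lcar (Suc n)" by (rule bij_betw_obtain[OF k(2) x(2)])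
    moreover obtain b' where "b = k1 b'" "b' \<in> Lcar (Suc n)" by (rule bij_betw_obtain[OF k(4) x(3)])
    moreover obtain c' where "c = k2 c'" "c' \<in> Lcar (Suc (Suc n))" by (rule bij_betw_obtain[OF k(6) x(4)])
    moreover obtain d' where "d = k3 d'" "d' \<in> Lcar n" by (rule bij_betw_obtain[OF k(8) x(5)])
    ultimately show "x \<in> ?f ` Dcar n"
      by (intro image_eqI[of _ _ "(a', b', c', d')"]) (simp_all add: x Dcar_def)
  next
    fix x assume "x \<in> ?f ` Dcar n"
    then show "x \<in> carrier (direct_sum [V0, V1, V2, V3])"
      using bij_betwE[OF k(2)] bij_betwE[OF k(4)] bij_betwE[OF k(6)] bij_betwE[OF k(8)] by (auto simp: car Dcar_def)
  qed
  ultimately show "bij_betw ?f (carrier (rep_module (Drep n m0 m1 m2 m3) (Dcar n))) (carrier (direct_sum [V0, V1, V2, V3]))"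
    by (simp add: bij_betw_def)
qed

lemma direct_sum_iso3:
  assumes k: "lie_hom gl2 (rep_module (Lrep m0 (Suc 0)) (Lcar (Suc 0))) V0 k0" "bij_betw k0 (Lcar (Suc 0)) (carrier V0)"
    "lie_hom gl2 (rep_module (Lrep m1 (Suc 0)) (Lcar (Suc 0))) V1 k1" "bij_betw k1 (Lcar (Suc 0)) (carrier V1)"
    "lie_hom gl2 (rep_module (Lrep m2 (Suc (Suc 0))) (Lcar (Suc (Suc 0)))) V2 k2" "bij_betw k2 (Lcar (Suc (Suc 0))) (carrier V2)"
  shows "module_iso gl2 (rep_module (Drep 0 m0 m1 m2 m3) (Dcar 0)) (direct_sum [V0, V1, V2])"
  unfolding module_iso_iff
proof (intro exI conjI)
  let ?f = "\<lambda>(a, b, c, d :: nat \<Rightarrow> complex). [k0 a, k1 b, k2 c]"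
  have L0: "Lcar 0 = {0}" by (auto simp: Lcar_def fun_eq_iff)
  have upt: "[0..<length [V0, V1, V2]] = [0, 1, 2]" by (simp add: upt_rec)
  have car: "carrier (direct_sum [V0, V1, V2]) =
      {[a, b, c] | a b c. a \<in> carrier V0 \<and> b \<in> carrier V1 \<and> c \<in> carrier V2}"
    by (auto simp: direct_sum_def list_all2_Cons2)
  show "lie_hom gl2 (rep_module (Drep 0 m0 m1 m2 m3) (Dcar 0)) (direct_sum [V0, V1, V2]) ?f"
    using k(1,3,5) unfolding lie_hom_def car
    by (auto simp: Dcar_def Drep_def direct_sum_def upt cs_Pair simp del: length_Cons)
  have "inj_on ?f (Dcar 0)"
    using k(2,4,6) by (auto simp: inj_on_def bij_betw_def Dcar_def L0)
  moreover have "?f ` Dcar 0 = carrier (direct_sum [V0, V1, V2])"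
  proof (intro equalityI subsetI)
    fix x assume "x \<in> carrier (direct_sum [V0, V1, V2])"
    then obtain a b c where x: "x = [a, b, c]" "a \<in> carrier V0" "b \<in> carrier V1" "c \<in> carrier V2"
      by (auto simp: car)
    obtain a' where "a = k0 a'" "a' \<in> Lcar (Suc 0)" by (rule bij_betw_obtain[OF k(2) x(2)])
    moreover obtain b' where "b = k1 b'" "b' \<in> Lcar (Suc 0)" by (rule bij_betw_obtain[OF k(4) x(3)])
    moreover obtain c' where "c = k2 c'" "c' \<in> Lcar (Suc (Suc 0))" by (rule bij_betw_obtain[OF k(6) x(4)])
    ultimately show "x \<in> ?f ` Dcar 0"
      by (intro image_eqI[of _ _ "(a', b', c', 0)"]) (simp_all add: x Dcar_def L0)
  next
    fix x assume "x \<in> ?f ` Dcar 0"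
    then show "x \<in> carrier (direct_sum [V0, V1, V2])"
      using bij_betwE[OF k(2)] bij_betwE[OF k(4)] bij_betwE[OF k(6)] by (auto simp: car Dcar_def)
  qed
  ultimately show "bij_betw ?f (carrier (rep_module (Drep 0 m0 m1 m2 m3) (Dcar 0))) (carrier (direct_sum [V0, V1, V2]))"
    by (simp add: bij_betw_def)
qed

lemma Lrep_iso_L_gl:
  obtains k where "lie_hom gl2 (rep_module (Lrep m (Suc n)) (Lcar (Suc n))) (L_gl (m, of_nat n)) k"
    "bij_betw k (Lcar (Suc n)) (carrier (L_gl (m, of_nat n)))"
  using module_iso_sym[OF L_gl_lie_module L_gl_iso_Lrep, of m n]
  unfolding module_iso_iff rep_module_simps by (elim exE conjE)

lemma Drep_iso_direct_sum:
  "module_iso gl2 (rep_module (Drep n m0 m1 m2 m3) (Dcar n))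
     (direct_sum ([L_gl (m0, of_nat n), L_gl (m1, of_nat n), L_gl (m2, of_nat (Suc n))] @
        replicate (1 - of_bool (n = 0)) (L_gl (m3, of_nat n - 1))))"
proof -
  obtain k0 where k0: "lie_hom gl2 (rep_module (Lrep m0 (Suc n)) (Lcar (Suc n))) (L_gl (m0, of_nat n)) k0"
    "bij_betw k0 (Lcar (Suc n)) (carrier (L_gl (m0, of_nat n)))" by (rule Lrep_iso_L_gl)
  obtain k1 where k1: "lie_hom gl2 (rep_module (Lrep m1 (Suc n)) (Lcar (Suc n))) (L_gl (m1, of_nat n)) k1"
    "bij_betw k1 (Lcar (Suc n)) (carrier (L_gl (m1, of_nat n)))" by (rule Lrep_iso_L_gl)
  obtain k2 where k2: "lie_hom gl2 (rep_module (Lrep m2 (Suc (Suc n))) (Lcar (Suc (Suc n)))) (L_gl (m2, of_nat (Suc n))) k2"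
    "bij_betw k2 (Lcar (Suc (Suc n))) (carrier (L_gl (m2, of_nat (Suc n))))" by (rule Lrep_iso_L_gl)
  show ?thesis
  proof (cases n)
    case 0
    show ?thesis
      using direct_sum_iso3[OF k0[unfolded 0] k1[unfolded 0] k2[unfolded 0]] by (simp add: 0)
  next
    case (Suc j)
    obtain k3 where k3: "lie_hom gl2 (rep_module (Lrep m3 (Suc j)) (Lcar (Suc j))) (L_gl (m3, of_nat j)) k3"
      "bij_betw k3 (Lcar (Suc j)) (carrier (L_gl (m3, of_nat j)))" by (rule Lrep_iso_L_gl)
    show ?thesis
      using direct_sum_iso4[OF k0 k1 k2 k3[folded Suc]] by (simp add: Suc)
  qed
qed

lemma decomp_iso:
  assumes R: "rep gl2 R" "subrep gl2 R S" and G: "lin G" "bij_betw G (Dcar n) S"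
    "\<forall>A\<in>gl2. \<forall>p\<in>Dcar n. R A (G p) = G (Drep n m0 m1 m2 m3 A p)"
    and V: "module_iso sl12 V (rep_module R S)"
  shows "module_iso gl2 V
     (direct_sum ([L_gl (m0, of_nat n), L_gl (m1, of_nat n), L_gl (m2, of_nat (Suc n))] @
        replicate (1 - of_bool (n = 0)) (L_gl (m3, of_nat n - 1))))"
proof -
  have "lie_hom gl2 (rep_module (Drep n m0 m1 m2 m3) (Dcar n)) (rep_module R S) G"
    using G bij_betwE[OF G(2)] by (simp add: lie_hom_def lin_add[OF G(1)] lin_cs[OF G(1)])
  then have "module_iso gl2 (rep_module (Drep n m0 m1 m2 m3) (Dcar n)) (rep_module R S)"
    unfolding module_iso_iff by (intro exI[of _ G]) (simp add: G(2))
  from module_iso_sym[OF lie_module_rep_module[OF rep_Drep subrep_Drep] this]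
  have "module_iso gl2 (rep_module R S) (rep_module (Drep n m0 m1 m2 m3) (Dcar n))" .
  from module_iso_trans[OF module_iso_mono[OF part_subset V] module_iso_trans[OF this Drep_iso_direct_sum]]
  show ?thesis .
qed

lemma kac_like_kac_module:
  obtains R :: "kac_space action" and S v where
    "kac_like b m n R S v" "module_iso sl12 (kac_module b (m, of_nat n)) (rep_module R S)"
    "rep gl2 R" "subrep gl2 R S"
proof -
  obtain R :: "kac_space action" and S v where
    R: "rep sl12 R" and S: "subrep sl12 R S" and K: "v \<in> S" "kac_hwv b (m, of_nat n) R v"
    "\<forall>T. subrep sl12 R T \<longrightarrow> v \<in> T \<longrightarrow> S \<subseteq> T"
    "\<forall>(Q :: ispace action) w. rep sl12 Q \<longrightarrow> kac_hwv b (m, of_nat n) Q w \<longrightarrow>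
        (\<exists>f. f v = w \<and> intertwines R Q S f)"
    and iso: "module_iso sl12 (kac_module b (m, of_nat n)) (rep_module R S)"
    using kac_module_embedding[of b "(m, of_nat n)", where 'w = ispace] by (elim exE conjE)
  have "kac_like b m n R S v"
    unfolding kac_like_def by (intro conjI R S K)
  moreover have "subrep gl2 R S"
    using S gl2_subset by (simp add: subrep_def)
  ultimately show ?thesis using iso rep_gl2[OF R] by (intro that)
qed

text \<open>The generator of a finite dimensional irreducible module is an \<open>sl(2)\<close>-highest weight vector, so
  its \<open>h2\<close>-weight \<open>n\<close> is natural. For the second Borel subalgebra and \<open>n = 0\<close>, \<open>x3\<close> maps \<open>y2 v = 0\<close>
  to \<open>x1 v\<close>, hence \<open>x1 v = 0\<close>, and then \<open>0 = y1 (x1 v) = h1 v\<close>.\<close>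

lemma Pplus_dominant:
  assumes "(l1, l2) \<in> Pplus b"
  obtains n where "l2 = of_nat n" "b = Borel2 \<Longrightarrow> n = 0 \<Longrightarrow> l1 = 0"
proof -
  obtain V :: "(nat \<Rightarrow> complex) lmod" where irr: "irreducible_hw_module sl12 (nplus b) (l1, l2) V" and fin: "finite_dimensional V"
    using assms by (auto simp: Pplus_def)
  have lm: "lie_module sl12 V" using irr by (simp add: irreducible_hw_module_def irreducible_module_def)
  interpret Module.module complex_ring V using lm by (simp add: lie_module_def)
  obtain v0 where v0: "highest_weight_vector (nplus b) (l1, l2) V v0"
    using irr by (auto simp: irreducible_hw_module_def)
  obtain R :: "mat3 \<Rightarrow> ((nat \<Rightarrow> complex) \<Rightarrow>\<^sub>0 complex) \<Rightarrow> ((nat \<Rightarrow> complex) \<Rightarrow>\<^sub>0 complex)" and S f where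
    R: "rep sl12 R" and S: "subrep sl12 R S" and f: "lie_hom sl12 V (rep_module R S) f" "bij_betw f (carrier V) S"
    by (rule embed_lie_module[OF lm subalg_sl12])
  define v where "v = f v0"
  have v0c: "v0 \<in> carrier V" "v0 \<noteq> \<zero>\<^bsub>V\<^esub>" using v0 by (simp_all add: highest_weight_vector_def)
  have vS: "v \<in> S" using f(2) v0c by (auto simp: v_def bij_betw_def)
  note f0 = lie_hom_zero[OF lm f(1)]
  have zc: "\<zero>\<^bsub>V\<^esub> \<in> carrier V" by (rule lie_module_zero_closed[OF lm])
  have vn: "v \<noteq> 0"
    using f(2) v0c f0 zc by (auto simp: v_def bij_betw_def inj_on_def)
  have fa: "f (v \<oplus>\<^bsub>V\<^esub> w) = f v + f w" if "v \<in> carrier V" "w \<in> carrier V" for v w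
    using f(1) that by (simp add: lie_hom_def)
  have fc: "f (c \<odot>\<^bsub>V\<^esub> w) = c *\<^sub>c f w" if "w \<in> carrier V" for c w
    using f(1) that by (simp add: lie_hom_def)
  have Rv: "R A v = f (act V A v0)" if "A \<in> sl12" for A
    using f(1) that v0c by (simp add: v_def lie_hom_def)
  have ca: "R (cartan a c) v = weight_eval (l1, l2) a c *\<^sub>c v" for a c
    unfolding Rv[OF cartan_sl12] using v0 fc[OF v0c(1)] by (simp add: highest_weight_vector_def v_def)
  have kill: "R A v = 0" if "A \<in> gens b" for A
    using v0 f0 mspan_base[OF that] subsetD[OF gens_sl12 that]
    by (simp add: Rv highest_weight_vector_def nplus_gens)
  have x2: "R x2 v = 0" by (rule kill) (cases b; simp)
  have h: "R h1 v = l1 *\<^sub>c v" "R h2 v = l2 *\<^sub>c v"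
    using ca[of 1 0] ca[of 0 1] by (simp_all add: rep_cartan[OF R part_subset] weight_eval_def cs_one)
  have hw: "sl2_hwv R l1 l2 v" using x2 h by (simp add: sl2_hwv_def)
  note R0 = rep_gl2[OF R]
  have inv: "\<And>A w. A \<in> sl12 \<Longrightarrow> w \<in> S \<Longrightarrow> R A w \<in> S" using S by (simp add: subrep_def)
  have yS: "ypow R v k \<in> S" for k by (induction k) (simp_all add: vS inv)
  obtain B where B: "finite B" "B \<subseteq> carrier V" "\<And>w. w \<in> carrier V \<Longrightarrow> \<exists>c. w = finsum V (\<lambda>s. c s \<odot>\<^bsub>V\<^esub> s) B"
    using fin unfolding finite_dimensional_def by auto
  have fs: "f (finsum V (\<lambda>s. c s \<odot>\<^bsub>V\<^esub> s) T) \<in> cvec.span (f ` B)" if "finite T" "T \<subseteq> B" for T c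
    using that
  proof (induction T rule: finite_induct)
    case empty
    then show ?case by (simp add: f0 cvec.span_zero)
  next
    case (insert s T)
    have sc: "s \<in> carrier V" "T \<subseteq> carrier V" using insert.prems B(2) by auto
    have "finsum V (\<lambda>s. c s \<odot>\<^bsub>V\<^esub> s) (insert s T) = c s \<odot>\<^bsub>V\<^esub> s \<oplus>\<^bsub>V\<^esub> finsum V (\<lambda>s. c s \<odot>\<^bsub>V\<^esub> s) T"
      by (rule finsum_insert) (use insert.hyps sc in auto)
    moreover have "finsum V (\<lambda>s. c s \<odot>\<^bsub>V\<^esub> s) T \<in> carrier V"
      by (rule finsum_closed) (use sc in auto)
    ultimately have "f (finsum V (\<lambda>s. c s \<odot>\<^bsub>V\<^esub> s) (insert s T)) = c s *\<^sub>c f s + f (finsum V (\<lambda>s. c s \<odot>\<^bsub>V\<^esub> s) T)"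
      using sc by (simp add: fa fc)
    then show ?case
      using insert.IH insert.prems by (simp add: cvec.span_add cvec.span_scale cvec.span_base)
  qed
  have "ypow R v k \<in> cvec.span (f ` B)" for k
  proof -
    obtain w where w: "w \<in> carrier V" "ypow R v k = f w"
      using yS[of k] f(2) by (auto simp: bij_betw_def)
    obtain c where "w = finsum V (\<lambda>s. c s \<odot>\<^bsub>V\<^esub> s) B" using B(3)[OF w(1)] by (rule exE)
    then show ?thesis using fs[OF B(1) order_refl, of c] by (simp only: w(2))
  qed
  then obtain k where "ypow R v k = 0"
    using ypow_finite_dim[OF R0 hw finite_imageI[OF B(1)], of f] by metis
  then obtain n where n: "l2 = of_nat n" "ypow R v (Suc n) = 0"
    using sl2_weight_natural[OF R0 hw vn] by metis
  have "l1 = 0" if b: "b = Borel2" "n = 0"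
  proof -
    have k: "R y1 v = 0" "R x3 v = 0" using kill[of y1] kill[of x3] b by simp_all
    have "R x1 v = 0"
      using x3_ypow[OF R k(2), of 0] n(2) lin_zero[OF rep_lin[OF R, of x3]] by (simp add: b(2) cs_one)
    then have "R h1 v = 0"
      using sl12_rels(9)[OF R, of v] by (simp add: k lin_zero[OF rep_lin[OF R]])
    then show ?thesis using h(1) vn by simp
  qed
  then show ?thesis using n(1) by (intro that)
qed

lemma kac_module_Borel1_iso:
  "module_iso gl2 (kac_module Borel1 (m, of_nat n))
     (direct_sum ([L_gl (m, of_nat n), L_gl (m - 1, of_nat n), L_gl (m, of_nat (Suc n))] @
        replicate (1 - of_bool (n = 0)) (L_gl (m - 1, of_nat n - 1))))"
proof -
  obtain R :: "kac_space action" and S v where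
    K: "kac_like Borel1 m n R S v" and iso: "module_iso sl12 (kac_module Borel1 (m, of_nat n)) (rep_module R S)"
    and R: "rep gl2 R" "subrep gl2 R S" by (rule kac_like_kac_module)
  obtain G where "lin G" "bij_betw G (Dcar n) S" "\<forall>A\<in>gl2. \<forall>p\<in>Dcar n. R A (G p) = G (Drep n m (m - 1) m (m - 1) A p)"
    using kac_like_Borel1_decomp[OF K] by (elim exE conjE)
  from decomp_iso[OF R this iso] show ?thesis .
qed

text \<open>The twisted module is a Kac module for the first Borel subalgebra with weight \<open>(n - m, n)\<close>.\<close>

lemma kac_module_Borel3_iso:
  "module_iso gl2 (kac_module Borel3 (m, of_nat n))
     (direct_sum ([L_gl (m, of_nat n), L_gl (m + 1, of_nat n), L_gl (m + 1, of_nat (Suc n))] @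
        replicate (1 - of_bool (n = 0)) (L_gl (m, of_nat n - 1))))"
proof -
  obtain R :: "kac_space action" and S v where
    K: "kac_like Borel3 m n R S v" and iso: "module_iso sl12 (kac_module Borel3 (m, of_nat n)) (rep_module R S)"
    and R: "rep gl2 R" "subrep gl2 R S" by (rule kac_like_kac_module)
  have "kac_like Borel1 (of_nat n - m) n (\<lambda>A. R (invol A)) S v"
    using kac_like_twist[OF K] by simp
  from kac_like_Borel1_decomp[OF this] obtain G where G: "lin G" "bij_betw G (Dcar n) S"
    "\<forall>A\<in>gl2. \<forall>p\<in>Dcar n. R (invol A) (G p) = G (Drep n (of_nat n - m) (of_nat n - m - 1) (of_nat n - m) (of_nat n - m - 1) A p)"
    by (elim exE conjE)
  from twisted_decomp[OF G]
  have "\<forall>A\<in>gl2. \<forall>p\<in>Dcar n. R A (G p) = G (Drep n m (m + 1) (m + 1) m A p)" by simp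
  from decomp_iso[OF R G(1,2) this iso] show ?thesis .
qed

text \<open>Twisting a decomposition yields its first two summands in the opposite order.\<close>

lemma swap_decomp:
  assumes G: "lin G" "bij_betw G (Dcar n) S" "\<forall>A\<in>gl2. \<forall>p\<in>Dcar n. R A (G p) = G (Drep n m0 m1 m2 m3 A p)"
  shows "\<exists>G. lin G \<and> bij_betw G (Dcar n) S \<and> (\<forall>A\<in>gl2. \<forall>p\<in>Dcar n. R A (G p) = G (Drep n m1 m0 m2 m3 A p))"
proof -
  let ?s = "\<lambda>(a, b, c, d). (b, a, c, d) :: ispace"
  have "bij_betw ?s (Dcar n) (Dcar n)"
    by (rule bij_betwI[where g = ?s]) (auto simp: Dcar_def)
  from bij_betw_trans[OF this G(2)] have "bij_betw (\<lambda>p. G (?s p)) (Dcar n) S" by (simp add: comp_def)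
  moreover have "lin (\<lambda>p. G (?s p))"
  proof (rule linI)
    show "G (?s (p + q)) = G (?s p) + G (?s q)" for p q
      by (cases p; cases q) (simp add: lin_add[OF G(1), symmetric])
    show "G (?s (c *\<^sub>c p)) = c *\<^sub>c G (?s p)" for c p
      by (cases p) (simp add: lin_cs[OF G(1), symmetric] cs_Pair)
  qed
  moreover have "\<forall>A\<in>gl2. \<forall>p\<in>Dcar n. R A (G (?s p)) = G (?s (Drep n m1 m0 m2 m3 A p))"
    using G(3) by (auto simp: Dcar_def Drep_def)
  ultimately show ?thesis by (intro exI[of _ "\<lambda>p. G (?s p)"] conjI)
qed

text \<open>For \<open>m = 0\<close> the odd reflection is applied after twisting, which replaces \<open>m\<close> by \<open>n + 1\<close>.\<close>

lemma kac_module_Borel2_iso: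
  "module_iso gl2 (kac_module Borel2 (m, of_nat (Suc n)))
     (direct_sum ([L_gl (m, of_nat n), L_gl (m - 1, of_nat n), L_gl (m, of_nat (Suc n))] @
        replicate (1 - of_bool (n = 0)) (L_gl (m - 1, of_nat n - 1))))"
proof -
  obtain R :: "kac_space action" and S v where
    K: "kac_like Borel2 m (Suc n) R S v" and iso: "module_iso sl12 (kac_module Borel2 (m, of_nat (Suc n))) (rep_module R S)"
    and R: "rep gl2 R" "subrep gl2 R S" by (rule kac_like_kac_module)
  have "\<exists>G. lin G \<and> bij_betw G (Dcar n) S \<and> (\<forall>A\<in>gl2. \<forall>p\<in>Dcar n. R A (G p) = G (Drep n m (m - 1) m (m - 1) A p))"
  proof (cases "m = 0")
    case False
    then show ?thesis by (rule kac_like_Borel2_decomp[OF K])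
  next
    case True
    let ?k = "of_nat (Suc n) :: complex"
    have "kac_like Borel2 ?k (Suc n) (\<lambda>A. R (invol A)) S v"
      using kac_like_twist[OF K] by (simp add: True del: of_nat_Suc)
    from kac_like_Borel2_decomp[OF this of_nat_neq_0] obtain G where G: "lin G" "bij_betw G (Dcar n) S"
      "\<forall>A\<in>gl2. \<forall>p\<in>Dcar n. R (invol A) (G p) = G (Drep n ?k (?k - 1) ?k (?k - 1) A p)"
      by (elim exE conjE)
    from twisted_decomp[OF G]
    have "\<forall>A\<in>gl2. \<forall>p\<in>Dcar n. R A (G p) = G (Drep n (m - 1) m m (m - 1) A p)" by (simp add: True)
    from swap_decomp[OF G(1,2) this] show ?thesis .
  qed
  then obtain G where "lin G" "bij_betw G (Dcar n) S" "\<forall>A\<in>gl2. \<forall>p\<in>Dcar n. R A (G p) = G (Drep n m (m - 1) m (m - 1) A p)"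
    by (elim exE conjE)
  from decomp_iso[OF R this iso] show ?thesis .
qed

theorem proposition2p6:
  shows "(\<forall>l1 l2 :: complex. (l1, l2) \<in> Pplus Borel1 \<longrightarrow>
      module_iso gl2 (kac_module Borel1 (l1, l2))
        (direct_sum ([L_gl (l1, l2), L_gl (l1 - 1, l2), L_gl (l1, l2 + 1)]
           @ replicate (1 - of_bool (l2 = 0)) (L_gl (l1 - 1, l2 - 1)))))
    \<and> (\<forall>l1 l2 :: complex. (l1, l2) \<in> Pplus Borel3 \<longrightarrow>
      module_iso gl2 (kac_module Borel3 (l1, l2))
        (direct_sum ([L_gl (l1, l2), L_gl (l1 + 1, l2), L_gl (l1 + 1, l2 + 1)]
           @ replicate (1 - of_bool (l2 = 0)) (L_gl (l1, l2 - 1)))))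
    \<and> (\<forall>l1 l2 :: complex. (l1, l2) \<in> Pplus Borel2 \<and> (l1, l2) \<noteq> (0, 0) \<longrightarrow>
      module_iso gl2 (kac_module Borel2 (l1, l2))
        (direct_sum ([L_gl (l1, l2 - 1), L_gl (l1 - 1, l2 - 1), L_gl (l1, l2)]
           @ replicate (1 - of_bool (l2 = 1)) (L_gl (l1 - 1, l2 - 2)))))"
proof (intro conjI allI impI)
  fix l1 l2 :: complex
  assume "(l1, l2) \<in> Pplus Borel1"
  then obtain n where n: "l2 = of_nat n" by (rule Pplus_dominant)
  show "module_iso gl2 (kac_module Borel1 (l1, l2))
        (direct_sum ([L_gl (l1, l2), L_gl (l1 - 1, l2), L_gl (l1, l2 + 1)]
           @ replicate (1 - of_bool (l2 = 0)) (L_gl (l1 - 1, l2 - 1))))"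
    using kac_module_Borel1_iso[of l1 n] by (simp add: n add.commute)
next
  fix l1 l2 :: complex
  assume "(l1, l2) \<in> Pplus Borel3"
  then obtain n where n: "l2 = of_nat n" by (rule Pplus_dominant)
  show "module_iso gl2 (kac_module Borel3 (l1, l2))
        (direct_sum ([L_gl (l1, l2), L_gl (l1 + 1, l2), L_gl (l1 + 1, l2 + 1)]
           @ replicate (1 - of_bool (l2 = 0)) (L_gl (l1, l2 - 1))))"
    using kac_module_Borel3_iso[of l1 n] by (simp add: n add.commute)
next
  fix l1 l2 :: complex
  assume l: "(l1, l2) \<in> Pplus Borel2 \<and> (l1, l2) \<noteq> (0, 0)"
  obtain k where k: "l2 = of_nat k" "k = 0 \<Longrightarrow> l1 = 0"
    using Pplus_dominant[of l1 l2 Borel2] l by metis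
  then obtain n where n: "k = Suc n" using l by (cases k) auto
  have e: "l2 - 1 = of_nat n" "l2 - 2 = of_nat n - 1" "l2 = of_nat (Suc n)" "l2 = 1 \<longleftrightarrow> n = 0"
    by (simp_all add: k n)
  show "module_iso gl2 (kac_module Borel2 (l1, l2))
        (direct_sum ([L_gl (l1, l2 - 1), L_gl (l1 - 1, l2 - 1), L_gl (l1, l2)]
           @ replicate (1 - of_bool (l2 = 1)) (L_gl (l1 - 1, l2 - 2))))"
    unfolding e(1,2,4) unfolding e(3) by (rule kac_module_Borel2_iso)
qed

end
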